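(* The operator $\mathrm{R}^*\mathrm{T}_{\mathrm{L}}\mathrm{R}:\mathrm{V}_h(\Sigma)\to \mathrm{V}_h(\Sigma)^*$ is invertible and $$(\mathrm{R}^*\,\mathrm{T}_{\mathrm{L}}\,\mathrm{R})^{-1} = \mathcal{B}\,\mathcal{L}^{-1}\,\mathcal{B}^*.$$
   Context: Duality: for a (complex) finite-dimensional space $\mathrm{H}$, $\mathrm{H}^*$ is the space of linear forms on $\mathrm{H}$, $\langle\varphi,v\rangle=\varphi(v)$ is the duality pairing (bilinear, no complex conjugation), and for linear $\mathrm{A}:\mathrm{V}\to\mathrm{H}$ the dual map $\mathrm{A}^*:\mathrm{H}^*\to\mathrm{V}^*$ is defined by $\langle \mathrm{A}^*\varphi,u\rangle=\langle\varphi,\mathrm{A}u\rangle$. Geometry: $\Omega\subset\mathbb{R}^3$ is a bounded polyhedral domain with a regular (conforming) tetrahedral triangulation $\mathcal{T}_h(\Omega)$ (no shape-regularity required). $\overline{\Omega}=\cup_{j=1}^{J}\overline{\Omega}_j$ where the $\Omega_j\subset\Omega$ are pairwise disjoint polyhedral domains, each exactly resolved by the triangulation (i.e. $\overline{\Omega}_j$ is a union of closed mesh elements). $\Gamma_j:=\partial\Omega_j$ and $\Sigma:=\cup_{j=1}^J\Gamma_j$ (the skeleton). Spaces: $\mathrm{V}_h(\Omega):=\{v\in \mathrm{H}^1(\Omega): v|_\tau\in\mathbb{P}_1(\tau)\ \forall\tau\in\mathcal{T}_h(\Omega)\}$ (complex-valued continuous piecewise linear functions), $\mathrm{V}_h(\Omega_j):=\{v|_{\Omega_j}: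 v\in \mathrm{V}_h(\Omega)\}$, $\mathrm{V}_h(\Gamma_j):=\{v|_{\Gamma_j}: v\in \mathrm{V}_h(\Omega)\}$, $\mathrm{V}_h(\Sigma):=\{v|_\Sigma: v\in \mathrm{V}_h(\Omega)\}$, $\mathbb{V}_h(\Omega):=\mathrm{V}_h(\Omega_1)\times\cdots\times \mathrm{V}_h(\Omega_J)$, $\mathbb{V}_h(\Sigma):=\mathrm{V}_h(\Gamma_1)\times\cdots\times \mathrm{V}_h(\Gamma_J)$. Trace and restriction maps: $\mathcal{B}:\mathrm{V}_h(\Omega)\to \mathrm{V}_h(\Sigma)$, $\mathcal{B}(u):=u|_\Sigma$; $\mathrm{B}:\mathbb{V}_h(\Omega)\to\mathbb{V}_h(\Sigma)$, $\mathrm{B}(v_1,\dots,v_J):=(v_1|_{\Gamma_1},\dots,v_J|_{\Gamma_J})$; $\mathrm{R}:\mathrm{V}_h(\Sigma)\to\mathbb{V}_h(\Sigma)$, $\mathrm{R}(p):=(p|_{\Gamma_1},\dots,p|_{\Gamma_J})$. Operators: $\alpha,\beta:\Omega\to(0,+\infty)$ are measurable with $\alpha_-\le\alpha(\boldsymbol{x})\le\alpha_+$ and $\beta_-\le\beta(\boldsymbol{x})\le\beta_+$ for all $\boldsymbol{x}\in\Omega$, for constants $\alpha_\pm,\beta_\pm>0$. $\mathcal{L}:\mathrm{V}_h(\Omega)\to \mathrm{V}_h(\Omega)^*$ is defined by $\langle\mathcal{L}(u),v\rangle:=\int_\Omega \alpha\nabla u\cdot\nabla v+\beta uv\,d\boldsymbol{x}$.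 $\mathrm{L}=\mathrm{diag}(\mathrm{L}_{\Omega_1},\dots,\mathrm{L}_{\Omega_J}):\mathbb{V}_h(\Omega)\to\mathbb{V}_h(\Omega)^*$ is block-diagonal with $\langle \mathrm{L}_{\Omega_j}u,v\rangle:=\int_{\Omega_j}\alpha\nabla u\cdot\nabla v+\beta uv\,d\boldsymbol{x}$. $\mathrm{T}_{\mathrm{L}}:\mathbb{V}_h(\Sigma)\to\mathbb{V}_h(\Sigma)^*$ is defined by $\mathrm{T}_{\mathrm{L}}^{-1}:=\mathrm{B}\,\mathrm{L}^{-1}\,\mathrm{B}^*$. *)

theory Defs
  imports "HOL-Analysis.Analysis" "HOL-Library.Function_Algebras"
begin

text \<open>
  Conventions. All function spaces are sets of total functions \<^typ>\<open>real^3 \<Rightarrow> complex\<close> that vanish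
  outside the set on which the functions live, so each element has exactly one representative.
  A function on a domain \<open>D\<close> is represented on \<open>closure D\<close>: finite element functions extend
  uniquely by continuity, and their traces on \<open>frontier D\<close> are then ordinary restrictions.
  Tuples indexed by the subdomains are functions on a finite index type \<open>'j\<close>, so the
  number of subdomains is \<open>CARD('j)\<close>. Addition of functions and tuples is pointwise.
\<close>

type_synonym field3 = "real^3 \<Rightarrow> complex"

section \<open>Geometry\<close>

text \<open>The condition \<open>interior (closure D) = D\<close> excludes slits and isolated missing points.\<close>

definition polyhedral_domain :: "(real^3) set \<Rightarrow> bool" where
  "polyhedral_domain D \<longleftrightarrow>
     D \<noteq> {} \<and> open D \<and> connected D \<and> bounded D \<and> interior (closure D) = D \<and>
     (\<exists>P. finite P \<and> (\<forall>p\<in>P. polytope p) \<and> closure D = \<Union>P)"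

text \<open>Conformity (any two elements meet in a common face) is part of \<^const>\<open>triangulation\<close>.\<close>

definition tetrahedral_mesh :: "(real^3) set set \<Rightarrow> (real^3) set \<Rightarrow> bool" where
  "tetrahedral_mesh T \<Omega> \<longleftrightarrow>
     triangulation T \<and> (\<forall>\<tau>\<in>T. 3 simplex \<tau>) \<and> \<Union>T = closure \<Omega>"

definition resolved_decomposition ::
    "(real^3) set set \<Rightarrow> (real^3) set \<Rightarrow> ('j::finite \<Rightarrow> (real^3) set) \<Rightarrow> bool" where
  "resolved_decomposition T \<Omega> \<omega> \<longleftrightarrow>
     (\<forall>j. polyhedral_domain (\<omega> j) \<and> \<omega> j \<subseteq> \<Omega>) \<and>
     (\<forall>i j. i \<noteq> j \<longrightarrow> \<omega> i \<inter> \<omega> j = {}) \<and>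
     closure \<Omega> = (\<Union>j. closure (\<omega> j)) \<and>
     (\<forall>j. \<exists>S\<subseteq>T. closure (\<omega> j) = \<Union>S)"

definition skeleton :: "('j \<Rightarrow> (real^3) set) \<Rightarrow> (real^3) set" where
  "skeleton \<omega> = (\<Union>j. frontier (\<omega> j))"

section \<open>The Sobolev space \<open>H\<^sup>1\<close>\<close>

definition partial :: "3 \<Rightarrow> (real^3 \<Rightarrow> real) \<Rightarrow> real^3 \<Rightarrow> real" where
  "partial i \<phi> x = frechet_derivative \<phi> (at x) (axis i 1)"

primrec Ck :: "nat \<Rightarrow> (real^3 \<Rightarrow> real) \<Rightarrow> bool" where
  "Ck 0 \<phi> \<longleftrightarrow> continuous_on UNIV \<phi>"
| "Ck (Suc k) \<phi> \<longleftrightarrow> (\<forall>x. \<phi> differentiable (at x)) \<and> (\<forall>i. Ck k (partial i \<phi>))"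

definition test_functions :: "(real^3) set \<Rightarrow> (real^3 \<Rightarrow> real) set" where
  "test_functions D =
     {\<phi>. (\<forall>k. Ck k \<phi>) \<and> compact (closure {x. \<phi> x \<noteq> 0}) \<and> closure {x. \<phi> x \<noteq> 0} \<subseteq> D}"

definition L2 :: "(real^3) set \<Rightarrow> (real^3 \<Rightarrow> 'b::euclidean_space) set" where
  "L2 D = {u. u \<in> borel_measurable (lebesgue_on D) \<and>
              integrable (lebesgue_on D) (\<lambda>x. (norm (u x))\<^sup>2)}"

definition has_weak_gradient :: "(real^3) set \<Rightarrow> field3 \<Rightarrow> (real^3 \<Rightarrow> complex^3) \<Rightarrow> bool" where
  "has_weak_gradient D u g \<longleftrightarrow> g \<in> L2 D \<and>
     (\<forall>\<phi>\<in>test_functions D. \<forall>i.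
        (LINT x|lebesgue_on D. u x * of_real (partial i \<phi> x)) =
        - (LINT x|lebesgue_on D. g x $ i * of_real (\<phi> x)))"

definition H1 :: "(real^3) set \<Rightarrow> field3 set" where
  "H1 D = {u \<in> L2 D. \<exists>g. has_weak_gradient D u g}"

text \<open>The weak gradient is unique only almost everywhere; below it occurs only under integrals.\<close>

definition weak_gradient :: "(real^3) set \<Rightarrow> field3 \<Rightarrow> real^3 \<Rightarrow> complex^3" where
  "weak_gradient D u = (SOME g. has_weak_gradient D u g)"

section \<open>Finite element spaces\<close>

definition P1_on :: "(real^3) set \<Rightarrow> field3 \<Rightarrow> bool" where
  "P1_on \<tau> v \<longleftrightarrow> (\<exists>a (b::complex^3). \<forall>x\<in>\<tau>. v x = a + (\<Sum>i\<in>UNIV. b $ i * of_real (x $ i)))"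

text \<open>
  As \<open>v\<close> is a pointwise function and the elements \<open>\<tau>\<close> are closed, the condition on the
  elements makes \<open>v\<close> continuous on \<open>closure \<Omega>\<close>.
\<close>

definition Vh :: "(real^3) set set \<Rightarrow> (real^3) set \<Rightarrow> field3 set" where
  "Vh T \<Omega> = {v \<in> H1 \<Omega>. (\<forall>\<tau>\<in>T. P1_on \<tau> v) \<and> (\<forall>x. x \<notin> closure \<Omega> \<longrightarrow> v x = 0)}"

definition restr :: "(real^3) set \<Rightarrow> field3 \<Rightarrow> field3" where
  "restr D v = (\<lambda>x. if x \<in> D then v x else 0)"

definition Vh_restr :: "(real^3) set set \<Rightarrow> (real^3) set \<Rightarrow> (real^3) set \<Rightarrow> field3 set" where
  "Vh_restr T \<Omega> D = restr D ` Vh T \<Omega>"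

definition Vh_skel ::
    "(real^3) set set \<Rightarrow> (real^3) set \<Rightarrow> ('j \<Rightarrow> (real^3) set) \<Rightarrow> field3 set" where
  "Vh_skel T \<Omega> \<omega> = Vh_restr T \<Omega> (skeleton \<omega>)"

definition VVh_vol ::
    "(real^3) set set \<Rightarrow> (real^3) set \<Rightarrow> ('j::finite \<Rightarrow> (real^3) set) \<Rightarrow> ('j \<Rightarrow> field3) set" where
  "VVh_vol T \<Omega> \<omega> = {v. \<forall>j. v j \<in> Vh_restr T \<Omega> (closure (\<omega> j))}"

definition VVh_skel ::
    "(real^3) set set \<Rightarrow> (real^3) set \<Rightarrow> ('j::finite \<Rightarrow> (real^3) set) \<Rightarrow> ('j \<Rightarrow> field3) set" where
  "VVh_skel T \<Omega> \<omega> = {p. \<forall>j. p j \<in> Vh_restr T \<Omega> (frontier (\<omega> j))}"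

section \<open>Duality\<close>

definition scale_field :: "complex \<Rightarrow> field3 \<Rightarrow> field3" where
  "scale_field c u = (\<lambda>x. c * u x)"

definition scale_tuple :: "complex \<Rightarrow> ('j \<Rightarrow> field3) \<Rightarrow> 'j \<Rightarrow> field3" where
  "scale_tuple c u = (\<lambda>j. scale_field c (u j))"

definition dual_space ::
    "(complex \<Rightarrow> 'v::plus \<Rightarrow> 'v) \<Rightarrow> 'v set \<Rightarrow> ('v \<Rightarrow> complex) set" where
  "dual_space scl H =
     {\<phi>. (\<forall>u\<in>H. \<forall>v\<in>H. \<phi> (u + v) = \<phi> u + \<phi> v) \<and>
         (\<forall>c. \<forall>u\<in>H. \<phi> (scl c u) = c * \<phi> u) \<and>
         (\<forall>u. u \<notin> H \<longrightarrow> \<phi> u = 0)}"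

definition dual_map :: "'v set \<Rightarrow> ('v \<Rightarrow> 'h) \<Rightarrow> ('h \<Rightarrow> complex) \<Rightarrow> 'v \<Rightarrow> complex" where
  "dual_map V A \<phi> = (\<lambda>u. if u \<in> V then \<phi> (A u) else 0)"

section \<open>Trace and restriction maps\<close>

definition trace_glob :: "('j \<Rightarrow> (real^3) set) \<Rightarrow> field3 \<Rightarrow> field3" where
  "trace_glob \<omega> u = restr (skeleton \<omega>) u"

definition trace_loc :: "('j \<Rightarrow> (real^3) set) \<Rightarrow> ('j \<Rightarrow> field3) \<Rightarrow> 'j \<Rightarrow> field3" where
  "trace_loc \<omega> v = (\<lambda>j. restr (frontier (\<omega> j)) (v j))"

definition skel_restr :: "('j \<Rightarrow> (real^3) set) \<Rightarrow> field3 \<Rightarrow> 'j \<Rightarrow> field3" where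
  "skel_restr \<omega> p = (\<lambda>j. restr (frontier (\<omega> j)) p)"

section \<open>Operators\<close>

definition energy ::
    "(real^3 \<Rightarrow> real) \<Rightarrow> (real^3 \<Rightarrow> real) \<Rightarrow> (real^3) set \<Rightarrow> field3 \<Rightarrow> field3 \<Rightarrow> complex" where
  "energy \<alpha> \<beta> D u v =
     (LINT x|lebesgue_on D.
        of_real (\<alpha> x) * (\<Sum>i\<in>UNIV. weak_gradient D u x $ i * weak_gradient D v x $ i)
        + of_real (\<beta> x) * u x * v x)"

definition energy_op ::
    "(real^3 \<Rightarrow> real) \<Rightarrow> (real^3 \<Rightarrow> real) \<Rightarrow> (real^3) set \<Rightarrow> field3 set \<Rightarrow>
     field3 \<Rightarrow> field3 \<Rightarrow> complex" where
  "energy_op \<alpha> \<beta> D V u = (\<lambda>v. if v \<in> V then energy \<alpha> \<beta> D u v else 0)"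

definition L_glob ::
    "(real^3) set set \<Rightarrow> (real^3) set \<Rightarrow> (real^3 \<Rightarrow> real) \<Rightarrow> (real^3 \<Rightarrow> real) \<Rightarrow>
     field3 \<Rightarrow> field3 \<Rightarrow> complex" where
  "L_glob T \<Omega> \<alpha> \<beta> = energy_op \<alpha> \<beta> \<Omega> (Vh T \<Omega>)"

definition L_sub ::
    "(real^3) set set \<Rightarrow> (real^3) set \<Rightarrow> ('j \<Rightarrow> (real^3) set) \<Rightarrow> (real^3 \<Rightarrow> real) \<Rightarrow>
     (real^3 \<Rightarrow> real) \<Rightarrow> 'j \<Rightarrow> field3 \<Rightarrow> field3 \<Rightarrow> complex" where
  "L_sub T \<Omega> \<omega> \<alpha> \<beta> j = energy_op \<alpha> \<beta> (\<omega> j) (Vh_restr T \<Omega> (closure (\<omega> j)))"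

text \<open>
  The dual of a product is identified with the product of the duals, so a block-diagonal
  operator pairs two tuples by summing the pairings of the components.
\<close>

definition L_loc ::
    "(real^3) set set \<Rightarrow> (real^3) set \<Rightarrow> ('j::finite \<Rightarrow> (real^3) set) \<Rightarrow> (real^3 \<Rightarrow> real) \<Rightarrow>
     (real^3 \<Rightarrow> real) \<Rightarrow> ('j \<Rightarrow> field3) \<Rightarrow> ('j \<Rightarrow> field3) \<Rightarrow> complex" where
  "L_loc T \<Omega> \<omega> \<alpha> \<beta> u =
     (\<lambda>v. if v \<in> VVh_vol T \<Omega> \<omega> then \<Sum>j\<in>UNIV. L_sub T \<Omega> \<omega> \<alpha> \<beta> j (u j) (v j) else 0)"

definition TL_inv ::
    "(real^3) set set \<Rightarrow> (real^3) set \<Rightarrow> ('j::finite \<Rightarrow> (real^3) set) \<Rightarrow> (real^3 \<Rightarrow> real) \<Rightarrow>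
     (real^3 \<Rightarrow> real) \<Rightarrow> (('j \<Rightarrow> field3) \<Rightarrow> complex) \<Rightarrow> 'j \<Rightarrow> field3" where
  "TL_inv T \<Omega> \<omega> \<alpha> \<beta> =
     trace_loc \<omega> \<circ> inv_into (VVh_vol T \<Omega> \<omega>) (L_loc T \<Omega> \<omega> \<alpha> \<beta>)
       \<circ> dual_map (VVh_vol T \<Omega> \<omega>) (trace_loc \<omega>)"

definition TL ::
    "(real^3) set set \<Rightarrow> (real^3) set \<Rightarrow> ('j::finite \<Rightarrow> (real^3) set) \<Rightarrow> (real^3 \<Rightarrow> real) \<Rightarrow>
     (real^3 \<Rightarrow> real) \<Rightarrow> ('j \<Rightarrow> field3) \<Rightarrow> ('j \<Rightarrow> field3) \<Rightarrow> complex" where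
  "TL T \<Omega> \<omega> \<alpha> \<beta> =
     inv_into (dual_space scale_tuple (VVh_skel T \<Omega> \<omega>)) (TL_inv T \<Omega> \<omega> \<alpha> \<beta>)"

text \<open>The operator \<open>R\<^sup>* T\<^sub>L R\<close>.\<close>

definition RTR ::
    "(real^3) set set \<Rightarrow> (real^3) set \<Rightarrow> ('j::finite \<Rightarrow> (real^3) set) \<Rightarrow> (real^3 \<Rightarrow> real) \<Rightarrow>
     (real^3 \<Rightarrow> real) \<Rightarrow> field3 \<Rightarrow> field3 \<Rightarrow> complex" where
  "RTR T \<Omega> \<omega> \<alpha> \<beta> =
     dual_map (Vh_skel T \<Omega> \<omega>) (skel_restr \<omega>) \<circ> TL T \<Omega> \<omega> \<alpha> \<beta> \<circ> skel_restr \<omega>"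

end

theory Submission
  imports Defs
begin

text \<open>
  For surjective \<open>b : V \<rightarrow> X\<close> and a definite symmetric form \<open>a\<close> on \<open>V\<close>, with \<open>L u = a(u, \<cdot>)\<close>, the operator
  \<open>S = b L\<inverse> b\<^sup>* : X\<^sup>* \<rightarrow> X\<close> is bijective and \<open>S \<psi> = p\<close> holds iff some \<open>w\<close> with \<open>b w = p\<close> satisfies
  \<open>a(w, v) = \<psi>(b v)\<close> for all \<open>v\<close>. Applied to the broken space, \<open>\<psi> = T\<^sub>L R p\<close> comes with a tuple \<open>w\<close> whose
  traces are \<open>R p\<close>. Such a tuple glues to a global finite element function \<open>u\<close> with trace \<open>p\<close>. Testing
  with restrictions of global functions and adding up the energies gives \<open>a(u, v) = (R\<^sup>* T\<^sub>L R p)(v|\<^sub>\<Sigma>)\<close>,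
  which says that the global operator \<open>S\<close> maps \<open>R\<^sup>* T\<^sub>L R p\<close> to \<open>p\<close>.
\<close>

section \<open>Bilinear forms and traces\<close>

text \<open>The pairings are bilinear over the complex numbers, so \<open>a v v\<close> may vanish
  for nonzero \<open>v\<close>; definiteness is available only in the form that
  \<open>a v (conj v) = 0\<close> implies \<open>v = 0\<close>. This is why a conjugation runs
  through the abstract part and why the kernel of \<open>b\<close> has to be stable under it. Finite
  dimension enters through a finite separating family of linear forms, the values at the nodes of
  the mesh, from which solvability of the weak equations is derived. The analytic work has two
  sources. \<open>weak_gradient\<close> is an arbitrary choice, made anew for each domain, so
  bilinearity of the energy and its additivity over subdomains both rest on almost everywhere
  uniqueness, hence on the fundamental lemma. And \<open>Vh\<close> is contained in
  \<open>H1\<close> by definition, so a function assembled from pieces must be shown to be weakly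
  differentiable across the interfaces. This is reduced to the extension by zero of a function
  vanishing on the boundary of one subdomain, which is Lipschitz and piecewise linear; its gradient
  is then a limit of difference quotients.\<close>

definition linear_form_on :: "(complex \<Rightarrow> 'v::plus \<Rightarrow> 'v) \<Rightarrow> 'v set \<Rightarrow> ('v \<Rightarrow> complex) \<Rightarrow> bool" where
  "linear_form_on scl H f \<longleftrightarrow>
     (\<forall>u\<in>H. \<forall>v\<in>H. f (u + v) = f u + f v) \<and> (\<forall>c. \<forall>u\<in>H. f (scl c u) = c * f u)"

lemma linear_form_on_add:
  "linear_form_on scl H f \<Longrightarrow> u \<in> H \<Longrightarrow> v \<in> H \<Longrightarrow> f (u + v) = f u + f v"
  by (simp add: linear_form_on_def)

lemma linear_form_on_scale:
  "linear_form_on scl H f \<Longrightarrow> u \<in> H \<Longrightarrow> f (scl c u) = c * f u"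
  by (simp add: linear_form_on_def)

text \<open>The reason for a notion next to \<open>dual_space\<close>: an element of the dual of
  \<open>H\<close> may be nonzero on \<open>H - K\<close>, so it does not belong to the dual of
  \<open>K\<close>, while the inductions below keep passing to smaller subspaces.\<close>

lemma linear_form_on_subset: "linear_form_on scl H f \<Longrightarrow> K \<subseteq> H \<Longrightarrow> linear_form_on scl K f"
  unfolding linear_form_on_def by blast

lemma linear_form_on_dual_space: "f \<in> dual_space scl H \<Longrightarrow> linear_form_on scl H f"
  by (simp add: linear_form_on_def dual_space_def)

context vector_space
begin

text \<open>The scaling \<open>sc\<close> of the target is arbitrary up to its value at 0, so that
  one lemma serves linear forms as well as the trace map into a type that carries no vector space
  axioms.\<close>

lemma subspace_kernel:
  assumes "subspace H" "\<And>u v. u \<in> H \<Longrightarrow> v \<in> H \<Longrightarrow> f (u + v) = f u + f v"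
    and "\<And>c u. u \<in> H \<Longrightarrow> f (scale c u) = sc c (f u)" and "\<And>c. sc c (0::'c::ab_group_add) = 0"
  shows "subspace {v \<in> H. f v = 0}"
proof (rule subspaceI)
  have "f (0 + 0) = f 0 + f 0"
    using assms(1,2) subspace_0 by blast
  then have "f 0 = 0"
    by simp
  then show "0 \<in> {v \<in> H. f v = 0}"
    using assms(1) subspace_0 by simp
next
  fix u v assume "u \<in> {v \<in> H. f v = 0}" "v \<in> {v \<in> H. f v = 0}"
  then show "u + v \<in> {v \<in> H. f v = 0}"
    using assms(1,2) subspace_add by simp
next
  fix c u assume "u \<in> {v \<in> H. f v = 0}"
  then show "scale c u \<in> {v \<in> H. f v = 0}"
    using assms(1,3,4) subspace_scale by simp
qed

end

section \<open>Linear forms on a subspace separated by finitely many functionals\<close>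

context
  fixes scl :: "complex \<Rightarrow> 'v::ab_group_add \<Rightarrow> 'v"
  assumes vs: "vector_space scl"
begin

interpretation vector_space scl by (rule vs)

lemma linear_form_on_0: "subspace H \<Longrightarrow> linear_form_on scl H f \<Longrightarrow> f 0 = 0"
  using linear_form_on_scale[of scl H f 0 0] subspace_0 by simp

lemma linear_form_on_diff:
  assumes "subspace H" "linear_form_on scl H f" "u \<in> H" "v \<in> H"
  shows "f (u - v) = f u - f v"
proof -
  have "f (u - v + v) = f (u - v) + f v"
    using assms by (intro linear_form_on_add) (auto intro: subspace_diff)
  then show ?thesis by simp
qed

lemma linear_form_on_sum:
  assumes "subspace H" "linear_form_on scl H f" "\<And>i. i \<in> I \<Longrightarrow> w i \<in> H"
  shows "f (sum w I) = (\<Sum>i\<in>I. f (w i))"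
  using assms(3)
proof (induction I rule: infinite_finite_induct)
  case (insert i I)
  have "f (w i + sum w I) = f (w i) + f (sum w I)"
    using insert.prems assms(1,2) by (intro linear_form_on_add) (auto intro: subspace_sum)
  then show ?case using insert by simp
qed (use assms linear_form_on_0 in auto)

lemma subspace_kernel_form:
  "subspace H \<Longrightarrow> linear_form_on scl H f \<Longrightarrow> subspace {v \<in> H. f v = 0}"
  by (rule subspace_kernel[where sc="(*)"]) (auto simp: linear_form_on_def)

text \<open>Induction on the number of forms: the kernel of one form is a smaller subspace on which
  the remaining forms suffice, and passing back to \<open>H\<close> adds at most one dimension,
  which fixes one more coefficient.\<close>

lemma linear_form_combination:
  assumes "finite I" "subspace H" "\<And>i. i \<in> I \<Longrightarrow> linear_form_on scl H (f i)"
    and "linear_form_on scl H \<phi>"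
    and "\<And>v. v \<in> H \<Longrightarrow> (\<forall>i\<in>I. f i v = 0) \<Longrightarrow> \<phi> v = 0"
  shows "\<exists>c. \<forall>v\<in>H. \<phi> v = (\<Sum>i\<in>I. c i * f i v)"
  using assms
proof (induction I arbitrary: H rule: finite_induct)
  case empty
  then show ?case by simp
next
  case (insert j I)
  let ?K = "{v \<in> H. f j v = 0}"
  have K: "subspace ?K"
    using insert.prems by (intro subspace_kernel_form) auto
  have "\<exists>c. \<forall>v\<in>?K. \<phi> v = (\<Sum>i\<in>I. c i * f i v)"
    using insert.prems K by (intro insert.IH) (auto intro: linear_form_on_subset)
  then obtain c where c: "\<And>v. v \<in> H \<Longrightarrow> f j v = 0 \<Longrightarrow> \<phi> v = (\<Sum>i\<in>I. c i * f i v)"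
    by blast
  have fj: "linear_form_on scl H (f j)" using insert.prems by auto
  show ?case
  proof (cases "\<exists>v\<in>H. f j v \<noteq> 0")
    case False
    then show ?thesis using c insert by (intro exI[of _ c]) auto
  next
    case True
    then obtain w where w: "w \<in> H" "f j w \<noteq> 0" by blast
    \<comment> \<open>The value that makes both sides agree at \<open>w\<close>. Every vector is a
      multiple of \<open>w\<close> plus an element of the kernel of \<open>f j\<close>, where they
      agree already.\<close>
    define d where "d = (\<phi> w - (\<Sum>i\<in>I. c i * f i w)) / f j w"
    have "\<phi> v = (\<Sum>i\<in>insert j I. (c(j := d)) i * f i v)" if v: "v \<in> H" for v
    proof -
      let ?t = "f j v / f j w"
      have tw: "scl ?t w \<in> H" using w insert.prems(1) subspace_scale by blast
      let ?r = "v - scl ?t w"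
      have r: "?r \<in> H" using v tw insert.prems(1) subspace_diff by blast
      have e: "g ?r = g v - ?t * g w" if "linear_form_on scl H g" for g
        using linear_form_on_diff[OF insert.prems(1) that v tw] linear_form_on_scale[OF that w(1)]
        by simp
      have "\<phi> v - ?t * \<phi> w = (\<Sum>i\<in>I. c i * f i ?r)"
        using c[OF r] e[OF insert.prems(3)] e[OF fj] w by simp
      also have "\<dots> = (\<Sum>i\<in>I. c i * (f i v - ?t * f i w))"
        using insert.prems(2) by (intro sum.cong) (auto simp: e)
      also have "\<dots> = (\<Sum>i\<in>I. c i * f i v) - ?t * (\<Sum>i\<in>I. c i * f i w)"
        by (simp add: algebra_simps sum_subtractf sum_distrib_left)
      finally have "\<phi> v = (\<Sum>i\<in>I. c i * f i v) + d * f j v"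
        using w by (simp add: d_def field_simps)
      also have "(\<Sum>i\<in>I. c i * f i v) = (\<Sum>i\<in>I. (c(j := d)) i * f i v)"
        using insert.hyps by (intro sum.cong) auto
      finally show ?thesis using insert.hyps by simp
    qed
    then show ?thesis by blast
  qed
qed

text \<open>Each functional of the family either vanishes on the current subspace or splits off a
  single vector; when none is left, separation leaves only 0.\<close>

lemma finite_spanning_set:
  assumes "finite F" "subspace H" "\<And>f. f \<in> F \<Longrightarrow> linear_form_on scl H f"
    and "\<And>v. v \<in> H \<Longrightarrow> (\<forall>f\<in>F. f v = 0) \<Longrightarrow> v = 0"
  shows "\<exists>S. finite S \<and> S \<subseteq> H \<and> H \<subseteq> span S"
  using assms
proof (induction F arbitrary: H rule: finite_induct)
  case empty
  then have "H \<subseteq> {0}" by auto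
  then show ?case by (intro exI[of _ "{}"]) auto
next
  case (insert f F)
  let ?K = "{v \<in> H. f v = 0}"
  have K: "subspace ?K"
    using insert.prems by (intro subspace_kernel_form) auto
  have "\<exists>S. finite S \<and> S \<subseteq> ?K \<and> ?K \<subseteq> span S"
    using insert.prems K by (intro insert.IH) (auto intro: linear_form_on_subset)
  then obtain S where S: "finite S" "S \<subseteq> ?K" "?K \<subseteq> span S" by blast
  show ?case
  proof (cases "\<exists>v\<in>H. f v \<noteq> 0")
    case False
    then show ?thesis using S by (intro exI[of _ S]) auto
  next
    case True
    then obtain w where w: "w \<in> H" "f w \<noteq> 0" by blast
    have "v \<in> span (insert w S)" if v: "v \<in> H" for v
    proof -
      let ?t = "f v / f w"
      have f: "linear_form_on scl H f" using insert.prems by auto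
      have tw: "scl ?t w \<in> H" using w insert.prems(1) subspace_scale by blast
      have "v - scl ?t w \<in> ?K"
        using v tw w insert.prems(1) linear_form_on_diff[OF insert.prems(1) f v tw]
          linear_form_on_scale[OF f w(1)] by (auto intro: subspace_diff)
      then have "v - scl ?t w \<in> span S" using S by blast
      then show ?thesis
        unfolding span_insert by blast
    qed
    then show ?thesis using S w by (intro exI[of _ "insert w S"]) auto
  qed
qed

text \<open>Take \<open>s\<close> from a finite spanning set. A vector annihilated by all
  \<open>a s\<close> is, by symmetry and linearity, annihilated by all of \<open>H\<close>, hence is
  0. So the forms \<open>a s\<close> satisfy the kernel condition of
  \<open>linear_form_combination\<close>, and the coefficients found there assemble the representing
  vector.\<close>

lemma nondegenerate_form_represents:
  assumes "finite F" "subspace H" "\<And>f. f \<in> F \<Longrightarrow> linear_form_on scl H f"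
    and "\<And>v. v \<in> H \<Longrightarrow> (\<forall>f\<in>F. f v = 0) \<Longrightarrow> v = 0"
    and lin: "\<And>u. u \<in> H \<Longrightarrow> linear_form_on scl H (a u)"
    and sym: "\<And>u v. u \<in> H \<Longrightarrow> v \<in> H \<Longrightarrow> a u v = a v u"
    and nondeg: "\<And>v. v \<in> H \<Longrightarrow> (\<forall>u\<in>H. a u v = 0) \<Longrightarrow> v = 0"
    and \<phi>: "linear_form_on scl H \<phi>"
  shows "\<exists>u\<in>H. \<forall>v\<in>H. a u v = \<phi> v"
proof -
  obtain S where S: "finite S" "S \<subseteq> H" "H \<subseteq> span S"
    using finite_spanning_set[OF assms(1-4)] by blast
  have "\<exists>c. \<forall>v\<in>H. \<phi> v = (\<Sum>s\<in>S. c s * a s v)"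
  proof (rule linear_form_combination[OF S(1) assms(2) _ \<phi>])
    show "linear_form_on scl H (a s)" if "s \<in> S" for s using that S lin by blast
  next
    fix v assume v: "v \<in> H" "\<forall>s\<in>S. a s v = 0"
    have sub: "subspace {u \<in> H. a v u = 0}"
      using assms(2) lin[OF v(1)] by (rule subspace_kernel_form)
    have "S \<subseteq> {u \<in> H. a v u = 0}" using v S sym by auto
    then have "span S \<subseteq> {u \<in> H. a v u = 0}" using sub by (rule span_minimal)
    then have "\<forall>u\<in>H. a u v = 0" using S(3) sym v(1) by auto
    then have "v = 0" using nondeg v by blast
    then show "\<phi> v = 0" using linear_form_on_0[OF assms(2) \<phi>] by simp
  qed
  then obtain c where c: "\<And>v. v \<in> H \<Longrightarrow> \<phi> v = (\<Sum>s\<in>S. c s * a s v)" by blast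
  let ?u = "\<Sum>s\<in>S. scl (c s) s"
  have u: "?u \<in> H" using S assms(2) by (intro subspace_sum subspace_scale) auto
  have "a ?u v = \<phi> v" if v: "v \<in> H" for v
  proof -
    have "a ?u v = a v ?u" using sym u v by blast
    also have "\<dots> = (\<Sum>s\<in>S. a v (scl (c s) s))"
      using S assms(2) by (intro linear_form_on_sum[OF assms(2) lin[OF v]] subspace_scale) auto
    also have "\<dots> = (\<Sum>s\<in>S. c s * a s v)"
      using S v sym linear_form_on_scale[OF lin[OF v]] by (intro sum.cong) (auto simp: subset_eq)
    finally show ?thesis using c v by simp
  qed
  then show ?thesis using u by blast
qed

end

text \<open>\<open>F\<close> encodes finite dimension, and \<open>conj\<close> turns the bilinear
  form into a definite one. \<open>b_conj\<close> states that the kernel of \<open>b\<close> is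
  closed under \<open>conj\<close>, which makes the form nondegenerate on that kernel too.\<close>

locale trace_form = vector_space scl
  for scl :: "complex \<Rightarrow> 'v::ab_group_add \<Rightarrow> 'v" +
  fixes scx :: "complex \<Rightarrow> 'x::ab_group_add \<Rightarrow> 'x"
    and V :: "'v set" and F :: "('v \<Rightarrow> complex) set"
    and a :: "'v \<Rightarrow> 'v \<Rightarrow> complex" and conj :: "'v \<Rightarrow> 'v" and b :: "'v \<Rightarrow> 'x"
  assumes subspace_V: "subspace V"
    and finite_F: "finite F"
    and linear_F: "f \<in> F \<Longrightarrow> linear_form_on scl V f"
    and separating_F: "v \<in> V \<Longrightarrow> (\<forall>f\<in>F. f v = 0) \<Longrightarrow> v = 0"
    and linear_a: "u \<in> V \<Longrightarrow> linear_form_on scl V (a u)"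
    and sym_a: "u \<in> V \<Longrightarrow> v \<in> V \<Longrightarrow> a u v = a v u"
    and conj_V: "v \<in> V \<Longrightarrow> conj v \<in> V"
    and definite_a: "v \<in> V \<Longrightarrow> a v (conj v) = 0 \<Longrightarrow> v = 0"
    and b_add: "u \<in> V \<Longrightarrow> v \<in> V \<Longrightarrow> b (u + v) = b u + b v"
    and b_scale: "u \<in> V \<Longrightarrow> b (scl c u) = scx c (b u)"
    and scx_0: "scx c 0 = 0"
    and b_conj: "v \<in> V \<Longrightarrow> b v = 0 \<Longrightarrow> b (conj v) = 0"
begin

definition L :: "'v \<Rightarrow> 'v \<Rightarrow> complex" where
  "L u = (\<lambda>v. if v \<in> V then a u v else 0)"

abbreviation S :: "('x \<Rightarrow> complex) \<Rightarrow> 'x" where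
  "S \<equiv> b \<circ> inv_into V L \<circ> dual_map V b"

text \<open>The conjugate of \<open>v\<close> is the test vector that proves nondegeneracy on
  \<open>H\<close>. A general \<open>H\<close> is allowed because the equation is solved both on
  \<open>V\<close> and on the kernel of \<open>b\<close>.\<close>

lemma represents:
  assumes "subspace H" "H \<subseteq> V" "\<And>v. v \<in> H \<Longrightarrow> conj v \<in> H" "linear_form_on scl H \<phi>"
  shows "\<exists>u\<in>H. \<forall>v\<in>H. a u v = \<phi> v"
proof (rule nondegenerate_form_represents[OF vector_space_axioms finite_F assms(1) _ _ _ _ _ assms(4)])
  show "linear_form_on scl H f" if "f \<in> F" for f
    using linear_F[OF that] assms(2) by (rule linear_form_on_subset)
  show "linear_form_on scl H (a u)" if "u \<in> H" for u
    using linear_a assms(2) that by (blast intro: linear_form_on_subset)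
  show "v = 0" if "v \<in> H" "\<forall>u\<in>H. a u v = 0" for v
    using that assms(2,3) sym_a definite_a by (metis subsetD)
qed (use assms(2) separating_F sym_a in blast)+

lemma b_diff: "u \<in> V \<Longrightarrow> v \<in> V \<Longrightarrow> b (u - v) = b u - b v"
  using b_add[of "u - v" v] subspace_V subspace_diff by (simp add: eq_diff_eq)

lemma a_diff:
  assumes "u \<in> V" "v \<in> V" "w \<in> V" shows "a (u - v) w = a u w - a v w"
  using assms linear_form_on_diff[OF vector_space_axioms subspace_V linear_a[OF assms(3)] assms(1,2)]
    subspace_V by (simp add: sym_a[of _ w] subspace_diff)

lemma inj_L: "inj_on L V"
proof (rule inj_onI)
  fix u v assume uv: "u \<in> V" "v \<in> V" "L u = L v"
  then have "a u w = a v w" if "w \<in> V" for w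
    using that by (auto simp: L_def fun_eq_iff split: if_splits)
  then have "a (u - v) (conj (u - v)) = 0"
    using uv subspace_V by (simp add: a_diff conj_V subspace_diff)
  then show "u = v" using definite_a[of "u - v"] uv subspace_V subspace_diff by auto
qed

lemma dual_map_b:
  assumes "\<psi> \<in> dual_space scx (b ` V)"
  obtains u where "u \<in> V" "L u = dual_map V b \<psi>" "\<And>v. v \<in> V \<Longrightarrow> a u v = \<psi> (b v)"
proof -
  have "linear_form_on scl V (\<lambda>v. \<psi> (b v))"
    using assms by (auto simp: linear_form_on_def dual_space_def b_add b_scale)
  then obtain u where u: "u \<in> V" "\<And>v. v \<in> V \<Longrightarrow> a u v = \<psi> (b v)"
    using represents[OF subspace_V] conj_V by blast
  then show ?thesis by (intro that[of u]) (auto simp: L_def dual_map_def)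
qed

lemma S_eq_iff:
  assumes \<psi>: "\<psi> \<in> dual_space scx (b ` V)"
  shows "S \<psi> = p \<longleftrightarrow> (\<exists>w\<in>V. b w = p \<and> (\<forall>v\<in>V. a w v = \<psi> (b v)))"
proof -
  obtain u where u: "u \<in> V" "L u = dual_map V b \<psi>" "\<And>v. v \<in> V \<Longrightarrow> a u v = \<psi> (b v)"
    using dual_map_b[OF \<psi>] by blast
  have *: "inv_into V L (dual_map V b \<psi>) = u"
    using u inj_L by (metis inv_into_f_f)
  have "w = u" if w: "w \<in> V" "\<forall>v\<in>V. a w v = \<psi> (b v)" for w
  proof (rule inj_onD[OF inj_L _ w(1) u(1)])
    show "L w = L u" using w(2) u(3) by (simp add: L_def fun_eq_iff)
  qed
  moreover have "S \<psi> = b u" using * by simp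
  ultimately show ?thesis using u(1,3) by metis
qed

lemma subspace_ker: "subspace {v \<in> V. b v = 0}"
  by (rule subspace_kernel[where sc=scx]) (auto simp: subspace_V b_add b_scale scx_0)

text \<open>The preimage of \<open>p\<close> is read off a lifting of \<open>p\<close> orthogonal to the kernel of \<open>b\<close>.\<close>

lemma bij_betw_S: "bij_betw S (dual_space scx (b ` V)) (b ` V)"
proof (rule bij_betwI')
  fix \<phi> \<psi> assume \<phi>: "\<phi> \<in> dual_space scx (b ` V)" and \<psi>: "\<psi> \<in> dual_space scx (b ` V)"
  show "S \<phi> = S \<psi> \<longleftrightarrow> \<phi> = \<psi>"
  proof
    assume "S \<phi> = S \<psi>"
    then obtain u w where u: "u \<in> V" "b u = S \<psi>" "\<And>v. v \<in> V \<Longrightarrow> a u v = \<phi> (b v)"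
      and w: "w \<in> V" "b w = S \<psi>" "\<And>v. v \<in> V \<Longrightarrow> a w v = \<psi> (b v)"
      using S_eq_iff[OF \<phi>, of "S \<psi>"] S_eq_iff[OF \<psi>, of "S \<psi>"] by blast
    have d: "u - w \<in> V" "b (u - w) = 0"
      using u w subspace_V by (auto simp: subspace_diff b_diff)
    have b0: "b 0 = 0" using b_diff[OF u(1) u(1)] by simp
    \<comment> \<open>Equal images put \<open>u - w\<close> into the kernel of \<open>b\<close>, so
      its conjugate is a test vector that the functionals see only through their value at 0.\<close>
    have "b (conj (u - w)) = 0" using b_conj d by blast
    then have "a (u - w) (conj (u - w)) = \<phi> (b 0) - \<psi> (b 0)"
      using a_diff[OF u(1) w(1) conj_V[OF d(1)]] u(3) w(3) conj_V d(1) b0 by simp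
    also have "\<dots> = 0"
    proof -
      have "a u 0 = 0" "a w 0 = 0"
        by (rule linear_form_on_0[OF vector_space_axioms subspace_V linear_a] u(1) w(1))+
      then show ?thesis
        unfolding u(3)[OF subspace_0[OF subspace_V]] w(3)[OF subspace_0[OF subspace_V]] by simp
    qed
    finally have "u = w" using definite_a d by fastforce
    then have "\<phi> x = \<psi> x" if "x \<in> b ` V" for x
      using that u(3) w(3) \<open>u = w\<close> by (metis imageE)
    moreover have "\<phi> x = \<psi> x" if "x \<notin> b ` V" for x
      using that \<phi> \<psi> by (simp add: dual_space_def)
    ultimately show "\<phi> = \<psi>" by blast
  qed simp
next
  fix \<psi> assume "\<psi> \<in> dual_space scx (b ` V)"
  then show "S \<psi> \<in> b ` V" using S_eq_iff by blast
next
  fix p assume "p \<in> b ` V"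
  then obtain w where w: "w \<in> V" "b w = p" by blast
  let ?K = "{v \<in> V. b v = 0}"
  \<comment> \<open>\<open>z\<close> is the \<open>a\<close>-orthogonal projection of
    \<open>w\<close> onto the kernel; subtracting it changes no trace.\<close>
  have "\<exists>z\<in>?K. \<forall>v\<in>?K. a z v = a w v"
    by (rule represents) (auto simp: subspace_ker conj_V b_conj intro: linear_form_on_subset linear_a w)
  then obtain z where z: "z \<in> V" "b z = 0" "\<And>v. v \<in> V \<Longrightarrow> b v = 0 \<Longrightarrow> a z v = a w v" by auto
  define h where "h = w - z"
  have h: "h \<in> V" "b h = p" "\<And>v. v \<in> V \<Longrightarrow> b v = 0 \<Longrightarrow> a h v = 0"
    using w z subspace_V by (auto simp: h_def subspace_diff b_diff a_diff)
  \<comment> \<open>Two preimages of \<open>q\<close> differ by a kernel element, which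
    \<open>a h\<close> annihilates; hence the arbitrary choice made by \<open>inv_into\<close> is
    harmless.\<close>
  define \<psi> where "\<psi> q = (if q \<in> b ` V then a h (inv_into V b q) else 0)" for q
  have \<psi>: "\<psi> (b v) = a h v" if v: "v \<in> V" for v
  proof -
    let ?v = "inv_into V b (b v)"
    have i: "?v \<in> V" "b ?v = b v" using v by (auto intro: inv_into_into f_inv_into_f)
    have "a h (?v - v) = 0" using h(3)[of "?v - v"] i v subspace_V by (simp add: subspace_diff b_diff)
    then show ?thesis
      using v linear_form_on_diff[OF vector_space_axioms subspace_V linear_a[OF h(1)] i(1) v]
      by (simp add: \<psi>_def)
  qed
  have "\<psi> \<in> dual_space scx (b ` V)"
    unfolding dual_space_def
  proof (intro CollectI conjI ballI allI impI)
    fix p q assume "p \<in> b ` V" "q \<in> b ` V"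
    then show "\<psi> (p + q) = \<psi> p + \<psi> q"
      using linear_form_on_add[OF linear_a[OF h(1)]] subspace_V
      by (auto simp: \<psi> subspace_add simp flip: b_add)
  next
    fix c q assume "q \<in> b ` V"
    then show "\<psi> (scx c q) = c * \<psi> q"
      using linear_form_on_scale[OF linear_a[OF h(1)]] subspace_V
      by (auto simp: \<psi> subspace_scale simp flip: b_scale)
  qed (auto simp: \<psi>_def)
  moreover from this have "S \<psi> = p" using S_eq_iff \<psi> h by auto
  ultimately show "\<exists>\<psi>\<in>dual_space scx (b ` V). p = S \<psi>" by metis
qed

end

section \<open>The fundamental lemma of the calculus of variations\<close>

text \<open>For \<open>n = 0\<close> this is the classical smooth function that is flat at 0. The
  negative powers of \<open>t\<close> are carried along because differentiation produces
  them.\<close>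

definition flat :: "nat \<Rightarrow> real \<Rightarrow> real" where
  "flat n t = (if 0 < t then exp (- (1 / t)) / t ^ n else 0)"

lemma flat_nonneg: "0 \<le> flat n t"
  by (simp add: flat_def)

lemma flat_0_le_1: "flat 0 t \<le> 1"
  by (simp add: flat_def)

lemma tendsto_flat_at_0: "((\<lambda>t. exp (- (1 / t)) / t ^ n) \<longlongrightarrow> 0) (at_right (0::real))"
proof -
  have "((\<lambda>t::real. inverse t ^ n / exp (inverse t)) \<longlongrightarrow> 0) (at_right 0)"
    by (rule filterlim_compose[OF tendsto_power_div_exp_0 filterlim_inverse_at_top_right])
  then show ?thesis
    by (simp add: exp_minus divide_simps power_inverse mult.commute)
qed

text \<open>Away from 0 this is the product rule for \<open>exp (- (1 / t)) * t powr (- n)\<close>;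
  at 0 the exponential beats every power of \<open>1 / t\<close>, so both one-sided difference
  quotients tend to 0.\<close>

lemma has_derivative_flat:
  "(flat n has_real_derivative (flat (n + 2) t - of_nat n * flat (n + 1) t)) (at t)"
proof -
  consider "t < 0" | "t = 0" | "t > 0" by linarith
  then show ?thesis
  proof cases
    case 1
    have "((\<lambda>t. 0) has_real_derivative 0) (at t)" by simp
    then have "(flat n has_real_derivative 0) (at t)"
      by (rule has_field_derivative_transform_within_open[of _ _ _ "{..<0}"])
        (use 1 in \<open>auto simp: flat_def\<close>)
    then show ?thesis using 1 by (simp add: flat_def)
  next
    case 2
    have "((\<lambda>h. (flat n (0 + h) - flat n 0) / h) \<longlongrightarrow> 0) (at 0)"
    proof (rule filterlim_split_at)
      show "((\<lambda>h. (flat n (0 + h) - flat n 0) / h) \<longlongrightarrow> 0) (at_left 0)"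
        by (rule tendsto_eventually) (auto simp: eventually_at_filter flat_def)
      \<comment> \<open>Dividing by \<open>h\<close> raises the power in the denominator from
        \<open>n\<close> to \<open>Suc n\<close>.\<close>
      show "((\<lambda>h. (flat n (0 + h) - flat n 0) / h) \<longlongrightarrow> 0) (at_right 0)"
        by (rule Lim_transform_eventually[OF tendsto_flat_at_0[of "Suc n"]])
          (auto simp: eventually_at_filter flat_def field_simps)
    qed
    then show ?thesis using 2 by (simp add: DERIV_def flat_def)
  next
    case 3
    have "((\<lambda>t. exp (- (1 / t)) / t ^ n) has_real_derivative
            (flat (n + 2) t - of_nat n * flat (n + 1) t)) (at t)"
    proof (cases n)
      case 0
      then show ?thesis using 3
        by (auto intro!: derivative_eq_intros simp: flat_def power2_eq_square)
    next
      case (Suc k)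
      have "((\<lambda>t. exp (- (1 / t)) / t ^ Suc k) has_real_derivative
          (exp (- (1 / t)) * (1 / t\<^sup>2) * t ^ Suc k - exp (- (1 / t)) * (of_nat (Suc k) * t ^ k))
          / (t ^ Suc k * t ^ Suc k)) (at t)"
        using 3 by (auto intro!: derivative_eq_intros simp del: power_Suc simp: power2_eq_square)
      moreover have "(exp (- (1 / t)) * (1 / t\<^sup>2) * t ^ Suc k - exp (- (1 / t)) * (of_nat (Suc k) * t ^ k))
          / (t ^ Suc k * t ^ Suc k) = flat (n + 2) t - of_nat n * flat (n + 1) t"
        using 3 Suc by (simp add: flat_def field_simps power2_eq_square)
      ultimately show ?thesis using Suc by simp
    qed
    then show ?thesis
      by (rule has_field_derivative_transform_within_open[of _ _ _ "{0<..}"])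
        (use 3 in \<open>auto simp: flat_def\<close>)
  qed
qed

text \<open>The derivative of \<open>flat n\<close> is a combination of \<open>flat (n + 1)\<close> and \<open>flat (n + 2)\<close>, so this algebra is
  closed under partial derivatives.\<close>

inductive_set flat_algebra :: "(real^3 \<Rightarrow> real) set" where
  base: "(\<lambda>x. flat n (s * x $ i + c)) \<in> flat_algebra"
| const: "(\<lambda>x. c) \<in> flat_algebra"
| add: "f \<in> flat_algebra \<Longrightarrow> g \<in> flat_algebra \<Longrightarrow> (\<lambda>x. f x + g x) \<in> flat_algebra"
| mult: "f \<in> flat_algebra \<Longrightarrow> g \<in> flat_algebra \<Longrightarrow> (\<lambda>x. f x * g x) \<in> flat_algebra"

lemma flat_algebra_prod:
  "(\<And>i. i \<in> I \<Longrightarrow> f i \<in> flat_algebra) \<Longrightarrow> (\<lambda>x. \<Prod>i\<in>I. f i x) \<in> flat_algebra"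
  by (induction I rule: infinite_finite_induct)
     (auto intro: flat_algebra.const flat_algebra.mult)

text \<open>Closure is claimed only for the values of the derivative at the axis vectors, since
  these are the functions \<open>partial\<close> produces; iterating then gives all orders of
  differentiability.\<close>

lemma flat_algebra_derivative:
  assumes "f \<in> flat_algebra"
  shows "\<exists>F. (\<forall>x. (f has_derivative F x) (at x)) \<and> (\<forall>i. (\<lambda>x. F x (axis i 1)) \<in> flat_algebra)"
  using assms
proof induction
  case (base n s j c)
  let ?d = "\<lambda>t. flat (n + 2) t - of_nat n * flat (n + 1) t"
  let ?F = "\<lambda>x h. ?d (s * x $ j + c) * (s * h $ j)"
  have "((\<lambda>x. flat n (s * x $ j + c)) has_derivative ?F x) (at x)" for x :: "real^3"
  proof -
    have "((\<lambda>x::real^3. s * x $ j + c) has_derivative (\<lambda>h. s * h $ j)) (at x)"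
      by (auto intro!: derivative_eq_intros bounded_linear_imp_has_derivative bounded_linear_vec_nth)
    then show ?thesis
      using has_derivative_flat[of n "s * x $ j + c", unfolded has_field_derivative_def]
        has_derivative_compose by fastforce
  qed
  moreover have "(\<lambda>x. ?F x (axis i 1)) \<in> flat_algebra" for i
  proof -
    let ?k = "s * (axis i 1 :: real^3) $ j"
    have "(\<lambda>x. (flat (n + 2) (s * x $ j + c) + (- of_nat n) * flat (n + 1) (s * x $ j + c)) * ?k)
        \<in> flat_algebra"
      by (intro flat_algebra.intros)
    then show ?thesis by simp
  qed
  ultimately show ?case by (intro exI[of _ ?F]) blast
next
  case (const c)
  show ?case by (intro exI[of _ "\<lambda>x h. 0"]) (auto intro: flat_algebra.const)
next
  case (add f g)
  then obtain F G where "\<And>x. (f has_derivative F x) (at x)" "\<And>x. (g has_derivative G x) (at x)"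
    "\<And>i. (\<lambda>x. F x (axis i 1)) \<in> flat_algebra" "\<And>i. (\<lambda>x. G x (axis i 1)) \<in> flat_algebra" by blast
  then show ?case
    by (intro exI[of _ "\<lambda>x h. F x h + G x h"])
       (auto intro!: flat_algebra.add derivative_eq_intros)
next
  case (mult f g)
  then obtain F G where "\<And>x. (f has_derivative F x) (at x)" "\<And>x. (g has_derivative G x) (at x)"
    "\<And>i. (\<lambda>x. F x (axis i 1)) \<in> flat_algebra" "\<And>i. (\<lambda>x. G x (axis i 1)) \<in> flat_algebra" by blast
  then show ?case using mult.hyps
    by (intro exI[of _ "\<lambda>x h. f x * G x h + F x h * g x"])
       (auto intro!: flat_algebra.add flat_algebra.mult derivative_eq_intros)
qed

lemma flat_algebra_Ck: "f \<in> flat_algebra \<Longrightarrow> Ck k f"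
proof (induction k arbitrary: f)
  case 0
  then obtain F where "\<And>x. (f has_derivative F x) (at x)" using flat_algebra_derivative by blast
  then show ?case
    by (auto intro!: continuous_at_imp_continuous_on has_derivative_continuous)
next
  case (Suc k)
  then obtain F where F: "\<And>x. (f has_derivative F x) (at x)"
    "\<And>i. (\<lambda>x. F x (axis i 1)) \<in> flat_algebra" using flat_algebra_derivative by blast
  have "partial i f = (\<lambda>x. F x (axis i 1))" for i
    using frechet_derivative_at[OF F(1)] by (auto simp: partial_def fun_eq_iff)
  then show ?case using F Suc.IH by (auto simp: differentiable_def)
qed

text \<open>A product of two one-sided cutoffs per coordinate, positive exactly on the open box. The
  factor \<open>Suc m\<close> steepens the flanks, so the bumps converge pointwise to the indicator
  of the box.\<close>

definition box_bump :: "real^3 \<Rightarrow> real^3 \<Rightarrow> nat \<Rightarrow> real^3 \<Rightarrow> real" where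
  "box_bump a b m x =
     (\<Prod>i\<in>UNIV. flat 0 (of_nat (Suc m) * (x $ i - a $ i)) * flat 0 (of_nat (Suc m) * (b $ i - x $ i)))"

lemma box_bump_nonneg: "0 \<le> box_bump a b m x"
  by (auto simp: box_bump_def intro!: prod_nonneg flat_nonneg mult_nonneg_nonneg)

lemma box_bump_le_1: "box_bump a b m x \<le> 1"
  unfolding box_bump_def
  by (intro prod_le_1 conjI mult_nonneg_nonneg mult_le_one flat_nonneg flat_0_le_1)

lemma box_bump_outside: "x \<notin> box a b \<Longrightarrow> box_bump a b m x = 0"
  by (auto simp: box_bump_def mem_box_cart flat_def zero_less_mult_iff)

lemma box_bump_tendsto: "(\<lambda>m. box_bump a b m x) \<longlonglongrightarrow> indicator (box a b) x"
proof (cases "x \<in> box a b")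
  case True
  have 1: "(\<lambda>m. flat 0 (of_nat (Suc m) * t)) \<longlonglongrightarrow> 1" if "t > 0" for t
  proof -
    have "(\<lambda>m. exp (- (inverse (real (Suc m)) * inverse t))) \<longlonglongrightarrow> exp (- (0 * inverse t))"
      by (intro tendsto_intros LIMSEQ_inverse_real_of_nat)
    moreover have "flat 0 (of_nat (Suc m) * t) = exp (- (inverse (real (Suc m)) * inverse t))" for m
    proof -
      have "0 < of_nat (Suc m) * t" using that by simp
      then show ?thesis by (simp only: flat_def if_True) (simp add: divide_inverse)
    qed
    ultimately show ?thesis by simp
  qed
  have "(\<lambda>m. box_bump a b m x) \<longlonglongrightarrow> (\<Prod>i\<in>(UNIV::3 set). 1 * 1)"
    unfolding box_bump_def using True
    by (intro tendsto_prod tendsto_mult 1) (auto simp: mem_box_cart)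
  then show ?thesis using True by simp
qed (simp add: box_bump_outside)

text \<open>The support may reach the boundary of the box, so the closed box has to lie in
  \<open>D\<close>.\<close>

lemma box_bump_test_function:
  assumes "cbox a b \<subseteq> D" shows "box_bump a b m \<in> test_functions D"
proof -
  have "(\<lambda>x. \<Prod>i\<in>UNIV. flat 0 (of_nat (Suc m) * x $ i + - (of_nat (Suc m) * a $ i)) *
      flat 0 (- of_nat (Suc m) * x $ i + of_nat (Suc m) * b $ i)) \<in> flat_algebra"
    by (intro flat_algebra_prod flat_algebra.intros)
  also have "(\<lambda>x. \<Prod>i\<in>UNIV. flat 0 (of_nat (Suc m) * x $ i + - (of_nat (Suc m) * a $ i)) *
      flat 0 (- of_nat (Suc m) * x $ i + of_nat (Suc m) * b $ i)) = box_bump a b m"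
    unfolding box_bump_def
    by (intro ext prod.cong arg_cong2[of _ _ _ _ "(*)"] arg_cong[of _ _ "flat 0"])
       (simp_all add: algebra_simps)
  finally have "\<forall>k. Ck k (box_bump a b m)" using flat_algebra_Ck by blast
  moreover have "closure {x. box_bump a b m x \<noteq> 0} \<subseteq> cbox a b"
    using box_bump_outside box_subset_cbox by (intro closure_minimal) (auto, blast)
  moreover from this have "compact (closure {x. box_bump a b m x \<noteq> 0})"
    using compact_cbox closed_closure by (metis compact_Int_closed inf.absorb2)
  ultimately show ?thesis using assms by (auto simp: test_functions_def)
qed

lemma test_function_continuous: "\<phi> \<in> test_functions D \<Longrightarrow> continuous_on UNIV \<phi>"
  unfolding test_functions_def using Ck.simps(1) by blast

section \<open>From vanishing integrals over boxes to vanishing almost everywhere\<close>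

lemma sigma_finite_lebesgue: "sigma_finite_measure (lebesgue :: 'a::euclidean_space measure)"
proof
  obtain A :: "'a set set" where "countable A" "A \<subseteq> sets lborel" "\<Union>A = space lborel"
    "\<forall>a\<in>A. emeasure lborel a \<noteq> \<infinity>"
    using lborel.sigma_finite_countable by blast
  then show "\<exists>A. countable A \<and> A \<subseteq> sets lebesgue \<and> \<Union> A = space lebesgue \<and>
      (\<forall>a\<in>A. emeasure (lebesgue :: 'a measure) a \<noteq> \<infinity>)"
    by (intro exI[of _ A]) (auto intro: sets_completionI_sets simp: subset_eq)
qed

text \<open>A Dynkin system argument: open boxes are stable under intersection and generate the
  Borel sets, and the sets over which \<open>f\<close> integrates to 0 are closed under complements
  and disjoint unions. Lebesgue sets differ from Borel sets by null sets.\<close>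

lemma AE_zero_if_box_integrals_zero:
  fixes f :: "'a::euclidean_space \<Rightarrow> complex"
  assumes f: "integrable lebesgue f"
    and box: "\<And>a b. (LINT x|lebesgue. indicator (box a b) x *\<^sub>R f x) = 0"
  shows "AE x in lebesgue. f x = 0"
proof (rule sigma_finite_measure.density_zero[OF sigma_finite_lebesgue f])
  have int: "integrable lebesgue (\<lambda>x. indicator A x *\<^sub>R f x)" if "A \<in> sets lebesgue" for A
    using that f by (rule integrable_mult_indicator)
  have borel_zero: "(LINT x|lebesgue. indicator A x *\<^sub>R f x) = 0" if "A \<in> sets borel" for A
  proof -
    let ?G = "range (\<lambda>(a, b). box a b :: 'a set)"
    have A: "A \<in> sigma_sets UNIV ?G" using that by (simp add: borel_eq_box)
    have stable: "Int_stable ?G"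
      by (auto simp: Int_stable_def box_Int_box)
    have sub: "sigma_sets UNIV ?G \<subseteq> sets lebesgue"
      using sets_completionI_sets[of _ lborel] by (auto simp: borel_eq_box)
    have "?G \<subseteq> Pow UNIV" by simp
    from stable this A show ?thesis
    proof (induction A rule: sigma_sets_induct_disjoint)
      case (basic A)
      then show ?case using box by auto
    next
      case empty
      then show ?case by simp
    next
      case (compl A)
      \<comment> \<open>Complements need the integral over the whole space, which is not a box; it
        is the limit of the integrals over growing cubes, dominated by the norm of
        \<open>f\<close>.\<close>
      have U: "(LINT x|lebesgue. f x) = 0"
      proof -
        have "(\<lambda>n. LINT x|lebesgue. indicator (box (- (real n *\<^sub>R One)) (real n *\<^sub>R One)) x *\<^sub>R f x)
            \<longlonglongrightarrow> (LINT x|lebesgue. f x)"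
        proof (rule integral_dominated_convergence[where w="\<lambda>x. norm (f x)"])
          show "AE x in lebesgue. (\<lambda>n. indicator (box (- (real n *\<^sub>R One)) (real n *\<^sub>R One)) x *\<^sub>R f x)
              \<longlonglongrightarrow> f x"
          proof (rule AE_I2, rule tendsto_eventually)
            fix x :: 'a
            obtain N where N: "norm x < real N" using reals_Archimedean2 by blast
            have "x \<in> box (- (real n *\<^sub>R One)) (real n *\<^sub>R One)" if "n \<ge> N" for n
            proof -
              have "\<bar>x \<bullet> i\<bar> < real n" if "i \<in> Basis" for i
                using Basis_le_norm[OF that, of x] N \<open>n \<ge> N\<close> by linarith
              then show ?thesis by (force simp: mem_box abs_less_iff)
            qed
            then show "\<forall>\<^sub>F n in sequentially.
                indicator (box (- (real n *\<^sub>R One)) (real n *\<^sub>R One)) x *\<^sub>R f x = f x"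
              by (auto simp: eventually_sequentially intro!: exI[of _ N])
          qed
          show "(\<lambda>x. indicator (box (- (real n *\<^sub>R One)) (real n *\<^sub>R One)) x *\<^sub>R f x)
              \<in> borel_measurable lebesgue" for n
            by (intro borel_measurable_integrable int) auto
        qed (use f in \<open>auto simp: indicator_def\<close>)
        then show ?thesis using box by (simp add: LIMSEQ_const_iff)
      qed
      have "(LINT x|lebesgue. indicator (UNIV - A) x *\<^sub>R f x)
          = (LINT x|lebesgue. f x - indicator A x *\<^sub>R f x)"
        by (intro Bochner_Integration.integral_cong) (auto simp: indicator_def)
      also have "\<dots> = 0"
        using compl sub U by (subst Bochner_Integration.integral_diff[OF f int]) auto
      finally show ?case .
    next
      case (union A)
      have "(LINT x:(\<Union>i. A i)|lebesgue. f x) = (\<Sum>i. (LINT x:(A i)|lebesgue. f x))"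
      proof (rule lebesgue_integral_countable_add)
        show "A i \<in> sets lebesgue" for i using union(2) sub by blast
        show "set_integrable lebesgue (\<Union>i. A i) f"
          using union(2) sub unfolding set_integrable_def by (intro int) auto
      qed (use union sub in \<open>auto simp: disjoint_family_on_def\<close>)
      then show ?case using union(3) by (simp add: set_lebesgue_integral_def)
    qed
  qed
  fix A :: "'a set" assume "A \<in> sets lebesgue"
  then obtain S N N' where A: "A = S \<union> N" "N \<subseteq> N'" "N' \<in> null_sets lborel" "S \<in> sets lborel"
    by (rule sets_completionE)
  have "AE x in lebesgue. x \<notin> N'" using A(3) by (intro AE_not_in) (rule null_sets_completionI)
  then have "AE x in lebesgue. indicator A x *\<^sub>R f x = indicator S x *\<^sub>R f x"
    by eventually_elim (use A in \<open>auto simp: indicator_def\<close>)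
  then have "(LINT x|lebesgue. indicator A x *\<^sub>R f x) = (LINT x|lebesgue. indicator S x *\<^sub>R f x)"
    using \<open>A \<in> sets lebesgue\<close> A(4) f by (intro integral_cong_AE borel_measurable_integrable int) auto
  then show "set_lebesgue_integral lebesgue A f = 0"
    using borel_zero A(4) by (simp add: set_lebesgue_integral_def)
qed

text \<open>Test functions reach only boxes whose closure lies in \<open>D\<close>, so the argument
  is local: bumps converge to the indicator of such a box, the previous lemma applies to
  \<open>h\<close> cut off to it, and countably many closed boxes exhaust \<open>D\<close>.\<close>

lemma fundamental_lemma:
  fixes h :: "real^3 \<Rightarrow> complex"
  assumes D: "open D" and h: "integrable (lebesgue_on D) h"
    and zero: "\<And>\<phi>. \<phi> \<in> test_functions D \<Longrightarrow> (LINT x|lebesgue_on D. h x * of_real (\<phi> x)) = 0"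
  shows "AE x in lebesgue_on D. h x = 0"
proof -
  have DM: "D \<inter> space lebesgue \<in> sets lebesgue" using D by simp
  have hD: "integrable lebesgue (\<lambda>x. indicator D x *\<^sub>R h x)"
    using h integrable_restrict_space[OF DM, of h] by simp
  have box0: "(LINT x|lebesgue. indicator (box a b) x *\<^sub>R h x) = 0" if ab: "cbox a b \<subseteq> D" for a b
  proof -
    have "(\<lambda>m. LINT x|lebesgue_on D. h x * of_real (box_bump a b m x))
        \<longlonglongrightarrow> (LINT x|lebesgue_on D. h x * of_real (indicator (box a b) x))"
    proof (rule integral_dominated_convergence[where w="\<lambda>x. norm (h x)"])
      have "(\<lambda>x. of_real (box_bump a b m x) :: complex) \<in> borel_measurable (lebesgue_on D)" for m
        using test_function_continuous[OF box_bump_test_function[OF ab, of m]]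
        using D by (intro continuous_imp_measurable_on_sets_lebesgue)
          (auto intro!: continuous_intros intro: continuous_on_subset)
      then show "(\<lambda>x. h x * of_real (box_bump a b m x)) \<in> borel_measurable (lebesgue_on D)" for m
        using borel_measurable_integrable[OF h] by (intro borel_measurable_times)
      have "box a b \<inter> D \<in> sets lebesgue" using D by auto
      then have "(\<lambda>x. of_real (indicator (box a b) x) :: complex) \<in> borel_measurable (lebesgue_on D)"
        by (intro measurable_restrict_space1 measurable_compose[OF _ borel_measurable_of_real]
            borel_measurable_indicator) auto
      then show "(\<lambda>x. h x * of_real (indicator (box a b) x)) \<in> borel_measurable (lebesgue_on D)"
        using borel_measurable_integrable[OF h] by (intro borel_measurable_times)
      show "AE x in lebesgue_on D. (\<lambda>m. h x * of_real (box_bump a b m x))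
          \<longlonglongrightarrow> h x * of_real (indicator (box a b) x)"
        by (intro AE_I2 tendsto_intros box_bump_tendsto)
      show "AE x in lebesgue_on D. norm (h x * of_real (box_bump a b m x)) \<le> norm (h x)" for m
        using box_bump_le_1 box_bump_nonneg
        by (intro AE_I2) (auto simp: norm_mult intro!: mult_left_le)
    qed (use h in auto)
    then have "(LINT x|lebesgue_on D. h x * of_real (indicator (box a b) x)) = 0"
      using zero[OF box_bump_test_function[OF ab]] by (simp add: LIMSEQ_const_iff)
    moreover have "(LINT x|lebesgue_on D. h x * of_real (indicator (box a b) x))
        = (LINT x|lebesgue. indicator (box a b) x *\<^sub>R h x)"
      unfolding integral_restrict_space[OF DM]
      using ab box_subset_cbox[of a b]
      by (intro Bochner_Integration.integral_cong) (auto simp: indicator_def)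
    ultimately show ?thesis by simp
  qed
  have AE_cbox: "AE x in lebesgue. x \<in> cbox a b \<longrightarrow> h x = 0" if ab: "cbox a b \<subseteq> D" for a b
  proof -
    have "AE x in lebesgue. indicator (box a b) x *\<^sub>R h x = 0"
    proof (rule AE_zero_if_box_integrals_zero)
      have "integrable lebesgue (\<lambda>x. indicator (box a b) x *\<^sub>R indicator D x *\<^sub>R h x)"
        by (rule integrable_mult_indicator[OF _ hD]) simp
      also have "(\<lambda>x. indicator (box a b) x *\<^sub>R indicator D x *\<^sub>R h x) = (\<lambda>x. indicator (box a b) x *\<^sub>R h x)"
        using ab box_subset_cbox[of a b] by (auto simp: indicator_def fun_eq_iff)
      finally show "integrable lebesgue (\<lambda>x. indicator (box a b) x *\<^sub>R h x)" .
    next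
      fix c d :: "real^3"
      obtain p q where pq: "box c d \<inter> box a b = box p q"
        using box_Int_box by blast
      show "(LINT x|lebesgue. indicator (box c d) x *\<^sub>R indicator (box a b) x *\<^sub>R h x) = 0"
      \<comment> \<open>An empty open box can have a nonempty closed counterpart, for which
        containment in \<open>D\<close> is unclear; only for a nonempty one is
        \<open>cbox p q\<close> its closure.\<close>
      proof (cases "box p q = {}")
        case True
        then have "indicator (box c d) x *\<^sub>R indicator (box a b) x *\<^sub>R h x = 0" for x
          using pq by (auto simp: indicator_def)
        then show ?thesis by (simp only: Bochner_Integration.integral_zero)
      next
        case False
        have "cbox p q = closure (box p q)" using False by simp
        also have "\<dots> \<subseteq> closure (box a b)" using pq by (intro closure_mono) auto
        also have "\<dots> \<subseteq> cbox a b" using box_subset_cbox by (intro closure_minimal) auto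
        finally have "(LINT x|lebesgue. indicator (box p q) x *\<^sub>R h x) = 0"
          using ab by (intro box0) auto
        then show ?thesis
          unfolding pq[symmetric] by (simp add: indicator_inter_arith)
      qed
    qed
    \<comment> \<open>The exhaustion of \<open>D\<close> uses closed boxes, the cutoff an open one;
      the boundary between them is a null set.\<close>
    moreover have "AE x in lebesgue. x \<notin> cbox a b - box a b"
      using negligible_frontier_interval[of a b] by (intro AE_not_in) (simp add: negligible_iff_null_sets)
    ultimately show ?thesis by eventually_elim auto
  qed
  obtain \<D> where \<D>: "countable \<D>" "\<D> \<subseteq> Pow D" "\<And>X. X \<in> \<D> \<Longrightarrow> \<exists>a b. X = cbox a b" "\<Union>\<D> = D"
    using open_countable_Union_open_cbox[OF D] by metis
  have "AE x in lebesgue. \<forall>X\<in>\<D>. x \<in> X \<longrightarrow> h x = 0"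
    unfolding AE_ball_countable[OF \<D>(1)]
  proof
    fix X assume X: "X \<in> \<D>"
    then obtain a b where ab: "X = cbox a b" using \<D>(3) by blast
    have "cbox a b \<subseteq> D" using X \<D>(2) ab by auto
    then show "AE x in lebesgue. x \<in> X \<longrightarrow> h x = 0" unfolding ab by (rule AE_cbox)
  qed
  then have "AE x in lebesgue. x \<in> D \<longrightarrow> h x = 0"
    by eventually_elim (use \<D>(4) in auto)
  then show ?thesis by (subst AE_restrict_space_iff[OF DM])
qed

section \<open>Weak gradients and the energy\<close>

lemma L2_add:
  assumes "u \<in> L2 D" "v \<in> L2 D" shows "(\<lambda>x. u x + v x) \<in> L2 D"
proof -
  have "integrable (lebesgue_on D) (\<lambda>x. (norm (u x + v x))\<^sup>2)"
  proof (rule Bochner_Integration.integrable_bound)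
    show "integrable (lebesgue_on D) (\<lambda>x. 2 * (norm (u x))\<^sup>2 + 2 * (norm (v x))\<^sup>2)"
      using assms by (auto simp: L2_def)
    show "AE x in lebesgue_on D. norm ((norm (u x + v x))\<^sup>2)
        \<le> norm (2 * (norm (u x))\<^sup>2 + 2 * (norm (v x))\<^sup>2)"
    proof (rule AE_I2)
      fix x
      have "(norm (u x + v x))\<^sup>2 \<le> (norm (u x) + norm (v x))\<^sup>2"
        by (intro power_mono norm_triangle_ineq norm_ge_zero)
      also have "\<dots> \<le> 2 * (norm (u x))\<^sup>2 + 2 * (norm (v x))\<^sup>2"
        using sum_squares_bound[of "norm (u x)" "norm (v x)"] by (simp add: power2_sum)
      finally show "norm ((norm (u x + v x))\<^sup>2) \<le> norm (2 * (norm (u x))\<^sup>2 + 2 * (norm (v x))\<^sup>2)"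
        by simp
    qed
  qed (use assms in \<open>auto simp: L2_def intro!: borel_measurable_power borel_measurable_norm borel_measurable_add\<close>)
  then show ?thesis using assms by (auto simp: L2_def)
qed

lemma L2_bounded_linear:
  assumes "u \<in> L2 D" "bounded_linear f" shows "(\<lambda>x. f (u x)) \<in> L2 D"
proof -
  obtain K where K: "\<And>x. norm (f x) \<le> norm x * K"
    using bounded_linear.bounded assms(2) by blast
  have m: "(\<lambda>x. f (u x)) \<in> borel_measurable (lebesgue_on D)"
    using assms by (intro measurable_compose[OF _ borel_measurable_continuous_onI[of f]])
      (auto simp: L2_def linear_continuous_on)
  have "integrable (lebesgue_on D) (\<lambda>x. (norm (f (u x)))\<^sup>2)"
  proof (rule Bochner_Integration.integrable_bound)
    show "integrable (lebesgue_on D) (\<lambda>x. (norm (u x))\<^sup>2 * K\<^sup>2)"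
      using assms by (auto simp: L2_def)
    show "AE x in lebesgue_on D. norm ((norm (f (u x)))\<^sup>2) \<le> norm ((norm (u x))\<^sup>2 * K\<^sup>2)"
    proof (rule AE_I2)
      fix x
      have "(norm (f (u x)))\<^sup>2 \<le> (norm (u x) * K)\<^sup>2"
        using K by (intro power_mono) auto
      then show "norm ((norm (f (u x)))\<^sup>2) \<le> norm ((norm (u x))\<^sup>2 * K\<^sup>2)"
        by (simp add: power_mult_distrib)
    qed
  qed (use m in auto)
  then show ?thesis using m by (auto simp: L2_def)
qed

lemma L2_mult_integrable:
  fixes u v :: "real^3 \<Rightarrow> complex"
  assumes "u \<in> L2 D" "v \<in> L2 D" shows "integrable (lebesgue_on D) (\<lambda>x. u x * v x)"
proof (rule Bochner_Integration.integrable_bound)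
  show "integrable (lebesgue_on D) (\<lambda>x. (norm (u x))\<^sup>2 + (norm (v x))\<^sup>2)"
    using assms by (auto simp: L2_def)
  show "AE x in lebesgue_on D. norm (u x * v x) \<le> norm ((norm (u x))\<^sup>2 + (norm (v x))\<^sup>2)"
  proof (rule AE_I2)
    fix x
    show "norm (u x * v x) \<le> norm ((norm (u x))\<^sup>2 + (norm (v x))\<^sup>2)"
      using sum_squares_bound[of "norm (u x)" "norm (v x)"]
        mult_nonneg_nonneg[OF norm_ge_zero[of "u x"] norm_ge_zero[of "v x"]]
      by (simp only: norm_mult real_norm_def)
  qed
qed (use assms in \<open>auto simp: L2_def\<close>)

lemma finite_measure_lebesgue_on: "bounded D \<Longrightarrow> open D \<Longrightarrow> finite_measure (lebesgue_on D)"
  using emeasure_bounded_finite[of D]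
  by (intro finite_measureI) (auto simp: emeasure_restrict_space)

text \<open>The bound is required only almost everywhere because the gradient of a Lipschitz
  function, taken as a limit of difference quotients, is controlled only where the limit
  exists.\<close>

lemma L2_AE_bounded_function:
  fixes u :: "real^3 \<Rightarrow> 'b::euclidean_space"
  assumes "open D" "bounded D" "u \<in> borel_measurable (lebesgue_on D)"
    and "AE x in lebesgue_on D. norm (u x) \<le> K"
  shows "u \<in> L2 D"
proof -
  interpret finite_measure "lebesgue_on D"
    using assms by (intro finite_measure_lebesgue_on)
  have "AE x in lebesgue_on D. norm ((norm (u x))\<^sup>2) \<le> K\<^sup>2"
    using assms(4) by eventually_elim (auto intro: power_mono)
  then have "integrable (lebesgue_on D) (\<lambda>x. (norm (u x))\<^sup>2)"
    using assms(3) by (intro integrable_const_bound[where B="K\<^sup>2"]) auto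
  then show ?thesis using assms by (simp add: L2_def)
qed

lemma L2_bounded_function:
  fixes u :: "real^3 \<Rightarrow> 'b::euclidean_space"
  assumes "open D" "bounded D" "u \<in> borel_measurable (lebesgue_on D)" "\<And>x. norm (u x) \<le> K"
  shows "u \<in> L2 D"
  using assms by (intro L2_AE_bounded_function[where K=K] AE_I2)

lemma continuous_compact_support_bounded:
  fixes f :: "'a::metric_space \<Rightarrow> 'b::real_normed_vector"
  assumes "continuous_on UNIV f" "compact S" "\<And>x. x \<notin> S \<Longrightarrow> f x = 0"
  shows "\<exists>K. \<forall>x. norm (f x) \<le> K"
proof -
  have "bounded (f ` S)"
    using assms by (intro compact_imp_bounded compact_continuous_image) (auto intro: continuous_on_subset)
  then obtain K where K: "\<forall>y\<in>f ` S. norm y \<le> K" unfolding bounded_iff ..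
  have "norm (f x) \<le> max 0 K" for x
  proof (cases "x \<in> S")
    case True
    then have "norm (f x) \<le> K" using K by blast
    then show ?thesis by linarith
  qed (simp add: assms)
  then show ?thesis by blast
qed

lemma test_function_compact_support:
  assumes "\<phi> \<in> test_functions D"
  shows "\<exists>S. compact S \<and> (\<forall>x. x \<notin> S \<longrightarrow> \<phi> x = 0)"
proof (intro exI conjI allI impI)
  show "compact (closure {x. \<phi> x \<noteq> 0})" using assms unfolding test_functions_def by blast
  show "\<phi> x = 0" if "x \<notin> closure {x. \<phi> x \<noteq> 0}" for x
    using that closure_subset[of "{x. \<phi> x \<noteq> 0}"] by auto
qed

lemma test_function_bounded:
  assumes "\<phi> \<in> test_functions D"
  shows "\<exists>K. \<forall>x. norm (\<phi> x) \<le> K"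
proof -
  obtain S where "compact S" "\<And>x. x \<notin> S \<Longrightarrow> \<phi> x = 0"
    using test_function_compact_support[OF assms] by blast
  then show ?thesis
    by (rule continuous_compact_support_bounded[OF test_function_continuous[OF assms]])
qed

lemma test_function_L2:
  assumes "open D" "bounded D" "\<phi> \<in> test_functions D"
  shows "(\<lambda>x. of_real (\<phi> x) :: complex) \<in> L2 D"
proof -
  obtain K where "\<And>x. norm (\<phi> x) \<le> K"
    using test_function_bounded[OF assms(3)] by blast
  then show ?thesis using assms test_function_continuous[OF assms(3)]
    by (intro L2_bounded_function[where K=K] continuous_imp_measurable_on_sets_lebesgue)
      (auto intro!: continuous_intros intro: continuous_on_subset)
qed

section \<open>Uniqueness of weak gradients and their linear operations\<close>

lemma has_weak_gradientD:
  "has_weak_gradient D u g \<Longrightarrow> \<phi> \<in> test_functions D \<Longrightarrow>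
    (LINT x|lebesgue_on D. u x * of_real (partial i \<phi> x)) = - (LINT x|lebesgue_on D. g x $ i * of_real (\<phi> x))"
  by (simp add: has_weak_gradient_def)

text \<open>Both gradients have the same pairing with every test function, so the fundamental lemma
  applies to each component of the difference.\<close>

lemma weak_gradient_AE_unique:
  assumes D: "open D" "bounded D" and g: "has_weak_gradient D u g" "has_weak_gradient D u g'"
  shows "AE x in lebesgue_on D. g x = g' x"
proof -
  have L2: "(\<lambda>x. g x $ i) \<in> L2 D" "(\<lambda>x. g' x $ i) \<in> L2 D" for i
    using g by (auto simp: has_weak_gradient_def intro: L2_bounded_linear bounded_linear_vec_nth)
  \<comment> \<open>Multiplying by 1 turns square integrability into the integrability that the
    fundamental lemma requires; this uses that \<open>D\<close> has finite measure.\<close>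
  have one: "(\<lambda>x. 1 :: complex) \<in> L2 D"
    using D by (intro L2_bounded_function[where K=1]) auto
  have "AE x in lebesgue_on D. g x $ i - g' x $ i = 0" for i
  proof (rule fundamental_lemma[OF D(1)])
    show "integrable (lebesgue_on D) (\<lambda>x. g x $ i - g' x $ i)"
      using L2_mult_integrable[OF L2(1) one] L2_mult_integrable[OF L2(2) one] by simp
  next
    fix \<phi> assume \<phi>: "\<phi> \<in> test_functions D"
    have "(LINT x|lebesgue_on D. (g x $ i - g' x $ i) * of_real (\<phi> x))
        = (LINT x|lebesgue_on D. g x $ i * of_real (\<phi> x)) - (LINT x|lebesgue_on D. g' x $ i * of_real (\<phi> x))"
      using L2_mult_integrable[OF L2(1) test_function_L2[OF D \<phi>]]
        L2_mult_integrable[OF L2(2) test_function_L2[OF D \<phi>]]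
      by (simp add: left_diff_distrib)
    also have "\<dots> = 0"
    proof -
      have "- (LINT x|lebesgue_on D. g x $ i * of_real (\<phi> x)) = (LINT x|lebesgue_on D. u x * of_real (partial i \<phi> x))"
        using g(1) \<phi> by (simp add: has_weak_gradient_def)
      also have "\<dots> = - (LINT x|lebesgue_on D. g' x $ i * of_real (\<phi> x))"
        using g(2) \<phi> by (simp add: has_weak_gradient_def)
      finally show ?thesis by simp
    qed
    finally show "(LINT x|lebesgue_on D. (g x $ i - g' x $ i) * of_real (\<phi> x)) = 0" .
  qed
  then have "AE x in lebesgue_on D. \<forall>i\<in>UNIV. g x $ i - g' x $ i = 0"
    by (intro AE_finite_allI) auto
  then show ?thesis by eventually_elim (simp add: vec_eq_iff)
qed

lemma partial_test_function_continuous: "\<phi> \<in> test_functions D \<Longrightarrow> continuous_on UNIV (partial i \<phi>)"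
proof -
  assume "\<phi> \<in> test_functions D"
  then have "Ck (Suc 0) \<phi>" unfolding test_functions_def by blast
  then show ?thesis by simp
qed

lemma partial_eq_0_outside_support:
  assumes "x \<notin> closure {x. \<phi> x \<noteq> 0}" shows "partial i \<phi> x = 0"
proof -
  have "((\<lambda>x. 0) has_derivative (\<lambda>h. 0)) (at x)" by simp
  then have "(\<phi> has_derivative (\<lambda>h. 0)) (at x)"
  proof (rule has_derivative_transform_within_open[of _ _ _ _ "- closure {x. \<phi> x \<noteq> 0}"])
    show "0 = \<phi> y" if "y \<in> - closure {x. \<phi> x \<noteq> 0}" for y
      using that closure_subset[of "{x. \<phi> x \<noteq> 0}"] by auto
  qed (use assms in auto)
  then show ?thesis using frechet_derivative_at by (metis partial_def)
qed

lemma partial_test_function_bounded: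
  assumes "\<phi> \<in> test_functions D"
  shows "\<exists>K. \<forall>x. norm (partial i \<phi> x) \<le> K"
proof (rule continuous_compact_support_bounded[OF partial_test_function_continuous[OF assms]])
  show "compact (closure {x. \<phi> x \<noteq> 0})" using assms unfolding test_functions_def by blast
qed (rule partial_eq_0_outside_support)

lemma partial_test_function_L2:
  assumes "open D" "bounded D" "\<phi> \<in> test_functions D"
  shows "(\<lambda>x. of_real (partial i \<phi> x) :: complex) \<in> L2 D"
proof -
  obtain K where "\<And>x. norm (partial i \<phi> x) \<le> K"
    using partial_test_function_bounded[OF assms(3)] by blast
  then show ?thesis using assms partial_test_function_continuous[OF assms(3)]
    by (intro L2_bounded_function[where K=K] continuous_imp_measurable_on_sets_lebesgue)
      (auto intro!: continuous_intros intro: continuous_on_subset)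
qed

lemma has_weak_gradient_add:
  assumes D: "open D" "bounded D" and uv: "u \<in> L2 D" "v \<in> L2 D"
    and g: "has_weak_gradient D u g" "has_weak_gradient D v h"
  shows "has_weak_gradient D (u + v) (\<lambda>x. g x + h x)"
proof -
  have L2: "(\<lambda>x. g x $ i) \<in> L2 D" "(\<lambda>x. h x $ i) \<in> L2 D" for i
    using g by (auto simp: has_weak_gradient_def intro: L2_bounded_linear bounded_linear_vec_nth)
  show ?thesis
    unfolding has_weak_gradient_def
  proof (intro conjI ballI allI)
    show "(\<lambda>x. g x + h x) \<in> L2 D" using g by (auto simp: has_weak_gradient_def intro: L2_add)
    fix \<phi> i assume \<phi>: "\<phi> \<in> test_functions D"
    have e: "(LINT x|lebesgue_on D. u x * of_real (partial i \<phi> x)) =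
        - (LINT x|lebesgue_on D. g x $ i * of_real (\<phi> x))"
      "(LINT x|lebesgue_on D. v x * of_real (partial i \<phi> x)) =
        - (LINT x|lebesgue_on D. h x $ i * of_real (\<phi> x))"
      using g \<phi> by (auto simp: has_weak_gradient_def)
    show "(LINT x|lebesgue_on D. (u + v) x * of_real (partial i \<phi> x)) =
        - (LINT x|lebesgue_on D. (g x + h x) $ i * of_real (\<phi> x))"
      using L2_mult_integrable[OF L2(1) test_function_L2[OF D \<phi>]]
        L2_mult_integrable[OF L2(2) test_function_L2[OF D \<phi>]]
        L2_mult_integrable[OF uv(1) partial_test_function_L2[OF D \<phi>]]
        L2_mult_integrable[OF uv(2) partial_test_function_L2[OF D \<phi>]] e
      by (simp add: distrib_right)
  qed
qed

lemma bounded_linear_scale_vec: "bounded_linear (\<lambda>g::complex^'n. \<chi> i. c * g $ i)"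
  unfolding linear_conv_bounded_linear[symmetric]
  by (rule linearI) (simp_all add: vec_eq_iff algebra_simps)

lemma bounded_linear_cnj_vec: "bounded_linear (\<lambda>g::complex^'n. \<chi> i. cnj (g $ i))"
  unfolding linear_conv_bounded_linear[symmetric]
  by (rule linearI) (simp_all add: vec_eq_iff)

lemma has_weak_gradient_scale:
  assumes "has_weak_gradient D u g"
  shows "has_weak_gradient D (scale_field c u) (\<lambda>x. \<chi> i. c * g x $ i)"
  using assms L2_bounded_linear[OF _ bounded_linear_scale_vec]
  by (auto simp: has_weak_gradient_def scale_field_def mult.assoc)

lemma has_weak_gradient_cnj:
  assumes "has_weak_gradient D u g"
  shows "has_weak_gradient D (\<lambda>x. cnj (u x)) (\<lambda>x. \<chi> i. cnj (g x $ i))"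
proof -
  have "(LINT x|lebesgue_on D. cnj (u x) * of_real (partial i \<phi> x)) =
      - (LINT x|lebesgue_on D. cnj (g x $ i) * of_real (\<phi> x))" if "\<phi> \<in> test_functions D" for i \<phi>
  proof -
    have "cnj (LINT x|lebesgue_on D. u x * of_real (partial i \<phi> x)) =
        cnj (- (LINT x|lebesgue_on D. g x $ i * of_real (\<phi> x)))"
      using assms that by (simp add: has_weak_gradient_def)
    moreover have "(LINT x|lebesgue_on D. cnj (u x) * of_real (partial i \<phi> x))
        = cnj (LINT x|lebesgue_on D. u x * of_real (partial i \<phi> x))"
      "(LINT x|lebesgue_on D. cnj (g x $ i) * of_real (\<phi> x))
        = cnj (LINT x|lebesgue_on D. g x $ i * of_real (\<phi> x))"
      by (simp_all flip: Bochner_Integration.integral_cnj)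
    ultimately show ?thesis by simp
  qed
  then show ?thesis
    using assms L2_bounded_linear[OF _ bounded_linear_cnj_vec] by (auto simp: has_weak_gradient_def)
qed

lemma H1_add:
  assumes "open D" "bounded D" "u \<in> H1 D" "v \<in> H1 D" shows "u + v \<in> H1 D"
proof -
  obtain g h where "has_weak_gradient D u g" "has_weak_gradient D v h" "u \<in> L2 D" "v \<in> L2 D"
    using assms by (auto simp: H1_def)
  then show ?thesis
    using has_weak_gradient_add[OF assms(1,2)] L2_add[of u D v]
    unfolding H1_def plus_fun_def by blast
qed

lemma H1_scale: "u \<in> H1 D \<Longrightarrow> scale_field c u \<in> H1 D"
  using L2_bounded_linear[OF _ bounded_linear_mult_right[of c], of u D]
  by (auto simp: H1_def scale_field_def intro!: has_weak_gradient_scale[unfolded scale_field_def])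

lemma H1_cnj: "u \<in> H1 D \<Longrightarrow> (\<lambda>x. cnj (u x)) \<in> H1 D"
  using L2_bounded_linear[OF _ bounded_linear_cnj, of u D]
  by (auto simp: H1_def intro!: has_weak_gradient_cnj)

lemma H1_weak_gradient: "u \<in> H1 D \<Longrightarrow> has_weak_gradient D u (weak_gradient D u)"
  using someI_ex[of "has_weak_gradient D u"] by (simp add: H1_def weak_gradient_def)

text \<open>The domain is merely open and bounded, so that the locale can be instantiated for the
  whole domain and for each subdomain.\<close>

locale elliptic_coefficients =
  fixes D :: "(real^3) set" and \<alpha> \<beta> :: "real^3 \<Rightarrow> real" and \<alpha>m \<alpha>p \<beta>m \<beta>p :: real
  assumes open_D: "open D" and bounded_D: "bounded D"
    and meas_\<alpha>: "\<alpha> \<in> borel_measurable (lebesgue_on D)"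
    and meas_\<beta>: "\<beta> \<in> borel_measurable (lebesgue_on D)"
    and \<alpha>m_pos: "0 < \<alpha>m" and \<beta>m_pos: "0 < \<beta>m"
    and \<alpha>_bounds: "x \<in> D \<Longrightarrow> \<alpha>m \<le> \<alpha> x \<and> \<alpha> x \<le> \<alpha>p"
    and \<beta>_bounds: "x \<in> D \<Longrightarrow> \<beta>m \<le> \<beta> x \<and> \<beta> x \<le> \<beta>p"
begin

text \<open>The gradients are arguments here, which allows the energy to be evaluated with
  conveniently chosen ones.\<close>

definition energy_density :: "field3 \<Rightarrow> (real^3 \<Rightarrow> complex^3) \<Rightarrow> field3 \<Rightarrow> (real^3 \<Rightarrow> complex^3) \<Rightarrow> field3" where
  "energy_density u g v h x = of_real (\<alpha> x) * (\<Sum>i\<in>UNIV. g x $ i * h x $ i) + of_real (\<beta> x) * u x * v x"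

lemma bounded_coefficient_mult_integrable:
  fixes f :: field3
  assumes "integrable (lebesgue_on D) f" "\<gamma> \<in> borel_measurable (lebesgue_on D)"
    and "\<And>x. x \<in> D \<Longrightarrow> \<bar>\<gamma> x\<bar> \<le> K"
  shows "integrable (lebesgue_on D) (\<lambda>x. of_real (\<gamma> x) * f x)"
proof (rule Bochner_Integration.integrable_bound)
  show "integrable (lebesgue_on D) (\<lambda>x. K * norm (f x))" using assms(1) by simp
  show "(\<lambda>x. of_real (\<gamma> x) * f x) \<in> borel_measurable (lebesgue_on D)"
    using assms(1,2) by (intro borel_measurable_times measurable_compose[OF _ borel_measurable_of_real]) auto
  show "AE x in lebesgue_on D. norm (of_real (\<gamma> x) * f x) \<le> norm (K * norm (f x))"
  proof (rule AE_I2)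
    fix x assume "x \<in> space (lebesgue_on D)"
    then have "\<bar>\<gamma> x\<bar> \<le> \<bar>K\<bar>" using assms(3)[of x] by simp
    then show "norm (of_real (\<gamma> x) * f x) \<le> norm (K * norm (f x))"
      by (simp add: norm_mult abs_mult mult_right_mono)
  qed
qed

lemma energy_density_integrable:
  assumes "u \<in> L2 D" "v \<in> L2 D" "has_weak_gradient D u g" "has_weak_gradient D v h"
  shows "integrable (lebesgue_on D) (energy_density u g v h)"
proof -
  have L2: "(\<lambda>x. g x $ i) \<in> L2 D" "(\<lambda>x. h x $ i) \<in> L2 D" for i
    using assms by (auto simp: has_weak_gradient_def intro: L2_bounded_linear bounded_linear_vec_nth)
  have "integrable (lebesgue_on D) (\<lambda>x. of_real (\<alpha> x) * (\<Sum>i\<in>UNIV. g x $ i * h x $ i))"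
    using \<alpha>_bounds \<alpha>m_pos
    by (intro bounded_coefficient_mult_integrable[where K=\<alpha>p] meas_\<alpha> Bochner_Integration.integrable_sum
        L2_mult_integrable L2) (fastforce simp: abs_le_iff)
  moreover have "integrable (lebesgue_on D) (\<lambda>x. of_real (\<beta> x) * (u x * v x))"
    using \<beta>_bounds \<beta>m_pos
    by (intro bounded_coefficient_mult_integrable[where K=\<beta>p] meas_\<beta>
        L2_mult_integrable assms) (fastforce simp: abs_le_iff)
  ultimately show ?thesis unfolding energy_density_def[abs_def]
    by (auto intro!: Bochner_Integration.integrable_add simp: mult.assoc)
qed

text \<open>Frees the energy from the choice in \<open>weak_gradient\<close>: any two weak gradients
  agree almost everywhere. Linearity and restriction to subdomains are then computed with explicit
  gradients.\<close>

lemma energy_eq: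
  assumes "u \<in> L2 D" "v \<in> L2 D" "has_weak_gradient D u g" "has_weak_gradient D v h"
  shows "energy \<alpha> \<beta> D u v = (LINT x|lebesgue_on D. energy_density u g v h x)"
proof -
  have w: "has_weak_gradient D u (weak_gradient D u)" "has_weak_gradient D v (weak_gradient D v)"
    using assms H1_weak_gradient by (auto simp: H1_def)
  have "AE x in lebesgue_on D. weak_gradient D u x = g x" "AE x in lebesgue_on D. weak_gradient D v x = h x"
    using weak_gradient_AE_unique[OF open_D bounded_D] w assms by blast+
  then have "AE x in lebesgue_on D. energy_density u (weak_gradient D u) v (weak_gradient D v) x = energy_density u g v h x"
    by eventually_elim (simp add: energy_density_def)
  then have "(LINT x|lebesgue_on D. energy_density u (weak_gradient D u) v (weak_gradient D v) x)
      = (LINT x|lebesgue_on D. energy_density u g v h x)"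
    using energy_density_integrable assms w by (intro integral_cong_AE borel_measurable_integrable) auto
  then show ?thesis by (simp add: energy_def energy_density_def)
qed

lemma energy_commute: "energy \<alpha> \<beta> D u v = energy \<alpha> \<beta> D v u"
  by (simp add: energy_def mult.commute mult.left_commute)

lemma energy_add_right:
  assumes "u \<in> H1 D" "v \<in> H1 D" "w \<in> H1 D"
  shows "energy \<alpha> \<beta> D u (v + w) = energy \<alpha> \<beta> D u v + energy \<alpha> \<beta> D u w"
proof -
  obtain f g h where fgh: "has_weak_gradient D u f" "has_weak_gradient D v g" "has_weak_gradient D w h"
    and L2: "u \<in> L2 D" "v \<in> L2 D" "w \<in> L2 D"
    using assms by (auto simp: H1_def)
  have "v + w \<in> L2 D" using L2 L2_add by (simp add: plus_fun_def)
  then have "energy \<alpha> \<beta> D u (v + w) = (LINT x|lebesgue_on D. energy_density u f (v + w) (\<lambda>x. g x + h x) x)"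
    by (intro energy_eq L2 fgh has_weak_gradient_add open_D bounded_D)
  also have "\<dots> = (LINT x|lebesgue_on D. energy_density u f v g x + energy_density u f w h x)"
    by (simp add: energy_density_def algebra_simps sum.distrib)
  also have "\<dots> = energy \<alpha> \<beta> D u v + energy \<alpha> \<beta> D u w"
    using L2 fgh by (simp add: energy_eq energy_density_integrable)
  finally show ?thesis .
qed

lemma energy_scale_right:
  assumes "u \<in> H1 D" "v \<in> H1 D"
  shows "energy \<alpha> \<beta> D u (scale_field c v) = c * energy \<alpha> \<beta> D u v"
proof -
  obtain f g where fg: "has_weak_gradient D u f" "has_weak_gradient D v g"
    and L2: "u \<in> L2 D" "v \<in> L2 D"
    using assms by (auto simp: H1_def)
  have "scale_field c v \<in> L2 D" using assms H1_scale by (auto simp: H1_def)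
  then have "energy \<alpha> \<beta> D u (scale_field c v)
      = (LINT x|lebesgue_on D. energy_density u f (scale_field c v) (\<lambda>x. \<chi> i. c * g x $ i) x)"
    by (intro energy_eq L2 fg has_weak_gradient_scale)
  also have "\<dots> = (LINT x|lebesgue_on D. c * energy_density u f v g x)"
    by (simp add: energy_density_def algebra_simps sum_distrib_left scale_field_def)
  also have "\<dots> = c * energy \<alpha> \<beta> D u v"
    using L2 fg by (simp add: energy_eq)
  finally show ?thesis .
qed

text \<open>Against the conjugate, the density becomes \<alpha> times the squared gradient norm plus
  \<beta> times the squared modulus of \<open>u\<close>, real and nonnegative. The zeroth-order term
  alone, bounded below by \<open>\<beta>m\<close>, forces \<open>u\<close> to vanish when the
  integral does.\<close>

lemma energy_cnj_nonneg_real: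
  assumes "u \<in> H1 D"
  obtains r where "energy \<alpha> \<beta> D u (\<lambda>x. cnj (u x)) = of_real r" "0 \<le> r"
    "r = 0 \<Longrightarrow> AE x in lebesgue_on D. u x = 0"
proof -
  obtain g where g: "has_weak_gradient D u g" and L2: "u \<in> L2 D"
    using assms by (auto simp: H1_def)
  define \<rho> where "\<rho> x = \<alpha> x * (\<Sum>i\<in>UNIV. (norm (g x $ i))\<^sup>2) + \<beta> x * (norm (u x))\<^sup>2" for x
  have L2': "(\<lambda>x. cnj (u x)) \<in> L2 D" using assms H1_cnj by (auto simp: H1_def)
  have eq: "energy_density u g (\<lambda>x. cnj (u x)) (\<lambda>x. \<chi> i. cnj (g x $ i)) = (\<lambda>x. of_real (\<rho> x))"
    by (auto simp: energy_density_def \<rho>_def fun_eq_iff complex_norm_square[symmetric] mult.assoc)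
  have "integrable (lebesgue_on D) (\<lambda>x. of_real (\<rho> x) :: complex)"
    using energy_density_integrable[OF L2 L2' g has_weak_gradient_cnj[OF g]] by (simp add: eq)
  then have int: "integrable (lebesgue_on D) \<rho>"
    by (simp add: complex_of_real_integrable_eq)
  have lower: "\<beta>m * (norm (u x))\<^sup>2 \<le> \<rho> x" if "x \<in> D" for x
  proof -
    have "0 \<le> \<alpha> x * (\<Sum>i\<in>UNIV. (norm (g x $ i))\<^sup>2)"
      using \<alpha>_bounds[OF that] \<alpha>m_pos by (intro mult_nonneg_nonneg sum_nonneg) auto
    moreover have "\<beta>m * (norm (u x))\<^sup>2 \<le> \<beta> x * (norm (u x))\<^sup>2"
      using \<beta>_bounds[OF that] by (intro mult_right_mono) auto
    ultimately show ?thesis by (simp add: \<rho>_def)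
  qed
  have nonneg: "0 \<le> \<rho> x" if "x \<in> D" for x
    using lower[OF that] \<beta>m_pos by (meson mult_nonneg_nonneg order.trans zero_le_power2 less_imp_le)
  show ?thesis
  proof (rule that)
    show "energy \<alpha> \<beta> D u (\<lambda>x. cnj (u x)) = of_real (LINT x|lebesgue_on D. \<rho> x)"
      using energy_eq[OF L2 L2' g has_weak_gradient_cnj[OF g]] by (simp add: eq)
    show "0 \<le> (LINT x|lebesgue_on D. \<rho> x)"
      using nonneg by (intro Bochner_Integration.integral_nonneg) simp
    assume "(LINT x|lebesgue_on D. \<rho> x) = 0"
    then have "AE x in lebesgue_on D. \<rho> x = 0"
      using int nonneg by (subst (asm) integral_nonneg_eq_0_iff_AE) (auto intro: AE_I2)
    moreover have "AE x in lebesgue_on D. x \<in> D" by (intro AE_I2) simp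
    ultimately show "AE x in lebesgue_on D. u x = 0"
    proof eventually_elim
      case (elim x)
      then have "\<beta>m * (norm (u x))\<^sup>2 \<le> 0" using lower by metis
      then show ?case using \<beta>m_pos by (simp add: mult_le_0_iff)
    qed
  qed
qed

end

text \<open>A closed set that contains almost every point of an open set contains all of it;
  continuity then carries the zero from \<open>D\<close> to its closure.\<close>

lemma AE_zero_imp_zero_on_closure:
  fixes u :: field3
  assumes "open D" "continuous_on (closure D) u" "AE x in lebesgue_on D. u x = 0" "x \<in> closure D"
  shows "u x = 0"
proof -
  have "closed (closure D \<inter> u -` {0})"
    using assms(2) by (intro continuous_closed_preimage) auto
  moreover have "AE x in lebesgue. x \<in> D \<longrightarrow> u x = 0"
    using assms(1,3) by (simp add: AE_restrict_space_iff)
  then have "AE x\<in>D in lebesgue. x \<in> closure D \<inter> u -` {0}"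
    by eventually_elim (use closure_subset in auto)
  ultimately have "D \<subseteq> closure D \<inter> u -` {0}"
    using mem_closed_if_AE_lebesgue_open assms(1) by blast
  then have "\<And>y. y \<in> D \<Longrightarrow> u y = 0" by blast
  then show ?thesis
    by (rule continuous_constant_on_closure[OF assms(2) _ assms(4)])
qed

section \<open>Dependence on the values in the domain, and restriction to subdomains\<close>

lemma L2_cong: "(\<And>x. x \<in> D \<Longrightarrow> u x = v x) \<Longrightarrow> u \<in> L2 D \<longleftrightarrow> v \<in> L2 D"
  unfolding L2_def mem_Collect_eq
  by (intro conj_cong measurable_cong Bochner_Integration.integrable_cong) auto

text \<open>Equality of the predicates, rather than an equivalence for one gradient, ensures that
  \<open>SOME\<close> selects the same \<open>weak_gradient\<close> for both functions.\<close>

lemma has_weak_gradient_cong: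
  assumes "\<And>x. x \<in> D \<Longrightarrow> u x = v x"
  shows "has_weak_gradient D u = has_weak_gradient D v"
proof -
  have "(LINT x|lebesgue_on D. u x * of_real (partial i \<phi> x))
      = (LINT x|lebesgue_on D. v x * of_real (partial i \<phi> x))" for i \<phi>
    using assms by (intro Bochner_Integration.integral_cong) auto
  then show ?thesis by (auto simp: has_weak_gradient_def fun_eq_iff)
qed

lemma H1_cong: "(\<And>x. x \<in> D \<Longrightarrow> u x = v x) \<Longrightarrow> u \<in> H1 D \<longleftrightarrow> v \<in> H1 D"
  using L2_cong[of D u v] has_weak_gradient_cong[of D u v] by (simp add: H1_def)

lemma energy_cong:
  assumes "\<And>x. x \<in> D \<Longrightarrow> u x = u' x" "\<And>x. x \<in> D \<Longrightarrow> v x = v' x"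
  shows "energy \<alpha> \<beta> D u v = energy \<alpha> \<beta> D u' v'"
  unfolding energy_def weak_gradient_def has_weak_gradient_cong[of D u u', OF assms(1), simplified]
    has_weak_gradient_cong[of D v v', OF assms(2), simplified]
  using assms by (intro Bochner_Integration.integral_cong) auto

lemma integrable_lebesgue_on_subset:
  fixes f :: "'a::euclidean_space \<Rightarrow> 'b::{banach, second_countable_topology}"
  assumes "open D" "open E" "E \<subseteq> D" "integrable (lebesgue_on D) f"
  shows "integrable (lebesgue_on E) f"
proof -
  have D: "integrable lebesgue (\<lambda>x. indicator D x *\<^sub>R f x)"
    using assms by (subst (asm) integrable_restrict_space) auto
  have "integrable lebesgue (\<lambda>x. indicator E x *\<^sub>R indicator D x *\<^sub>R f x)"
    using assms(2) by (intro integrable_mult_indicator[OF _ D]) auto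
  also have "(\<lambda>x. indicator E x *\<^sub>R indicator D x *\<^sub>R f x) = (\<lambda>x. indicator E x *\<^sub>R f x)"
    using assms by (auto simp: indicator_def fun_eq_iff)
  finally show ?thesis using assms by (subst integrable_restrict_space) auto
qed

lemma L2_subset:
  assumes "open D" "open E" "E \<subseteq> D" "u \<in> L2 D" shows "u \<in> L2 E"
proof -
  have "u \<in> borel_measurable (lebesgue_on D)" "integrable (lebesgue_on D) (\<lambda>x. (norm (u x))\<^sup>2)"
    using assms(4) by (simp_all add: L2_def)
  then have "u \<in> borel_measurable (lebesgue_on E)" "integrable (lebesgue_on E) (\<lambda>x. (norm (u x))\<^sup>2)"
    using assms(3) integrable_lebesgue_on_subset[OF assms(1-3)] by (blast intro: measurable_restrict_mono)+
  then show ?thesis by (simp add: L2_def)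
qed

lemma integral_lebesgue_on_subset:
  fixes f :: "'a::euclidean_space \<Rightarrow> 'b::{banach, second_countable_topology}"
  assumes "open D" "open E" "E \<subseteq> D" "\<And>x. x \<notin> E \<Longrightarrow> f x = 0"
  shows "(LINT x|lebesgue_on E. f x) = (LINT x|lebesgue_on D. f x)"
proof -
  have "(LINT x|lebesgue. indicator E x *\<^sub>R f x) = (LINT x|lebesgue. indicator D x *\<^sub>R f x)"
    using assms by (intro Bochner_Integration.integral_cong) (auto simp: indicator_def)
  then show ?thesis using assms by (simp add: integral_restrict_space)
qed

lemma test_function_outside:
  assumes "\<phi> \<in> test_functions D" "x \<notin> D" shows "\<phi> x = 0" "partial i \<phi> x = 0"
proof -
  have x: "x \<notin> closure {x. \<phi> x \<noteq> 0}" using assms unfolding test_functions_def by blast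
  then show "\<phi> x = 0" using closure_subset[of "{x. \<phi> x \<noteq> 0}"] by auto
  show "partial i \<phi> x = 0" using x by (rule partial_eq_0_outside_support)
qed

lemma test_functions_mono:
  assumes "E \<subseteq> D" shows "test_functions E \<subseteq> test_functions D"
proof
  fix \<phi> assume "\<phi> \<in> test_functions E"
  then show "\<phi> \<in> test_functions D"
    using order_trans[OF _ assms] unfolding test_functions_def mem_Collect_eq by iprover
qed

text \<open>A test function of \<open>E\<close> is one of \<open>D\<close>, and it vanishes with its
  partial derivatives outside \<open>E\<close>, so the identity on \<open>D\<close> is already the
  one on \<open>E\<close>.\<close>

lemma has_weak_gradient_subset:
  assumes "open D" "open E" "E \<subseteq> D" "has_weak_gradient D u g"
  shows "has_weak_gradient E u g"
  unfolding has_weak_gradient_def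
proof (intro conjI ballI allI)
  show "g \<in> L2 E" using assms(4) by (intro L2_subset[OF assms(1-3)]) (simp add: has_weak_gradient_def)
  fix \<phi> i assume \<phi>: "\<phi> \<in> test_functions E"
  then have "\<phi> \<in> test_functions D" using test_functions_mono[OF assms(3)] by auto
  then have "(LINT x|lebesgue_on D. u x * of_real (partial i \<phi> x))
      = - (LINT x|lebesgue_on D. g x $ i * of_real (\<phi> x))"
    by (rule has_weak_gradientD[OF assms(4)])
  moreover have "(LINT x|lebesgue_on E. u x * of_real (partial i \<phi> x))
      = (LINT x|lebesgue_on D. u x * of_real (partial i \<phi> x))"
    by (rule integral_lebesgue_on_subset[OF assms(1-3)]) (simp add: test_function_outside[OF \<phi>])
  moreover have "(LINT x|lebesgue_on E. g x $ i * of_real (\<phi> x))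
      = (LINT x|lebesgue_on D. g x $ i * of_real (\<phi> x))"
    by (rule integral_lebesgue_on_subset[OF assms(1-3)]) (simp add: test_function_outside[OF \<phi>])
  ultimately show "(LINT x|lebesgue_on E. u x * of_real (partial i \<phi> x))
      = - (LINT x|lebesgue_on E. g x $ i * of_real (\<phi> x))"
    by simp
qed

lemma H1_subset:
  assumes "open D" "open E" "E \<subseteq> D" "u \<in> H1 D" shows "u \<in> H1 E"
proof -
  obtain g where "has_weak_gradient D u g" "u \<in> L2 D" using assms by (auto simp: H1_def)
  then have "has_weak_gradient E u g" "u \<in> L2 E"
    using has_weak_gradient_subset[OF assms(1-3)] L2_subset[OF assms(1-3)] by blast+
  then show ?thesis unfolding H1_def by blast
qed

context elliptic_coefficients
begin

lemma elliptic_subset: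
  assumes "open E" "E \<subseteq> D" shows "elliptic_coefficients E \<alpha> \<beta> \<alpha>m \<alpha>p \<beta>m \<beta>p"
proof
  show "bounded E" using bounded_D assms(2) by (rule bounded_subset)
  show "\<alpha> \<in> borel_measurable (lebesgue_on E)" "\<beta> \<in> borel_measurable (lebesgue_on E)"
    by (rule measurable_restrict_mono[OF meas_\<alpha> assms(2)] measurable_restrict_mono[OF meas_\<beta> assms(2)])+
qed (use assms \<alpha>m_pos \<beta>m_pos \<alpha>_bounds \<beta>_bounds in auto)

text \<open>The energies of the subdomains are defined with separately chosen gradients.
  Restrictions of one gradient on \<open>D\<close> may replace them all, and then a single density
  is integrated over a disjoint union that fills \<open>D\<close> up to a null set.\<close>

lemma energy_decomposition:
  fixes \<omega> :: "'j::finite \<Rightarrow> (real^3) set"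
  assumes "\<And>j. open (\<omega> j)" "\<And>j. \<omega> j \<subseteq> D" "\<And>i j. i \<noteq> j \<Longrightarrow> \<omega> i \<inter> \<omega> j = {}"
    and null: "negligible (D - (\<Union>j. \<omega> j))" and uv: "u \<in> H1 D" "v \<in> H1 D"
  shows "energy \<alpha> \<beta> D u v = (\<Sum>j\<in>UNIV. energy \<alpha> \<beta> (\<omega> j) u v)"
proof -
  obtain g h where g: "has_weak_gradient D u g" and h: "has_weak_gradient D v h"
    and L2: "u \<in> L2 D" "v \<in> L2 D"
    using uv by (auto simp: H1_def)
  let ?F = "energy_density u g v h"
  have int: "integrable (lebesgue_on D) ?F" by (rule energy_density_integrable[OF L2 g h])
  have set_eq: "(LINT x|lebesgue_on E. ?F x) = set_lebesgue_integral lebesgue E ?F" if "open E" for E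
    using that by (simp add: set_lebesgue_integral_def integral_restrict_space)
  have set_int: "set_integrable lebesgue E ?F" if "open E" "E \<subseteq> D" for E
    using integrable_lebesgue_on_subset[OF open_D that int] that
    by (simp add: set_integrable_def integrable_restrict_space)
  have e: "energy \<alpha> \<beta> (\<omega> j) u v = (LINT x|lebesgue_on (\<omega> j). ?F x)" for j
  proof -
    interpret sub: elliptic_coefficients "\<omega> j" \<alpha> \<beta> \<alpha>m \<alpha>p \<beta>m \<beta>p
      using assms by (intro elliptic_subset)
    show ?thesis
      by (intro sub.energy_eq L2_subset[OF open_D assms(1,2)]
          has_weak_gradient_subset[OF open_D assms(1,2)] L2 g h)
  qed
  have "energy \<alpha> \<beta> D u v = set_lebesgue_integral lebesgue D ?F"
    using energy_eq[OF L2 g h] set_eq[OF open_D] by simp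
  also have "\<dots> = set_lebesgue_integral lebesgue (\<Union>j. \<omega> j) ?F"
    unfolding set_lebesgue_integral_def
  proof (rule integral_cong_AE)
    show "(\<lambda>x. indicator D x *\<^sub>R ?F x) \<in> borel_measurable lebesgue"
      "(\<lambda>x. indicator (\<Union>j. \<omega> j) x *\<^sub>R ?F x) \<in> borel_measurable lebesgue"
      using set_int[OF open_D] set_int[of "\<Union>j. \<omega> j"] assms
      by (auto simp: set_integrable_def intro!: borel_measurable_integrable)
    have "AE x in lebesgue. x \<notin> D - (\<Union>j. \<omega> j)"
      using null by (intro AE_not_in) (simp add: negligible_iff_null_sets)
    then show "AE x in lebesgue. indicator D x *\<^sub>R ?F x = indicator (\<Union>j. \<omega> j) x *\<^sub>R ?F x"
      by eventually_elim (use assms(2) in \<open>auto simp: indicator_def\<close>)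
  qed
  also have "\<dots> = (\<Sum>j\<in>UNIV. set_lebesgue_integral lebesgue (\<omega> j) ?F)"
    using assms set_int by (intro set_integral_finite_Union) (auto simp: disjoint_family_on_def)
  also have "\<dots> = (\<Sum>j\<in>UNIV. energy \<alpha> \<beta> (\<omega> j) u v)"
    using e set_eq assms by simp
  finally show ?thesis .
qed

end

section \<open>Weak gradients of Lipschitz functions\<close>

lemma lborel_integral_translation:
  fixes F :: "'a::euclidean_space \<Rightarrow> 'b::{banach, second_countable_topology}"
  assumes "F \<in> borel_measurable borel"
  shows "(LINT x|lborel. F (c + x)) = (LINT x|lborel. F x)"
  using integral_distr[of "(+) c" lborel borel F] assms by (simp add: lborel_distr_plus)

lemma integrable_continuous_compact_support:
  fixes F :: "'a::euclidean_space \<Rightarrow> 'b::{banach, second_countable_topology}"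
  assumes "continuous_on UNIV F" "compact C" "\<And>x. x \<notin> C \<Longrightarrow> F x = 0"
  shows "integrable lborel F"
proof -
  have "integrable lborel (\<lambda>x. indicator C x *\<^sub>R F x)"
    using assms by (intro borel_integrable_compact) (auto intro: continuous_on_subset)
  also have "(\<lambda>x. indicator C x *\<^sub>R F x) = F"
    using assms(3) by (auto simp: indicator_def fun_eq_iff)
  finally show ?thesis .
qed

lemma test_function_line_derivative:
  assumes "\<phi> \<in> test_functions D"
  shows "((\<lambda>t. \<phi> (x - t *\<^sub>R axis i 1)) has_real_derivative - partial i \<phi> (x - t *\<^sub>R axis i 1)) (at t)"
proof -
  have "Ck (Suc 0) \<phi>" using assms unfolding test_functions_def by blast
  then have "(\<phi> has_derivative frechet_derivative \<phi> (at y)) (at y)" for y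
    by (simp add: frechet_derivative_works)
  then have d: "((\<lambda>t. \<phi> (x - t *\<^sub>R axis i 1)) has_derivative
      (\<lambda>h. frechet_derivative \<phi> (at (x - t *\<^sub>R axis i 1)) (- (h *\<^sub>R axis i 1)))) (at t)"
    by (rule has_derivative_compose[rotated]) (auto intro!: derivative_eq_intros)
  have "linear (frechet_derivative \<phi> (at y))" for y
    using \<open>Ck (Suc 0) \<phi>\<close> by (simp add: linear_frechet_derivative)
  then have "frechet_derivative \<phi> (at y) (- (h *\<^sub>R axis i 1)) = - partial i \<phi> y * h" for y h
    by (simp add: partial_def linear_neg linear_scale)
  then show ?thesis
    unfolding has_field_derivative_def by (intro has_derivative_eq_rhs[OF d]) auto
qed

text \<open>A fixed sequence of step sizes, so that the limit is measurable as a limit of continuous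
  functions and sequential dominated convergence applies.\<close>

definition diff_quot :: "field3 \<Rightarrow> nat \<Rightarrow> real^3 \<Rightarrow> complex^3" where
  "diff_quot f n x = (\<chi> i. of_nat (Suc n) * (f (x + inverse (real (Suc n)) *\<^sub>R axis i 1) - f x))"

text \<open>Difference quotients are moved to the test function by translation invariance, and both sides
  converge dominatedly.\<close>

lemma lipschitz_has_weak_gradient:
  assumes D: "open D" "bounded D" and lip: "K-lipschitz_on UNIV f"
    and C: "compact C" "\<And>x. x \<notin> C \<Longrightarrow> f x = 0"
    and conv: "AE x in lborel. convergent (\<lambda>n. diff_quot f n x)"
  shows "has_weak_gradient D f (\<lambda>x. lim (\<lambda>n. diff_quot f n x))"
proof -
  define g where "g x = lim (\<lambda>n. diff_quot f n x)" for x
  have contf: "continuous_on UNIV f" using lip by (rule lipschitz_on_continuous_on)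
  then have cont_shift: "continuous_on UNIV (\<lambda>x. f (x + c))" for c
    by (rule continuous_on_compose2) (auto intro!: continuous_intros)
  have cont_dq: "continuous_on UNIV (diff_quot f n)" for n
    unfolding diff_quot_def[abs_def] by (intro continuous_intros contf cont_shift)
  have lim: "AE x in lborel. (\<lambda>n. diff_quot f n x) \<longlonglongrightarrow> g x"
    using conv unfolding g_def by eventually_elim (simp add: convergent_LIMSEQ_iff)
  have meas_g: "g \<in> borel_measurable borel"
    unfolding g_def[abs_def]
    by (intro borel_measurable_lim_metric borel_measurable_continuous_onI cont_dq)
  have dq_bound: "norm (diff_quot f n x $ i) \<le> K" for n x i
  proof -
    have "norm (f (x + inverse (real (Suc n)) *\<^sub>R axis i 1) - f x)
        \<le> K * norm (inverse (real (Suc n)) *\<^sub>R axis i (1::real))"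
      using lipschitz_onD[OF lip, of "x + inverse (real (Suc n)) *\<^sub>R axis i 1" x]
      by (simp only: dist_norm add_diff_cancel_left' UNIV_I simp_thms)
    also have "\<dots> = K * inverse (real (Suc n))" by (simp add: norm_axis_1)
    finally have "real (Suc n) * norm (f (x + inverse (real (Suc n)) *\<^sub>R axis i 1) - f x)
        \<le> real (Suc n) * (K * inverse (real (Suc n)))"
      by (rule mult_left_mono) simp
    also have "\<dots> = K" by simp
    finally show ?thesis
      unfolding diff_quot_def vec_lambda_beta norm_mult norm_of_nat .
  qed
  have bound_g: "AE x in lborel. norm (g x) \<le> (\<Sum>i\<in>(UNIV::3 set). K)"
    using lim
  proof eventually_elim
    case (elim x)
    have "norm (diff_quot f n x) \<le> (\<Sum>i\<in>(UNIV::3 set). K)" for n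
    proof -
      have "norm (diff_quot f n x) \<le> (\<Sum>i\<in>UNIV. norm (diff_quot f n x $ i))"
        unfolding norm_vec_def by (rule L2_set_le_sum) simp
      also have "\<dots> \<le> (\<Sum>i\<in>(UNIV::3 set). K)" by (intro sum_mono dq_bound)
      finally show ?thesis .
    qed
    then show ?case by (intro tendsto_upperbound[OF tendsto_norm[OF elim]]) auto
  qed
  have "AE x in lebesgue. norm (g x) \<le> (\<Sum>i\<in>(UNIV::3 set). K)"
    using bound_g by (simp only: AE_completion_iff)
  then have "AE x in lebesgue_on D. norm (g x) \<le> (\<Sum>i\<in>(UNIV::3 set). K)"
    using D by (subst AE_restrict_space_iff) auto
  moreover have "g \<in> borel_measurable (lebesgue_on D)"
    using meas_g by (intro measurable_restrict_space1 measurable_completion) simp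
  ultimately have "g \<in> L2 D" using D by (intro L2_AE_bounded_function)
  moreover have "(LINT x|lebesgue_on D. f x * of_real (partial i \<phi> x)) =
      - (LINT x|lebesgue_on D. g x $ i * of_real (\<phi> x))" if \<phi>: "\<phi> \<in> test_functions D" for \<phi> i
  proof -
    let ?h = "\<lambda>n. inverse (real (Suc n)) *\<^sub>R axis i 1 :: real^3"
    define P where "P n x = of_nat (Suc n) * (\<phi> (x - ?h n) - \<phi> x)" for n x
    have cont\<phi>: "continuous_on UNIV \<phi>" using \<phi> by (rule test_function_continuous)
    have cont\<phi>': "continuous_on UNIV (\<lambda>x. \<phi> (x - c))" for c
      using cont\<phi> by (rule continuous_on_compose2) (auto intro!: continuous_intros)
    have contp: "continuous_on UNIV (partial i \<phi>)" using \<phi> by (rule partial_test_function_continuous)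
    obtain S where supp: "compact S" and supp0: "\<And>x. x \<notin> S \<Longrightarrow> \<phi> x = 0"
      using test_function_compact_support[OF \<phi>] by blast
    have int: "integrable lborel (\<lambda>x. F x * of_real (\<phi> x))" if "continuous_on UNIV F" for F :: field3
      by (rule integrable_continuous_compact_support[OF _ supp])
        (auto intro!: continuous_intros that cont\<phi> simp: supp0)
    have intf: "integrable lborel (\<lambda>x. f x * of_real (G x))" if "continuous_on UNIV G" for G :: "real^3 \<Rightarrow> real"
      by (rule integrable_continuous_compact_support[OF _ C(1)])
        (auto intro!: continuous_intros that contf simp: C(2))
    have "(\<lambda>x. g x $ i) \<in> borel_measurable borel"
      using meas_g by (rule measurable_compose)
        (intro borel_measurable_continuous_onI linear_continuous_on bounded_linear_vec_nth)
    then have meas_g\<phi>: "(\<lambda>x. g x $ i * of_real (\<phi> x)) \<in> borel_measurable borel"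
      by (rule borel_measurable_times) (intro borel_measurable_continuous_onI continuous_intros cont\<phi>)
    \<comment> \<open>Discrete integration by parts: a forward shift of \<open>f\<close> becomes a
      backward shift of \<phi>, so \<open>P n\<close> tends to minus the partial derivative, which
      produces the sign in the definition of the weak gradient.\<close>
    have parts: "(LINT x|lborel. diff_quot f n x $ i * of_real (\<phi> x)) = (LINT x|lborel. f x * of_real (P n x))" for n
    proof -
      have "(LINT x|lborel. f (x + ?h n) * of_real (\<phi> x)) = (LINT x|lborel. f x * of_real (\<phi> (x - ?h n)))"
        using lborel_integral_translation[of "\<lambda>x. f x * of_real (\<phi> (x - ?h n))" "?h n"] contf cont\<phi>'
        by (simp add: add.commute borel_measurable_continuous_onI continuous_intros)
      moreover have "(LINT x|lborel. diff_quot f n x $ i * of_real (\<phi> x))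
          = of_nat (Suc n) * ((LINT x|lborel. f (x + ?h n) * of_real (\<phi> x)) - (LINT x|lborel. f x * of_real (\<phi> x)))"
        unfolding diff_quot_def
        by (subst Bochner_Integration.integral_diff[symmetric, OF int[OF cont_shift] int[OF contf]])
          (simp add: left_diff_distrib mult.assoc flip: integral_mult_right_zero)
      moreover have "(LINT x|lborel. f x * of_real (P n x))
          = of_nat (Suc n) * ((LINT x|lborel. f x * of_real (\<phi> (x - ?h n))) - (LINT x|lborel. f x * of_real (\<phi> x)))"
        unfolding P_def
        by (subst Bochner_Integration.integral_diff[symmetric, OF intf[OF cont\<phi>'] intf[OF cont\<phi>]])
          (simp add: right_diff_distrib mult.assoc mult.left_commute flip: integral_mult_right_zero)
      ultimately show ?thesis by simp
    qed
    have "(\<lambda>n. LINT x|lborel. diff_quot f n x $ i * of_real (\<phi> x))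
        \<longlonglongrightarrow> (LINT x|lborel. g x $ i * of_real (\<phi> x))"
    \<comment> \<open>The Lipschitz constant bounds the quotients of \<open>f\<close>, and the
      compact support of \<phi> makes the bound integrable. In the second limit the roles are
      exchanged: the bound \<open>M\<close> comes from \<phi>, the compact support from
      \<open>f\<close>.\<close>
    proof (rule integral_dominated_convergence[where w="\<lambda>x. norm (of_real K * of_real (\<phi> x) :: complex)"])
      show "AE x in lborel. (\<lambda>n. diff_quot f n x $ i * of_real (\<phi> x)) \<longlonglongrightarrow> g x $ i * of_real (\<phi> x)"
        using lim by eventually_elim (intro tendsto_intros)
      show "integrable lborel (\<lambda>x. norm (of_real K * of_real (\<phi> x) :: complex))"
        by (intro integrable_norm int) auto
      show "AE x in lborel. norm (diff_quot f n x $ i * of_real (\<phi> x)) \<le> norm (of_real K * of_real (\<phi> x) :: complex)" for n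
      proof (rule AE_I2)
        fix x
        have "norm (diff_quot f n x $ i) \<le> norm (of_real K :: complex)"
          using dq_bound[of n x i] by simp
        then show "norm (diff_quot f n x $ i * of_real (\<phi> x)) \<le> norm (of_real K * of_real (\<phi> x) :: complex)"
          unfolding norm_mult by (rule mult_right_mono) simp
      qed
      show "(\<lambda>x. g x $ i * of_real (\<phi> x)) \<in> borel_measurable lborel"
        using meas_g\<phi> by (simp only: measurable_lborel2)
      show "(\<lambda>x. diff_quot f n x $ i * of_real (\<phi> x)) \<in> borel_measurable lborel" for n
        using cont\<phi> cont_dq by (auto intro!: borel_measurable_continuous_onI continuous_intros)
    qed
    moreover have "(\<lambda>n. LINT x|lborel. f x * of_real (P n x))
        \<longlonglongrightarrow> (LINT x|lborel. f x * of_real (- partial i \<phi> x))"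
    proof -
      obtain M where M: "\<And>x. norm (partial i \<phi> x) \<le> M"
        using partial_test_function_bounded[OF \<phi>] by blast
      show ?thesis
      proof (rule integral_dominated_convergence[where w="\<lambda>x. norm (f x * of_real M)"])
        show "AE x in lborel. (\<lambda>n. f x * of_real (P n x)) \<longlonglongrightarrow> f x * of_real (- partial i \<phi> x)"
        proof (intro AE_I2 tendsto_intros)
          fix x
          have "((\<lambda>h. (\<phi> (x - h *\<^sub>R axis i 1) - \<phi> x) / h) \<longlongrightarrow> - partial i \<phi> x) (at 0)"
            using test_function_line_derivative[OF \<phi>, of x i 0] by (simp add: DERIV_def)
          moreover have "filterlim (\<lambda>n. inverse (real (Suc n))) (at 0) sequentially"
            unfolding filterlim_at using LIMSEQ_inverse_real_of_nat by auto
          ultimately have "(\<lambda>n. (\<phi> (x - ?h n) - \<phi> x) / inverse (real (Suc n))) \<longlonglongrightarrow> - partial i \<phi> x"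
            by (rule filterlim_compose)
          then show "(\<lambda>n. P n x) \<longlonglongrightarrow> - partial i \<phi> x"
            by (simp only: P_def divide_inverse inverse_inverse_eq mult.commute)
        qed
        show "AE x in lborel. norm (f x * of_real (P n x)) \<le> norm (f x * of_real M)" for n
        proof (rule AE_I2)
          fix x
          \<comment> \<open>The mean value inequality along the line through \<open>x\<close> bounds
            \<open>P n\<close> uniformly by \<open>M\<close>.\<close>
          have "norm (\<phi> (x - inverse (real (Suc n)) *\<^sub>R axis i 1) - \<phi> (x - 0 *\<^sub>R axis i 1))
              \<le> M * norm (inverse (real (Suc n)) - 0)"
          proof (rule field_differentiable_bound[OF convex_UNIV])
            show "((\<lambda>t. \<phi> (x - t *\<^sub>R axis i 1)) has_field_derivative - partial i \<phi> (x - t *\<^sub>R axis i 1)) (at t)" for t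
              by (rule test_function_line_derivative[OF \<phi>])
          qed (use M in auto)
          then have "\<bar>P n x\<bar> \<le> M"
            unfolding P_def abs_mult by (simp add: field_simps)
          then show "norm (f x * of_real (P n x)) \<le> norm (f x * of_real M)"
            unfolding norm_mult by (intro mult_left_mono) auto
        qed
        show "integrable lborel (\<lambda>x. norm (f x * of_real M))"
          by (intro integrable_norm intf) auto
        show "(\<lambda>x. f x * of_real (P n x)) \<in> borel_measurable lborel" for n
          using contf cont\<phi> cont\<phi>' unfolding P_def
          by (auto intro!: borel_measurable_continuous_onI continuous_intros)
        show "(\<lambda>x. f x * of_real (- partial i \<phi> x)) \<in> borel_measurable lborel"
          using contf contp by (auto intro!: borel_measurable_continuous_onI continuous_intros)
      qed
    qed
    ultimately have "(LINT x|lborel. g x $ i * of_real (\<phi> x)) = (LINT x|lborel. f x * of_real (- partial i \<phi> x))"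
      unfolding parts by (rule LIMSEQ_unique)
    then have eq: "(LINT x|lborel. f x * of_real (partial i \<phi> x)) = - (LINT x|lborel. g x $ i * of_real (\<phi> x))"
      by simp
    \<comment> \<open>Translation invariance required integrals over the whole space; the factors
      \<phi> and \<open>partial i \<phi>\<close> vanish off \<open>D\<close>, which permits the
      return to \<open>D\<close>.\<close>
    have full: "(LINT x|lebesgue_on D. F x) = (LINT x|lborel. F x)"
      if "F \<in> borel_measurable borel" "\<And>x. x \<notin> D \<Longrightarrow> F x = 0" for F :: field3
    proof -
      have "(LINT x|lebesgue_on D. F x) = (LINT x|lebesgue_on UNIV. F x)"
        using D that(2) by (intro integral_lebesgue_on_subset) auto
      then show ?thesis using that(1) by (simp add: lebesgue_on_UNIV_eq integral_completion)
    qed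
    have "(LINT x|lebesgue_on D. g x $ i * of_real (\<phi> x)) = (LINT x|lborel. g x $ i * of_real (\<phi> x))"
      by (rule full[OF meas_g\<phi>]) (simp add: test_function_outside(1)[OF \<phi>])
    moreover have "(LINT x|lebesgue_on D. f x * of_real (partial i \<phi> x)) = (LINT x|lborel. f x * of_real (partial i \<phi> x))"
      using contf contp test_function_outside(2)[OF \<phi>]
      by (intro full borel_measurable_continuous_onI) (auto intro!: continuous_intros)
    ultimately show ?thesis using eq by simp
  qed
  ultimately show ?thesis unfolding has_weak_gradient_def g_def by blast
qed

section \<open>Piecewise linear functions\<close>

lemma P1_on_add: "P1_on \<tau> u \<Longrightarrow> P1_on \<tau> v \<Longrightarrow> P1_on \<tau> (u + v)"
proof -
  assume "P1_on \<tau> u" "P1_on \<tau> v"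
  then obtain a b c d where "\<forall>x\<in>\<tau>. u x = a + (\<Sum>i\<in>UNIV. b $ i * of_real (x $ i))"
    "\<forall>x\<in>\<tau>. v x = c + (\<Sum>i\<in>UNIV. d $ i * of_real (x $ i))" by (auto simp: P1_on_def)
  then show ?thesis unfolding P1_on_def
    by (intro exI[of _ "a + c"] exI[of _ "b + d"]) (simp add: distrib_right sum.distrib)
qed

lemma P1_on_scale: "P1_on \<tau> u \<Longrightarrow> P1_on \<tau> (scale_field k u)"
proof -
  assume "P1_on \<tau> u"
  then obtain a b where "\<forall>x\<in>\<tau>. u x = a + (\<Sum>i\<in>UNIV. b $ i * of_real (x $ i))"
    by (auto simp: P1_on_def)
  then show ?thesis unfolding P1_on_def scale_field_def
    by (intro exI[of _ "k * a"] exI[of _ "\<chi> i. k * b $ i"])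
      (simp add: distrib_left sum_distrib_left mult.assoc)
qed

lemma P1_on_cnj: "P1_on \<tau> u \<Longrightarrow> P1_on \<tau> (\<lambda>x. cnj (u x))"
proof -
  assume "P1_on \<tau> u"
  then obtain a b where "\<forall>x\<in>\<tau>. u x = a + (\<Sum>i\<in>UNIV. b $ i * of_real (x $ i))"
    by (auto simp: P1_on_def)
  then show ?thesis unfolding P1_on_def
    by (intro exI[of _ "cnj a"] exI[of _ "\<chi> i. cnj (b $ i)"]) (simp add: cnj_sum)
qed

lemma P1_on_0: "(\<And>x. x \<in> \<tau> \<Longrightarrow> u x = 0) \<Longrightarrow> P1_on \<tau> u"
  unfolding P1_on_def by (intro exI[of _ 0]) simp

lemma P1_on_cong: "(\<And>x. x \<in> \<tau> \<Longrightarrow> u x = v x) \<Longrightarrow> P1_on \<tau> u \<longleftrightarrow> P1_on \<tau> v"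
  by (simp add: P1_on_def)

lemma P1_on_lipschitz: "P1_on \<tau> u \<Longrightarrow> \<exists>K. K-lipschitz_on \<tau> u"
proof -
  assume "P1_on \<tau> u"
  then obtain a b where u: "\<forall>x\<in>\<tau>. u x = a + (\<Sum>i\<in>UNIV. b $ i * of_real (x $ i))"
    by (auto simp: P1_on_def)
  have "(\<Sum>i\<in>UNIV. norm (b $ i))-lipschitz_on \<tau> u"
  proof (rule lipschitz_onI)
    fix x y assume "x \<in> \<tau>" "y \<in> \<tau>"
    then have "u x - u y = (\<Sum>i\<in>UNIV. b $ i * of_real ((x - y) $ i))"
      using u by (simp add: right_diff_distrib sum_subtractf)
    then have "dist (u x) (u y) = norm (\<Sum>i\<in>UNIV. b $ i * of_real ((x - y) $ i))"
      by (simp add: dist_norm)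
    also have "\<dots> \<le> (\<Sum>i\<in>UNIV. norm (b $ i * of_real ((x - y) $ i)))" by (rule norm_sum)
    also have "\<dots> \<le> (\<Sum>i\<in>UNIV. norm (b $ i) * norm (x - y))"
      unfolding norm_mult norm_of_real
      by (intro sum_mono mult_left_mono component_le_norm_cart) simp
    finally show "dist (u x) (u y) \<le> (\<Sum>i\<in>UNIV. norm (b $ i)) * dist x y"
      by (simp add: sum_distrib_right dist_norm)
  qed (simp add: sum_nonneg)
  then show ?thesis by blast
qed

text \<open>An affine function takes a convex combination of points to the same combination of its
  values; the constant term passes through because the weights add up to 1.\<close>

lemma P1_on_zero_on_hull:
  assumes "P1_on \<tau> u" "finite C" "\<tau> = convex hull C" "\<And>x. x \<in> C \<Longrightarrow> u x = 0" "x \<in> \<tau>"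
  shows "u x = 0"
proof -
  obtain a b where u: "\<forall>x\<in>\<tau>. u x = a + (\<Sum>i\<in>UNIV. b $ i * of_real (x $ i))"
    using assms(1) by (auto simp: P1_on_def)
  obtain w where w: "sum w C = 1" "(\<Sum>v\<in>C. w v *\<^sub>R v) = x"
    using assms(2,3,5) by (auto simp: convex_hull_finite)
  have "u x = a + (\<Sum>i\<in>UNIV. b $ i * of_real (\<Sum>v\<in>C. w v * v $ i))"
    using u assms(5) w(2)[symmetric] by simp
  also have "(\<Sum>i\<in>UNIV. b $ i * of_real (\<Sum>v\<in>C. w v * v $ i)) = (\<Sum>i\<in>UNIV. \<Sum>v\<in>C. of_real (w v) * (b $ i * of_real (v $ i)))"
    by (simp add: sum_distrib_left mult.left_commute)
  also have "\<dots> = (\<Sum>v\<in>C. of_real (w v) * (\<Sum>i\<in>UNIV. b $ i * of_real (v $ i)))"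
    by (subst sum.swap) (simp add: sum_distrib_left)
  also have "a = (\<Sum>v\<in>C. of_real (w v) * a)"
    using w(1) by (simp flip: sum_distrib_right of_real_sum)
  also have "(\<Sum>v\<in>C. of_real (w v) * a) + (\<Sum>v\<in>C. of_real (w v) * (\<Sum>i\<in>UNIV. b $ i * of_real (v $ i)))
      = (\<Sum>v\<in>C. of_real (w v) * u v)"
    using u assms(3) hull_inc[of _ C convex]
    by (simp add: distrib_left flip: sum.distrib)
  finally show ?thesis using assms(4) by simp
qed

lemma simplex_3_interior:
  fixes \<tau> :: "(real^3) set"
  assumes "3 simplex \<tau>"
  shows "closure (interior \<tau>) = \<tau>"
proof -
  have conv: "convex \<tau>" and cl: "closed \<tau>"
    using assms convex_simplex closed_simplex by blast+
  have "aff_dim \<tau> = 3" using assms by (rule aff_dim_simplex)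
  then have "affine hull \<tau> = UNIV" using aff_dim_eq_full[of \<tau>] by simp
  then have "rel_interior \<tau> = interior \<tau>" by (rule rel_interior_interior)
  moreover have "\<tau> \<noteq> {}" using \<open>aff_dim \<tau> = 3\<close> by auto
  ultimately have "interior \<tau> \<noteq> {}" using rel_interior_eq_empty[OF conv] by simp
  then show ?thesis using convex_closure_interior[OF conv] cl by simp
qed

text \<open>The intersection is a common face. Were it all of \<tau>, then \<tau> would be a proper
  face of \<sigma> and have smaller dimension, yet both have dimension 3. A proper face misses the
  interior.\<close>

lemma triangulation_interior_disjoint:
  fixes T :: "(real^3) set set"
  assumes "triangulation T" "\<And>\<tau>. \<tau> \<in> T \<Longrightarrow> 3 simplex \<tau>" "\<tau> \<in> T" "\<sigma> \<in> T" "\<tau> \<noteq> \<sigma>"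
  shows "interior \<tau> \<inter> \<sigma> = {}"
proof -
  have f: "(\<tau> \<inter> \<sigma>) face_of \<tau>" "(\<tau> \<inter> \<sigma>) face_of \<sigma>"
    using assms(1,3,4) unfolding triangulation_def by (metis inf_commute)+
  have "\<tau> \<inter> \<sigma> \<noteq> \<tau>"
  proof
    assume "\<tau> \<inter> \<sigma> = \<tau>"
    then have "aff_dim \<tau> < aff_dim \<sigma>"
      using face_of_aff_dim_lt[OF convex_simplex[OF assms(2)[OF assms(4)]] f(2)] assms(5) by simp
    then show False
      using aff_dim_simplex[OF assms(2)[OF assms(3)]] aff_dim_simplex[OF assms(2)[OF assms(4)]] by simp
  qed
  then have "(\<tau> \<inter> \<sigma>) \<inter> interior \<tau> = {}"
    by (rule face_of_disjoint_interior[OF f(1)])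
  then show ?thesis using interior_subset by blast
qed

text \<open>Affine pieces are Lipschitz separately; to combine them, cut the segment between two
  points along the pieces. Posing the statement on the whole space keeps every segment inside the
  domain of \<open>f\<close>, even when the union of the pieces is not convex.\<close>

lemma piecewise_P1_lipschitz:
  fixes f :: field3
  assumes S: "finite S" "\<And>\<tau>. \<tau> \<in> S \<Longrightarrow> closed \<tau>" "\<And>\<tau>. \<tau> \<in> S \<Longrightarrow> P1_on \<tau> f"
    and zero: "\<And>x. x \<in> closure (- \<Union>S) \<Longrightarrow> f x = 0"
  shows "\<exists>K. K-lipschitz_on UNIV f"
proof -
  \<comment> \<open>The zero region counts as one more closed piece, so that finitely many closed
    sets cover the space.\<close>
  let ?I = "insert (closure (- \<Union>S)) S"
  have "\<exists>K. K-lipschitz_on \<sigma> f" if "\<sigma> \<in> ?I" for \<sigma>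
    using that S(3) P1_on_lipschitz P1_on_0[of "closure (- \<Union>S)" f] zero by auto
  then obtain L where L: "\<And>\<sigma>. \<sigma> \<in> ?I \<Longrightarrow> (L \<sigma>)-lipschitz_on \<sigma> f" by metis
  define K where "K = (\<Sum>\<sigma>\<in>?I. L \<sigma>)"
  have Lpos: "0 \<le> L \<sigma>" if "\<sigma> \<in> ?I" for \<sigma> using L[OF that] lipschitz_on_nonneg by blast
  have K: "K-lipschitz_on \<sigma> f" if "\<sigma> \<in> ?I" for \<sigma>
    using L[OF that] unfolding K_def
    by (rule lipschitz_on_mono) (use S(1) Lpos that in \<open>auto intro!: member_le_sum\<close>)
  have K0: "0 \<le> K" using Lpos unfolding K_def by (intro sum_nonneg)
  have "dist (f x) (f y) \<le> K * dist x y" for x y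
  proof -
    \<comment> \<open>The parametrized segment pulls the pieces back to closed sets covering the
      unit interval, where Lipschitz bounds with a common constant can be combined.\<close>
    define p where "p t = x + t *\<^sub>R (y - x)" for t :: real
    have contp: "continuous_on UNIV p" unfolding p_def by (intro continuous_intros)
    have "(K * norm (y - x))-lipschitz_on {0..1} (\<lambda>t. f (p t))"
    proof (rule lipschitz_on_closed_Union[where I="?I" and U="\<lambda>\<sigma>. p -` \<sigma>"])
      fix \<sigma> assume \<sigma>: "\<sigma> \<in> ?I"
      show "closed (p -` \<sigma>)" using \<sigma> S(2) by (intro closed_vimage contp) auto
      show "(K * norm (y - x))-lipschitz_on (p -` \<sigma>) (\<lambda>t. f (p t))"
      proof (rule lipschitz_onI)
        fix s t assume "s \<in> p -` \<sigma>" "t \<in> p -` \<sigma>"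
        then have "dist (f (p s)) (f (p t)) \<le> K * dist (p s) (p t)"
          using lipschitz_onD[OF K[OF \<sigma>]] by simp
        also have "dist (p s) (p t) = norm (y - x) * dist s t"
          by (simp add: p_def dist_norm flip: scaleR_left_diff_distrib)
        finally show "dist (f (p s)) (f (p t)) \<le> K * norm (y - x) * dist s t" by simp
      qed (use K0 in simp)
    next
      show "{0..1} \<subseteq> (\<Union>\<sigma>\<in>?I. p -` \<sigma>)"
        using closure_subset[of "- \<Union>S"] by auto
    qed (use S K0 in auto)
    then have "dist (f (p 0)) (f (p 1)) \<le> K * norm (y - x) * dist 0 (1::real)"
      by (rule lipschitz_onD) auto
    then show ?thesis by (simp add: p_def dist_norm norm_minus_commute)
  qed
  then show ?thesis using K0 by (intro exI lipschitz_onI) auto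
qed

text \<open>Once the steps are short enough to stay in \<open>U\<close>, the quotients equal the
  coefficient vector. For piecewise linear functions this supplies the almost everywhere convergence
  that Rademacher's theorem would give for general Lipschitz functions.\<close>

lemma diff_quot_convergent_affine:
  assumes "open U" "x \<in> U" "P1_on U f"
  shows "convergent (\<lambda>n. diff_quot f n x)"
proof -
  obtain a b where f: "\<And>y. y \<in> U \<Longrightarrow> f y = a + (\<Sum>i\<in>UNIV. b $ i * of_real (y $ i))"
    using assms(3) by (auto simp: P1_on_def)
  have ev: "\<forall>\<^sub>F n in sequentially. x + inverse (real (Suc n)) *\<^sub>R axis i 1 \<in> U" for i
  proof (rule topological_tendstoD[OF _ assms(1)])
    have "(\<lambda>n. x + inverse (real (Suc n)) *\<^sub>R axis i 1) \<longlonglongrightarrow> x + 0 *\<^sub>R axis i 1"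
      by (intro tendsto_intros LIMSEQ_inverse_real_of_nat)
    then show "(\<lambda>n. x + inverse (real (Suc n)) *\<^sub>R axis i 1) \<longlonglongrightarrow> x" by simp
  qed (rule assms(2))
  have comp: "of_nat (Suc n) * (f (x + inverse (real (Suc n)) *\<^sub>R axis i 1) - f x) = b $ i"
    if "x + inverse (real (Suc n)) *\<^sub>R axis i 1 \<in> U" for n i
  proof -
    have "f (x + inverse (real (Suc n)) *\<^sub>R axis i 1) - f x
        = (\<Sum>k\<in>UNIV. b $ k * of_real ((inverse (real (Suc n)) *\<^sub>R axis i 1 :: real^3) $ k))"
      using f[OF that] f[OF assms(2)] by (simp add: distrib_left sum.distrib)
    also have "\<dots> = (\<Sum>k\<in>UNIV. if k = i then b $ k * of_real (inverse (real (Suc n))) else 0)"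
      by (intro sum.cong) (auto simp: axis_def)
    also have "\<dots> = b $ i * of_real (inverse (real (Suc n)))" by simp
    finally show ?thesis by (simp del: of_nat_Suc)
  qed
  have "\<forall>\<^sub>F n in sequentially. \<forall>i\<in>UNIV. x + inverse (real (Suc n)) *\<^sub>R axis i 1 \<in> U"
    using ev by (intro eventually_ball_finite) auto
  then have "\<forall>\<^sub>F n in sequentially. diff_quot f n x = b"
    by eventually_elim (simp add: diff_quot_def vec_eq_iff comp del: of_nat_Suc)
  then show ?thesis by (intro convergentI tendsto_eventually)
qed

text \<open>Convex sets have null frontiers, so almost every point lies in the interior of an
  element or in the open complement of their union; in both cases \<open>f\<close> is affine
  nearby.\<close>

lemma piecewise_P1_H1:
  fixes f :: field3
  assumes \<Omega>: "open \<Omega>" "bounded \<Omega>"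
    and S: "finite S" "\<And>\<tau>. \<tau> \<in> S \<Longrightarrow> compact \<tau>" "\<And>\<tau>. \<tau> \<in> S \<Longrightarrow> convex \<tau>" "\<And>\<tau>. \<tau> \<in> S \<Longrightarrow> P1_on \<tau> f"
    and zero: "\<And>x. x \<in> closure (- \<Union>S) \<Longrightarrow> f x = 0"
  shows "f \<in> H1 \<Omega>"
proof -
  obtain K where K: "K-lipschitz_on UNIV f"
    using piecewise_P1_lipschitz[OF S(1) compact_imp_closed[OF S(2)] S(4) zero] by blast
  then have cont: "continuous_on UNIV f" by (rule lipschitz_on_continuous_on)
  have C: "compact (\<Union>S)" using S(1,2) by (rule compact_Union)
  have outside: "f x = 0" if "x \<notin> \<Union>S" for x
    using zero[of x] that closure_subset[of "- \<Union>S"] by blast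
  obtain M where M: "\<And>x. norm (f x) \<le> M"
    using continuous_compact_support_bounded[OF cont C outside] by blast
  have "f \<in> L2 \<Omega>"
    using \<Omega> cont M by (intro L2_bounded_function continuous_imp_measurable_on_sets_lebesgue)
      (auto intro: continuous_on_subset)
  moreover have "AE x in lborel. convergent (\<lambda>n. diff_quot f n x)"
  proof -
    have "negligible (\<Union>\<tau>\<in>S. frontier \<tau>)"
      using S(1,3) by (intro negligible_Union) (auto intro: negligible_convex_frontier)
    then have "AE x in lebesgue. x \<notin> (\<Union>\<tau>\<in>S. frontier \<tau>)"
      by (intro AE_not_in) (simp add: negligible_iff_null_sets)
    then have "AE x in lebesgue. convergent (\<lambda>n. diff_quot f n x)"
    proof eventually_elim
      case (elim x)
      show ?case
      proof (cases "x \<in> \<Union>S")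
        case True
        then obtain \<tau> where \<tau>: "\<tau> \<in> S" "x \<in> \<tau>" by blast
        then have "x \<in> interior \<tau>"
          using elim closure_subset[of \<tau>] by (auto simp: frontier_def)
        moreover have "P1_on (interior \<tau>) f"
          using S(4)[OF \<tau>(1)] interior_subset[of \<tau>] unfolding P1_on_def by blast
        ultimately show ?thesis by (intro diff_quot_convergent_affine[of "interior \<tau>"]) auto
      next
        case False
        then show ?thesis
          using compact_imp_closed[OF C] outside
          by (intro diff_quot_convergent_affine[of "- \<Union>S"] P1_on_0) auto
      qed
    qed
    then show ?thesis by (simp only: AE_completion_iff)
  qed
  then have "has_weak_gradient \<Omega> f (\<lambda>x. lim (\<lambda>n. diff_quot f n x))"
    by (intro lipschitz_has_weak_gradient[OF \<Omega> K C] outside)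
  ultimately show ?thesis unfolding H1_def by blast
qed

section \<open>Finite element functions on a decomposition\<close>

interpretation field_space: vector_space scale_field
  by standard (auto simp: scale_field_def fun_eq_iff algebra_simps)

interpretation tuple_space: vector_space "scale_tuple :: complex \<Rightarrow> ('j \<Rightarrow> field3) \<Rightarrow> 'j \<Rightarrow> field3"
  by standard (auto simp: scale_tuple_def scale_field_def fun_eq_iff algebra_simps)

lemma scale_field_apply: "scale_field c u x = c * u x"
  by (simp add: scale_field_def)

lemma restr_add: "restr D (u + v) = restr D u + restr D v"
  by (auto simp: restr_def fun_eq_iff)

lemma restr_scale: "restr D (scale_field c u) = scale_field c (restr D u)"
  by (auto simp: restr_def scale_field_def fun_eq_iff)

lemma restr_0: "restr D 0 = 0"
  by (auto simp: restr_def fun_eq_iff)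

lemma restr_cnj: "restr D (\<lambda>x. cnj (u x)) = (\<lambda>x. cnj (restr D u x))"
  by (auto simp: restr_def fun_eq_iff)

locale fe_decomposition =
  fixes \<Omega> :: "(real^3) set" and T :: "(real^3) set set" and \<omega> :: "'j::finite \<Rightarrow> (real^3) set"
  assumes domain: "polyhedral_domain \<Omega>" and mesh: "tetrahedral_mesh T \<Omega>"
    and decomp: "resolved_decomposition T \<Omega> \<omega>"
begin

lemma open_\<Omega>: "open \<Omega>" and bounded_\<Omega>: "bounded \<Omega>"
  using domain by (auto simp: polyhedral_domain_def)

lemma finite_T: "finite T" and triangulation_T: "triangulation T"
  and simplex_T: "\<tau> \<in> T \<Longrightarrow> 3 simplex \<tau>" and Union_T: "\<Union>T = closure \<Omega>"
  using mesh by (auto simp: tetrahedral_mesh_def triangulation_def)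

lemma compact_T: "\<tau> \<in> T \<Longrightarrow> compact \<tau>" and closed_T: "\<tau> \<in> T \<Longrightarrow> closed \<tau>"
  and convex_T: "\<tau> \<in> T \<Longrightarrow> convex \<tau>"
  using simplex_T compact_simplex closed_simplex convex_simplex by blast+

lemma open_\<omega>: "open (\<omega> j)" and \<omega>_subset: "\<omega> j \<subseteq> \<Omega>"
  and interior_closure_\<omega>: "interior (closure (\<omega> j)) = \<omega> j"
  and disjoint_\<omega>: "i \<noteq> j \<Longrightarrow> \<omega> i \<inter> \<omega> j = {}"
  and closure_\<Omega>: "closure \<Omega> = (\<Union>j. closure (\<omega> j))"
  using decomp by (auto simp: resolved_decomposition_def polyhedral_domain_def)

lemma closure_\<omega>_Union: "\<exists>S\<subseteq>T. closure (\<omega> j) = \<Union>S"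
  using decomp by (auto simp: resolved_decomposition_def)

lemma frontier_\<omega>: "frontier (\<omega> j) = closure (\<omega> j) - \<omega> j"
  using open_\<omega> by (simp add: frontier_def interior_open)

lemma closure_\<omega>_subset: "closure (\<omega> j) \<subseteq> closure \<Omega>"
  using closure_\<Omega> by blast

lemma closures_meet_in_frontier: "i \<noteq> j \<Longrightarrow> closure (\<omega> i) \<inter> closure (\<omega> j) \<subseteq> frontier (\<omega> j)"
  using disjoint_\<omega>[of i j] open_Int_closure_eq_empty[OF open_\<omega>[of j], of "\<omega> i"]
  by (auto simp: frontier_\<omega>)

lemma frontier_subset_skeleton: "frontier (\<omega> j) \<subseteq> skeleton \<omega>"
  by (auto simp: skeleton_def)

text \<open>A point of some closure that lies in no subdomain lies on an element boundary: the
  interior of an element contained in \<open>closure (\<omega> j)\<close> is contained in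
  \<open>interior (closure (\<omega> j))\<close>, which is \<open>\<omega> j\<close> itself.\<close>

lemma negligible_gap: "negligible (\<Omega> - (\<Union>j. \<omega> j))"
proof (rule negligible_subset)
  show "negligible (\<Union>\<tau>\<in>T. frontier \<tau>)"
    using finite_T convex_T by (intro negligible_Union) (auto intro: negligible_convex_frontier)
  show "\<Omega> - (\<Union>j. \<omega> j) \<subseteq> (\<Union>\<tau>\<in>T. frontier \<tau>)"
  proof
    fix x assume x: "x \<in> \<Omega> - (\<Union>j. \<omega> j)"
    have "x \<in> closure \<Omega>" using x closure_subset[of \<Omega>] by auto
    then obtain j where j: "x \<in> closure (\<omega> j)" unfolding closure_\<Omega> by auto
    obtain S where S: "S \<subseteq> T" "closure (\<omega> j) = \<Union>S" using closure_\<omega>_Union by blast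
    then obtain \<tau> where \<tau>: "\<tau> \<in> S" "x \<in> \<tau>" using j by blast
    have "interior \<tau> \<subseteq> \<omega> j"
    proof -
      have "\<tau> \<subseteq> closure (\<omega> j)" using S(2) \<tau>(1) by auto
      then show ?thesis using interior_mono interior_closure_\<omega> by blast
    qed
    then have "x \<in> frontier \<tau>" using x \<tau> closure_subset[of \<tau>] by (auto simp: frontier_def)
    then show "x \<in> (\<Union>\<tau>\<in>T. frontier \<tau>)" using \<tau> S by blast
  qed
qed

section \<open>The global finite element space\<close>

lemma Vh_H1: "v \<in> Vh T \<Omega> \<Longrightarrow> v \<in> H1 \<Omega>"
  and Vh_P1: "v \<in> Vh T \<Omega> \<Longrightarrow> \<tau> \<in> T \<Longrightarrow> P1_on \<tau> v"
  and Vh_outside: "v \<in> Vh T \<Omega> \<Longrightarrow> x \<notin> closure \<Omega> \<Longrightarrow> v x = 0"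
  by (auto simp: Vh_def)

lemma Vh_add: "u \<in> Vh T \<Omega> \<Longrightarrow> v \<in> Vh T \<Omega> \<Longrightarrow> u + v \<in> Vh T \<Omega>"
  using H1_add[OF open_\<Omega> bounded_\<Omega>] P1_on_add by (auto simp: Vh_def)

lemma Vh_scale: "u \<in> Vh T \<Omega> \<Longrightarrow> scale_field c u \<in> Vh T \<Omega>"
  using H1_scale P1_on_scale by (auto simp: Vh_def scale_field_apply)

lemma Vh_cnj: "u \<in> Vh T \<Omega> \<Longrightarrow> (\<lambda>x. cnj (u x)) \<in> Vh T \<Omega>"
  using H1_cnj P1_on_cnj by (auto simp: Vh_def)

text \<open>Elements outside \<open>S\<close> cause no trouble: their interiors miss all elements of
  \<open>S\<close>, and a tetrahedron is the closure of its interior, so such an element lies in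
  \<open>closure (- \<Union>S)\<close>, where \<open>f\<close> is 0.\<close>

lemma Vh_piecewiseI:
  assumes "S \<subseteq> T" "\<And>\<tau>. \<tau> \<in> S \<Longrightarrow> P1_on \<tau> f" "\<And>x. x \<in> closure (- \<Union>S) \<Longrightarrow> f x = 0"
  shows "f \<in> Vh T \<Omega>"
  unfolding Vh_def
proof (intro CollectI conjI ballI allI impI)
  show "f \<in> H1 \<Omega>"
    by (rule piecewise_P1_H1[OF open_\<Omega> bounded_\<Omega> finite_subset[OF assms(1) finite_T]])
      (use assms compact_T convex_T in auto)
  show "f x = 0" if "x \<notin> closure \<Omega>" for x
  proof -
    have "x \<in> - \<Union>S" using that assms(1) unfolding Union_T[symmetric] by auto
    then show ?thesis using assms(3) closure_subset[of "- \<Union>S"] by auto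
  qed
  show "P1_on \<tau> f" if \<tau>: "\<tau> \<in> T" for \<tau>
  proof (cases "\<tau> \<in> S")
    case False
    have "interior \<tau> \<inter> \<sigma> = {}" if "\<sigma> \<in> S" for \<sigma>
      using triangulation_interior_disjoint[OF triangulation_T simplex_T \<tau>, of \<sigma>] that False assms(1) by blast
    then have "closure (interior \<tau>) \<subseteq> closure (- \<Union>S)" by (intro closure_mono) blast
    then show ?thesis using assms(3) simplex_3_interior[OF simplex_T[OF \<tau>]] by (intro P1_on_0) blast
  qed (use assms(2) in auto)
qed

lemma Vh_0: "0 \<in> Vh T \<Omega>"
  using Vh_piecewiseI[of "{}" 0] by simp

lemma subspace_Vh: "field_space.subspace (Vh T \<Omega>)"
  using Vh_0 Vh_add Vh_scale by (intro field_space.subspaceI)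

text \<open>The complement of the elements filling \<open>closure (\<omega> j)\<close> has as its
  closure the complement of \<open>\<omega> j\<close>. There the extension is 0, on the frontier by
  assumption and beyond it by construction.\<close>

lemma Vh_zero_extension:
  assumes w: "w \<in> Vh T \<Omega>" "\<And>x. x \<in> frontier (\<omega> j) \<Longrightarrow> w x = 0"
  shows "restr (closure (\<omega> j)) w \<in> Vh T \<Omega>"
proof -
  obtain S where S: "S \<subseteq> T" "closure (\<omega> j) = \<Union>S" using closure_\<omega>_Union by blast
  show ?thesis
  proof (rule Vh_piecewiseI[OF S(1)])
    show "P1_on \<tau> (restr (closure (\<omega> j)) w)" if "\<tau> \<in> S" for \<tau>
    proof -
      have "P1_on \<tau> w" using w(1) that S(1) Vh_P1 by blast
      moreover have "\<tau> \<subseteq> closure (\<omega> j)" using S(2) that by blast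
      ultimately show ?thesis by (subst P1_on_cong[where v=w]) (auto simp: restr_def)
    qed
    fix x assume "x \<in> closure (- \<Union>S)"
    then have "x \<notin> \<omega> j"
      unfolding S(2)[symmetric] closure_complement interior_closure_\<omega> by simp
    then show "restr (closure (\<omega> j)) w x = 0"
      using w(2)[of x] by (auto simp: restr_def frontier_\<omega>)
  qed
qed

lemma Vh_continuous:
  assumes "v \<in> Vh T \<Omega>" shows "continuous_on (closure \<Omega>) v"
proof -
  have "continuous_on (\<Union>\<tau>\<in>T. \<tau>) v"
  proof (rule continuous_on_closed_Union[OF finite_T closed_T])
    fix \<tau> assume "\<tau> \<in> T"
    then obtain K where "K-lipschitz_on \<tau> v" using P1_on_lipschitz[OF Vh_P1[OF assms]] by auto
    then show "continuous_on \<tau> v" by (rule lipschitz_on_continuous_on)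
  qed
  then show ?thesis by (simp add: Union_T)
qed

text \<open>Any finite generating sets of the elements will do, since only finiteness and the
  determination of affine functions by their values there are used. Evaluations at these points form
  the separating family of \<open>trace_form\<close>.\<close>

definition nodes :: "(real^3) set" where
  "nodes = (\<Union>\<tau>\<in>T. SOME C. finite C \<and> \<tau> = convex hull C)"

lemma nodes_T:
  assumes "\<tau> \<in> T" obtains C where "finite C" "\<tau> = convex hull C" "C \<subseteq> nodes"
proof -
  have "\<exists>C. finite C \<and> \<tau> = convex hull C" using simplex_T[OF assms] by (auto simp: simplex)
  then have "finite (SOME C. finite C \<and> \<tau> = convex hull C) \<and> \<tau> = convex hull (SOME C. finite C \<and> \<tau> = convex hull C)"
    by (rule someI_ex)
  then show ?thesis by (intro that) (use assms in \<open>auto simp: nodes_def\<close>)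
qed

lemma finite_nodes: "finite nodes"
  unfolding nodes_def
proof (rule finite_UN_I[OF finite_T])
  fix \<tau> assume "\<tau> \<in> T"
  then have "\<exists>C. finite C \<and> \<tau> = convex hull C" using simplex_T by (auto simp: simplex)
  then show "finite (SOME C. finite C \<and> \<tau> = convex hull C)" by (rule someI2_ex) simp
qed

lemma P1_zero_if_zero_at_nodes:
  assumes "\<tau> \<in> T" "P1_on \<tau> v" "\<And>x. x \<in> nodes \<inter> \<tau> \<Longrightarrow> v x = 0" "x \<in> \<tau>"
  shows "v x = 0"
proof -
  obtain C where "finite C" "\<tau> = convex hull C" "C \<subseteq> nodes" using nodes_T[OF assms(1)] .
  then show ?thesis
    using assms hull_subset[of C convex] by (intro P1_on_zero_on_hull[of \<tau> v C x]) auto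
qed

lemma Vh_eq_0:
  assumes "v \<in> Vh T \<Omega>" "\<forall>x\<in>nodes. v x = 0" shows "v = 0"
proof (rule ext)
  fix x
  show "v x = 0 x"
  proof (cases "x \<in> closure \<Omega>")
    case True
    then obtain \<tau> where "\<tau> \<in> T" "x \<in> \<tau>" using Union_T by blast
    then show ?thesis using P1_zero_if_zero_at_nodes[of \<tau> v x] assms Vh_P1 by auto
  qed (use assms Vh_outside in auto)
qed

section \<open>Restricted spaces, tuples and gluing\<close>

lemma subspace_Vh_restr: "field_space.subspace (Vh_restr T \<Omega> D)"
proof (rule field_space.subspaceI)
  show "0 \<in> Vh_restr T \<Omega> D"
    unfolding Vh_restr_def
    by (rule image_eqI[where f="restr D" and x=0]) (simp_all only: restr_0 Vh_0)
  show "u + v \<in> Vh_restr T \<Omega> D" if "u \<in> Vh_restr T \<Omega> D" "v \<in> Vh_restr T \<Omega> D" for u v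
    using that unfolding Vh_restr_def by (auto simp flip: restr_add intro: Vh_add)
  show "scale_field c u \<in> Vh_restr T \<Omega> D" if "u \<in> Vh_restr T \<Omega> D" for c u
    using that unfolding Vh_restr_def by (auto simp flip: restr_scale intro: Vh_scale)
qed

lemma subspace_VVh_vol: "tuple_space.subspace (VVh_vol T \<Omega> \<omega>)"
  unfolding VVh_vol_def scale_tuple_def
  by (rule tuple_space.subspaceI[unfolded scale_tuple_def])
    (auto intro: field_space.subspace_add field_space.subspace_scale field_space.subspace_0 subspace_Vh_restr)

text \<open>A global function representing the component is known to vanish only at the nodes in
  \<open>closure (\<omega> j)\<close>; this suffices because that closure consists of whole
  elements.\<close>

lemma VVh_vol_eq_0:
  assumes "v \<in> VVh_vol T \<Omega> \<omega>" "\<forall>j. \<forall>x\<in>nodes. v j x = 0" shows "v = 0"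
proof (intro ext)
  fix j x
  obtain w where w: "w \<in> Vh T \<Omega>" "v j = restr (closure (\<omega> j)) w"
    using assms(1) by (auto simp: VVh_vol_def Vh_restr_def)
  obtain S where S: "S \<subseteq> T" "closure (\<omega> j) = \<Union>S" using closure_\<omega>_Union by blast
  show "v j x = 0 j x"
  proof (cases "x \<in> closure (\<omega> j)")
    case True
    then obtain \<tau> where \<tau>: "\<tau> \<in> S" "x \<in> \<tau>" using S by blast
    have "w x = 0"
    proof (rule P1_zero_if_zero_at_nodes)
      show "\<tau> \<in> T" "P1_on \<tau> w" "x \<in> \<tau>" using \<tau> S w Vh_P1 by auto
      show "w y = 0" if "y \<in> nodes \<inter> \<tau>" for y
      proof -
        have "y \<in> closure (\<omega> j)" using that \<tau> S by blast
        then show ?thesis using that assms(2)[rule_format, of y j] w(2) by (auto simp: restr_def)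
      qed
    qed
    then show ?thesis using w by (simp add: restr_def)
  qed (simp add: w restr_def)
qed

text \<open>The differences of the local functions to a global finite element function with trace \<open>p\<close> vanish
  on the boundaries of the subdomains, so they extend by zero.\<close>

lemma gluing:
  assumes v: "v \<in> VVh_vol T \<Omega> \<omega>" and p: "p \<in> Vh_skel T \<Omega> \<omega>"
    and tr: "trace_loc \<omega> v = skel_restr \<omega> p"
  obtains u where "u \<in> Vh T \<Omega>" "trace_glob \<omega> u = p" "\<And>j. restr (closure (\<omega> j)) u = v j"
proof -
  have "\<forall>j. \<exists>w. w \<in> Vh T \<Omega> \<and> v j = restr (closure (\<omega> j)) w"
    using v by (auto simp: VVh_vol_def Vh_restr_def)
  from choice[OF this] obtain w where
    w: "\<And>j. w j \<in> Vh T \<Omega>" "\<And>j. v j = restr (closure (\<omega> j)) (w j)" by auto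
  obtain u0 where u0: "u0 \<in> Vh T \<Omega>" "p = restr (skeleton \<omega>) u0"
    using p by (auto simp: Vh_skel_def Vh_restr_def)
  define d where "d j = w j - u0" for j
  have d: "d j \<in> Vh T \<Omega>" for j
    unfolding d_def using field_space.subspace_diff[OF subspace_Vh w(1) u0(1)] .
  have d0: "d j x = 0" if x: "x \<in> frontier (\<omega> j)" for j x
  proof -
    have "trace_loc \<omega> v j x = skel_restr \<omega> p j x" using tr by simp
    moreover have "x \<in> closure (\<omega> j)" "x \<in> skeleton \<omega>"
      using x frontier_subset_skeleton by (auto simp: frontier_\<omega>)
    ultimately show ?thesis
      using x by (simp add: trace_loc_def skel_restr_def restr_def w(2) u0(2) d_def)
  qed
  define z where "z j = restr (closure (\<omega> j)) (d j)" for j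
  have z: "z j \<in> Vh T \<Omega>" for j unfolding z_def using d d0 by (rule Vh_zero_extension)
  define u where "u = u0 + (\<Sum>j\<in>UNIV. z j)"
  have u: "u \<in> Vh T \<Omega>"
    unfolding u_def using field_space.subspace_sum[OF subspace_Vh, of UNIV z] z u0(1) by (intro Vh_add) auto
  have sum_apply: "(\<Sum>j\<in>A. z j) x = (\<Sum>j\<in>A. z j x)" for A x
    by (induction A rule: infinite_finite_induct) auto
  have u_eq: "u x = w i x" if x: "x \<in> closure (\<omega> i)" for i x
  proof -
    \<comment> \<open>Either \<open>x\<close> lies outside \<open>closure (\<omega> j)\<close>,
      where the extension is 0, or it lies on the frontier of \<open>\<omega> j\<close>, where
      \<open>d j\<close> vanishes. So only the correction belonging to \<open>i\<close>
      survives.\<close>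
    have "z j x = 0" if "j \<noteq> i" for j
      using closures_meet_in_frontier[of i j] that x d0 by (auto simp: z_def restr_def)
    then have "(\<Sum>j\<in>UNIV. z j x) = (\<Sum>j\<in>{i}. z j x)" by (intro sum.mono_neutral_right) auto
    moreover have "u x = u0 x + (\<Sum>j\<in>UNIV. z j x)" by (simp add: u_def sum_apply)
    ultimately show ?thesis using x by (simp add: z_def restr_def d_def)
  qed
  show ?thesis
  proof (rule that[OF u])
    show "restr (closure (\<omega> j)) u = v j" for j
      using u_eq by (auto simp: w(2) restr_def fun_eq_iff)
    show "trace_glob \<omega> u = p"
    proof (rule ext)
      fix x
      show "trace_glob \<omega> u x = p x"
      proof (cases "x \<in> skeleton \<omega>")
        case True
        then obtain j where j: "x \<in> frontier (\<omega> j)" by (auto simp: skeleton_def)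
        then have "u x = w j x" using u_eq by (auto simp: frontier_\<omega>)
        also have "\<dots> = u0 x" using d0[OF j] by (simp add: d_def)
        finally show ?thesis using True by (simp add: trace_glob_def restr_def u0(2))
      qed (simp add: trace_glob_def restr_def u0(2))
    qed
  qed
qed

end

section \<open>The Schur complement identity\<close>

locale fe_problem = fe_decomposition \<Omega> T \<omega> + elliptic_coefficients \<Omega> \<alpha> \<beta> \<alpha>m \<alpha>p \<beta>m \<beta>p
  for \<Omega> T and \<omega> :: "'j::finite \<Rightarrow> (real^3) set" and \<alpha> \<beta> \<alpha>m \<alpha>p \<beta>m \<beta>p
begin

lemma elliptic_\<omega>: "elliptic_coefficients (\<omega> j) \<alpha> \<beta> \<alpha>m \<alpha>p \<beta>m \<beta>p"
  by (rule elliptic_subset[OF open_\<omega> \<omega>_subset])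

lemma Vh_restr_\<omega>:
  assumes "v \<in> Vh_restr T \<Omega> (closure (\<omega> j))"
  shows "v \<in> H1 (\<omega> j)" "continuous_on (closure (\<omega> j)) v" "x \<notin> closure (\<omega> j) \<Longrightarrow> v x = 0"
proof -
  obtain w where w: "w \<in> Vh T \<Omega>" "v = restr (closure (\<omega> j)) w"
    using assms by (auto simp: Vh_restr_def)
  have eq: "v x = w x" if "x \<in> closure (\<omega> j)" for x using that w by (simp add: restr_def)
  have "w \<in> H1 (\<omega> j)" using H1_subset[OF open_D open_\<omega> \<omega>_subset Vh_H1[OF w(1)]] .
  then show "v \<in> H1 (\<omega> j)"
    using H1_cong[of "\<omega> j" v w] eq closure_subset[of "\<omega> j"] by auto
  have "continuous_on (closure (\<omega> j)) w"
    using Vh_continuous[OF w(1)] closure_\<omega>_subset by (rule continuous_on_subset)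
  then show "continuous_on (closure (\<omega> j)) v" using eq by (simp cong: continuous_on_cong)
  show "x \<notin> closure (\<omega> j) \<Longrightarrow> v x = 0" by (simp add: w restr_def)
qed

section \<open>Definiteness of the global and the broken energy\<close>

definition broken_energy :: "('j \<Rightarrow> field3) \<Rightarrow> ('j \<Rightarrow> field3) \<Rightarrow> complex" where
  "broken_energy u v = (\<Sum>j\<in>UNIV. energy \<alpha> \<beta> (\<omega> j) (u j) (v j))"

lemma energy_eq_broken_energy:
  assumes "u \<in> Vh T \<Omega>" "v \<in> Vh T \<Omega>"
  shows "energy \<alpha> \<beta> \<Omega> u v
    = broken_energy (\<lambda>j. restr (closure (\<omega> j)) u) (\<lambda>j. restr (closure (\<omega> j)) v)"
proof -
  have "energy \<alpha> \<beta> \<Omega> u v = (\<Sum>j\<in>UNIV. energy \<alpha> \<beta> (\<omega> j) u v)"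
    by (rule energy_decomposition[OF open_\<omega> \<omega>_subset disjoint_\<omega> negligible_gap])
      (simp_all add: assms Vh_H1)
  also have "\<dots> = broken_energy (\<lambda>j. restr (closure (\<omega> j)) u) (\<lambda>j. restr (closure (\<omega> j)) v)"
    unfolding broken_energy_def
  proof (intro sum.cong refl energy_cong)
    show "u x = restr (closure (\<omega> j)) u x" "v x = restr (closure (\<omega> j)) v x" if "x \<in> \<omega> j" for j x
      using subsetD[OF closure_subset that] by (simp_all add: restr_def)
  qed
  finally show ?thesis .
qed

lemma VVh_volD: "v \<in> VVh_vol T \<Omega> \<omega> \<Longrightarrow> v j \<in> Vh_restr T \<Omega> (closure (\<omega> j))"
  by (simp add: VVh_vol_def)

lemma VVh_vol_cnj:
  assumes "v \<in> VVh_vol T \<Omega> \<omega>" shows "(\<lambda>j x. cnj (v j x)) \<in> VVh_vol T \<Omega> \<omega>"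
proof -
  have "(\<lambda>x. cnj (v j x)) \<in> Vh_restr T \<Omega> (closure (\<omega> j))" for j
  proof -
    obtain w where "w \<in> Vh T \<Omega>" "v j = restr (closure (\<omega> j)) w"
      using VVh_volD[OF assms, of j] by (auto simp: Vh_restr_def)
    then show ?thesis unfolding Vh_restr_def
      by (intro image_eqI[where x="\<lambda>x. cnj (w x)"]) (simp_all add: restr_cnj Vh_cnj)
  qed
  then show ?thesis by (simp add: VVh_vol_def)
qed

text \<open>The summands are nonnegative reals, so each of them vanishes separately; continuity up
  to the boundary then removes the exceptional null sets.\<close>

lemma broken_energy_definite:
  assumes v: "v \<in> VVh_vol T \<Omega> \<omega>" and zero: "broken_energy v (\<lambda>j x. cnj (v j x)) = 0"
  shows "v = 0"
proof -
  have "\<exists>r. energy \<alpha> \<beta> (\<omega> j) (v j) (\<lambda>x. cnj (v j x)) = of_real r \<and> 0 \<le> r \<and>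
      (r = 0 \<longrightarrow> (AE x in lebesgue_on (\<omega> j). v j x = 0))" for j
  proof -
    interpret sub: elliptic_coefficients "\<omega> j" \<alpha> \<beta> \<alpha>m \<alpha>p \<beta>m \<beta>p by (rule elliptic_\<omega>)
    show ?thesis
      using sub.energy_cnj_nonneg_real[OF Vh_restr_\<omega>(1)[OF VVh_volD[OF v]]] by metis
  qed
  then obtain r where r: "\<And>j. energy \<alpha> \<beta> (\<omega> j) (v j) (\<lambda>x. cnj (v j x)) = of_real (r j)"
    "\<And>j. 0 \<le> r j" "\<And>j. r j = 0 \<Longrightarrow> AE x in lebesgue_on (\<omega> j). v j x = 0" by metis
  have "of_real (\<Sum>j\<in>UNIV. r j) = (0::complex)" using zero by (simp add: broken_energy_def r(1))
  then have "(\<Sum>j\<in>UNIV. r j) = 0" by (simp only: of_real_eq_0_iff)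
  then have r0: "r j = 0" for j using r(2) by (simp add: sum_nonneg_eq_0_iff)
  have "v j x = 0" for j x
  proof (cases "x \<in> closure (\<omega> j)")
    case True
    then show ?thesis
      by (intro AE_zero_imp_zero_on_closure[OF open_\<omega> Vh_restr_\<omega>(2)[OF VVh_volD[OF v]] r(3)[OF r0]])
  qed (rule Vh_restr_\<omega>(3)[OF VVh_volD[OF v]])
  then show ?thesis by (simp add: fun_eq_iff)
qed

lemma energy_definite:
  assumes u: "u \<in> Vh T \<Omega>" and zero: "energy \<alpha> \<beta> \<Omega> u (\<lambda>x. cnj (u x)) = 0"
  shows "u = 0"
proof -
  obtain r where r: "energy \<alpha> \<beta> \<Omega> u (\<lambda>x. cnj (u x)) = of_real r"
    "r = 0 \<Longrightarrow> AE x in lebesgue_on \<Omega>. u x = 0"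
    using energy_cnj_nonneg_real[OF Vh_H1[OF u]] by metis
  have "AE x in lebesgue_on \<Omega>. u x = 0" using r zero by simp
  then have "u x = 0" for x
    using AE_zero_imp_zero_on_closure[OF open_D Vh_continuous[OF u]] Vh_outside[OF u] by blast
  then show ?thesis by (simp add: fun_eq_iff)
qed

lemma trace_form_glob:
  "trace_form scale_field scale_field (Vh T \<Omega>) ((\<lambda>x v. v x) ` nodes)
     (energy \<alpha> \<beta> \<Omega>) (\<lambda>v x. cnj (v x)) (trace_glob \<omega>)"
proof unfold_locales
  show "field_space.subspace (Vh T \<Omega>)" by (rule subspace_Vh)
  show "finite ((\<lambda>x v. v x) ` nodes :: (field3 \<Rightarrow> complex) set)" using finite_nodes by simp
  show "linear_form_on scale_field (Vh T \<Omega>) f" if "f \<in> (\<lambda>x v. v x) ` nodes" for f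
    using that by (auto simp: linear_form_on_def scale_field_def)
  show "v = 0" if "v \<in> Vh T \<Omega>" "\<forall>f\<in>(\<lambda>x v. v x) ` nodes. f v = 0" for v
    using that by (intro Vh_eq_0) auto
  show "linear_form_on scale_field (Vh T \<Omega>) (energy \<alpha> \<beta> \<Omega> u)" if "u \<in> Vh T \<Omega>" for u
    using that by (simp add: linear_form_on_def energy_add_right energy_scale_right Vh_H1)
  show "energy \<alpha> \<beta> \<Omega> u v = energy \<alpha> \<beta> \<Omega> v u" for u v by (rule energy_commute)
  show "(\<lambda>x. cnj (v x)) \<in> Vh T \<Omega>" if "v \<in> Vh T \<Omega>" for v using that by (rule Vh_cnj)
  show "v = 0" if "v \<in> Vh T \<Omega>" "energy \<alpha> \<beta> \<Omega> v (\<lambda>x. cnj (v x)) = 0" for v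
    using that by (rule energy_definite)
  show "trace_glob \<omega> (u + v) = trace_glob \<omega> u + trace_glob \<omega> v" for u v
    by (simp only: trace_glob_def restr_add)
  show "trace_glob \<omega> (scale_field c u) = scale_field c (trace_glob \<omega> u)" for c u
    by (simp only: trace_glob_def restr_scale)
  show "scale_field c 0 = 0" for c by (rule field_space.scale_zero_right)
  show "trace_glob \<omega> (\<lambda>x. cnj (v x)) = 0" if "trace_glob \<omega> v = 0" for v
    using that by (simp add: trace_glob_def restr_cnj fun_eq_iff)
qed

text \<open>Functionals on tuples are indexed by a component together with a node. The trace
  commutes with complex conjugation, which keeps its kernel stable.\<close>

lemma trace_form_loc:
  "trace_form scale_tuple scale_tuple (VVh_vol T \<Omega> \<omega>) ((\<lambda>(j, x) v. v j x) ` (UNIV \<times> nodes))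
     broken_energy (\<lambda>v j x. cnj (v j x)) (trace_loc \<omega>)"
proof unfold_locales
  show "tuple_space.subspace (VVh_vol T \<Omega> \<omega>)" by (rule subspace_VVh_vol)
  show "finite ((\<lambda>(j, x) v. v j x) ` (UNIV \<times> nodes) :: (('j \<Rightarrow> field3) \<Rightarrow> complex) set)"
    using finite_nodes by simp
  show "linear_form_on scale_tuple (VVh_vol T \<Omega> \<omega>) f" if "f \<in> (\<lambda>(j, x) v. v j x) ` (UNIV \<times> nodes)" for f
    using that by (auto simp: linear_form_on_def scale_tuple_def scale_field_def)
  show "v = 0" if "v \<in> VVh_vol T \<Omega> \<omega>" "\<forall>f\<in>(\<lambda>(j, x) v. v j x) ` (UNIV \<times> nodes). f v = 0" for v
    using that by (intro VVh_vol_eq_0) auto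
  show "linear_form_on scale_tuple (VVh_vol T \<Omega> \<omega>) (broken_energy u)" if u: "u \<in> VVh_vol T \<Omega> \<omega>" for u
  proof -
    note H1 = Vh_restr_\<omega>(1)[OF VVh_volD]
    have "energy \<alpha> \<beta> (\<omega> j) (u j) (v j + w j) = energy \<alpha> \<beta> (\<omega> j) (u j) (v j) + energy \<alpha> \<beta> (\<omega> j) (u j) (w j)"
      if "v \<in> VVh_vol T \<Omega> \<omega>" "w \<in> VVh_vol T \<Omega> \<omega>" for v w j
      by (rule elliptic_coefficients.energy_add_right[OF elliptic_\<omega> H1[OF u] H1[OF that(1)] H1[OF that(2)]])
    moreover have "energy \<alpha> \<beta> (\<omega> j) (u j) (scale_field c (v j)) = c * energy \<alpha> \<beta> (\<omega> j) (u j) (v j)"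
      if "v \<in> VVh_vol T \<Omega> \<omega>" for v c j
      by (rule elliptic_coefficients.energy_scale_right[OF elliptic_\<omega> H1[OF u] H1[OF that]])
    ultimately show ?thesis
      by (simp add: linear_form_on_def broken_energy_def scale_tuple_def sum.distrib sum_distrib_left)
  qed
  show "broken_energy u v = broken_energy v u" for u v
    unfolding broken_energy_def by (intro sum.cong refl elliptic_coefficients.energy_commute[OF elliptic_\<omega>])
  show "(\<lambda>j x. cnj (v j x)) \<in> VVh_vol T \<Omega> \<omega>" if "v \<in> VVh_vol T \<Omega> \<omega>" for v using that by (rule VVh_vol_cnj)
  show "v = 0" if "v \<in> VVh_vol T \<Omega> \<omega>" "broken_energy v (\<lambda>j x. cnj (v j x)) = 0" for v
    using that by (rule broken_energy_definite)
  show "trace_loc \<omega> (u + v) = trace_loc \<omega> u + trace_loc \<omega> v" for u v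
    by (simp add: trace_loc_def restr_add fun_eq_iff)
  show "trace_loc \<omega> (scale_tuple c u) = scale_tuple c (trace_loc \<omega> u)" for c u
    by (simp add: trace_loc_def scale_tuple_def restr_scale)
  show "scale_tuple c 0 = (0 :: 'j \<Rightarrow> field3)" for c by (rule tuple_space.scale_zero_right)
  show "trace_loc \<omega> (\<lambda>j x. cnj (v j x)) = 0" if "trace_loc \<omega> v = 0" for v
    using that by (simp add: trace_loc_def restr_cnj fun_eq_iff)
qed

section \<open>The concrete operators as instances of the abstract ones\<close>

interpretation glob: trace_form scale_field scale_field "Vh T \<Omega>" "(\<lambda>x v. v x) ` nodes"
  "energy \<alpha> \<beta> \<Omega>" "\<lambda>v x. cnj (v x)" "trace_glob \<omega>"
  by (rule trace_form_glob)

interpretation loc: trace_form scale_tuple scale_tuple "VVh_vol T \<Omega> \<omega>" "(\<lambda>(j, x) v. v j x) ` (UNIV \<times> nodes)"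
  broken_energy "\<lambda>v j x. cnj (v j x)" "trace_loc \<omega>"
  by (rule trace_form_loc)

lemma L_glob_eq: "L_glob T \<Omega> \<alpha> \<beta> = glob.L"
  by (simp add: L_glob_def energy_op_def glob.L_def fun_eq_iff)

lemma L_loc_eq: "L_loc T \<Omega> \<omega> \<alpha> \<beta> = loc.L"
proof (intro ext)
  fix u v
  show "L_loc T \<Omega> \<omega> \<alpha> \<beta> u v = loc.L u v"
    by (cases "v \<in> VVh_vol T \<Omega> \<omega>")
      (simp_all add: L_loc_def loc.L_def L_sub_def energy_op_def broken_energy_def VVh_volD)
qed

lemma TL_inv_eq: "TL_inv T \<Omega> \<omega> \<alpha> \<beta> = loc.S"
  by (simp only: TL_inv_def L_loc_eq)

lemma trace_glob_image: "trace_glob \<omega> ` Vh T \<Omega> = Vh_skel T \<Omega> \<omega>"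
  by (simp add: Vh_skel_def Vh_restr_def trace_glob_def[abs_def])

lemma trace_loc_restr:
  "trace_loc \<omega> (\<lambda>j. restr (closure (\<omega> j)) (w j)) = (\<lambda>j. restr (frontier (\<omega> j)) (w j))"
  by (auto simp: trace_loc_def restr_def fun_eq_iff frontier_\<omega>)

lemma trace_loc_image: "trace_loc \<omega> ` VVh_vol T \<Omega> \<omega> = VVh_skel T \<Omega> \<omega>"
proof (intro subset_antisym subsetI)
  fix p assume "p \<in> trace_loc \<omega> ` VVh_vol T \<Omega> \<omega>"
  then obtain v where v: "v \<in> VVh_vol T \<Omega> \<omega>" "p = trace_loc \<omega> v" by blast
  have "p j \<in> Vh_restr T \<Omega> (frontier (\<omega> j))" for j
  proof -
    obtain w where "w \<in> Vh T \<Omega>" "v j = restr (closure (\<omega> j)) w"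
      using VVh_volD[OF v(1), of j] by (auto simp: Vh_restr_def)
    then show ?thesis unfolding Vh_restr_def
      by (intro image_eqI[where x=w]) (auto simp: v(2) trace_loc_def restr_def fun_eq_iff frontier_\<omega>)
  qed
  then show "p \<in> VVh_skel T \<Omega> \<omega>" by (simp add: VVh_skel_def)
next
  fix p assume "p \<in> VVh_skel T \<Omega> \<omega>"
  then have "\<forall>j. \<exists>w. w \<in> Vh T \<Omega> \<and> p j = restr (frontier (\<omega> j)) w"
    by (auto simp: VVh_skel_def Vh_restr_def)
  from choice[OF this] obtain w where
    w: "\<And>j. w j \<in> Vh T \<Omega>" "\<And>j. p j = restr (frontier (\<omega> j)) (w j)" by auto
  show "p \<in> trace_loc \<omega> ` VVh_vol T \<Omega> \<omega>"
  proof (rule image_eqI)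
    show "p = trace_loc \<omega> (\<lambda>j. restr (closure (\<omega> j)) (w j))"
      by (simp add: trace_loc_restr fun_eq_iff w(2))
    show "(\<lambda>j. restr (closure (\<omega> j)) (w j)) \<in> VVh_vol T \<Omega> \<omega>"
      using w(1) by (auto simp: VVh_vol_def Vh_restr_def)
  qed
qed

text \<open>Shares its right-hand side with \<open>trace_loc_restr\<close>: restricting to
  subdomains and then taking local traces is the same as taking the global trace and then applying
  \<open>R\<close>.\<close>

lemma skel_restr_trace_glob: "skel_restr \<omega> (trace_glob \<omega> u) = (\<lambda>j. restr (frontier (\<omega> j)) u)"
  using frontier_subset_skeleton by (auto simp: skel_restr_def trace_glob_def restr_def fun_eq_iff)

text \<open>\<open>glob.S_eq_iff\<close> asks only for a witness of the weak equation, and the glued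
  function is one. Membership in the dual comes first because that criterion requires it.\<close>

lemma RTR_right_inverse:
  assumes p: "p \<in> Vh_skel T \<Omega> \<omega>"
  shows "RTR T \<Omega> \<omega> \<alpha> \<beta> p \<in> dual_space scale_field (Vh_skel T \<Omega> \<omega>)" (is "?\<chi> \<in> ?X")
    and "glob.S (RTR T \<Omega> \<omega> \<alpha> \<beta> p) = p"
proof -
  let ?Y = "dual_space scale_tuple (VVh_skel T \<Omega> \<omega>)"
  have R: "skel_restr \<omega> q \<in> VVh_skel T \<Omega> \<omega>" if "q \<in> Vh_skel T \<Omega> \<omega>" for q
    using that unfolding trace_glob_image[symmetric]
    by (auto simp: skel_restr_trace_glob VVh_skel_def Vh_restr_def)
  define \<psi> where "\<psi> = TL T \<Omega> \<omega> \<alpha> \<beta> (skel_restr \<omega> p)"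
  have bij: "bij_betw loc.S ?Y (VVh_skel T \<Omega> \<omega>)"
    using loc.bij_betw_S by (simp only: trace_loc_image)
  \<comment> \<open>\<open>TL\<close> is an \<open>inv_into\<close>, hence a true inverse only at
    values of \<open>loc.S\<close> on the dual; this places \<open>skel_restr \<omega> p\<close>
    among them.\<close>
  then have surj: "skel_restr \<omega> p \<in> loc.S ` ?Y"
    using R[OF p] by (simp only: bij_betw_imp_surj_on)
  have \<psi>: "\<psi> \<in> ?Y" "loc.S \<psi> = skel_restr \<omega> p"
    unfolding \<psi>_def TL_def TL_inv_eq by (rule inv_into_into[OF surj] f_inv_into_f[OF surj])+
  have \<chi>: "?\<chi> q = \<psi> (skel_restr \<omega> q)" if "q \<in> Vh_skel T \<Omega> \<omega>" for q
    using that by (simp add: RTR_def dual_map_def \<psi>_def)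
  have closed: "p + q \<in> Vh_skel T \<Omega> \<omega>" "scale_field c p \<in> Vh_skel T \<Omega> \<omega>"
    if "p \<in> Vh_skel T \<Omega> \<omega>" "q \<in> Vh_skel T \<Omega> \<omega>" for c p q
    using subspace_Vh_restr[of "skeleton \<omega>"] that field_space.subspace_add field_space.subspace_scale
    unfolding Vh_skel_def by blast+
  show X: "?\<chi> \<in> ?X"
    unfolding dual_space_def
  proof (intro CollectI conjI ballI allI impI)
    fix q r assume q: "q \<in> Vh_skel T \<Omega> \<omega>" and r: "r \<in> Vh_skel T \<Omega> \<omega>"
    have "skel_restr \<omega> (q + r) = skel_restr \<omega> q + skel_restr \<omega> r"
      by (simp add: skel_restr_def restr_add fun_eq_iff)
    then show "?\<chi> (q + r) = ?\<chi> q + ?\<chi> r"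
      using linear_form_on_add[OF linear_form_on_dual_space[OF \<psi>(1)] R[OF q] R[OF r]]
      by (simp add: \<chi> closed q r)
  next
    fix c q assume q: "q \<in> Vh_skel T \<Omega> \<omega>"
    have "skel_restr \<omega> (scale_field c q) = scale_tuple c (skel_restr \<omega> q)"
      by (simp add: skel_restr_def restr_scale scale_tuple_def)
    then show "?\<chi> (scale_field c q) = c * ?\<chi> q"
      using linear_form_on_scale[OF linear_form_on_dual_space[OF \<psi>(1)] R[OF q]]
      by (simp add: \<chi> closed(2)[OF q q] q)
  next
    fix q assume "q \<notin> Vh_skel T \<Omega> \<omega>"
    then show "?\<chi> q = 0" by (simp add: RTR_def dual_map_def)
  qed
  obtain w where w: "w \<in> VVh_vol T \<Omega> \<omega>" "trace_loc \<omega> w = skel_restr \<omega> p"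
    "\<And>v. v \<in> VVh_vol T \<Omega> \<omega> \<Longrightarrow> broken_energy w v = \<psi> (trace_loc \<omega> v)"
    using loc.S_eq_iff[unfolded trace_loc_image, OF \<psi>(1)] \<psi>(2) by blast
  obtain u where u: "u \<in> Vh T \<Omega>" "trace_glob \<omega> u = p" "\<And>j. restr (closure (\<omega> j)) u = w j"
    using gluing[OF w(1) p w(2)] by blast
  have "energy \<alpha> \<beta> \<Omega> u v = ?\<chi> (trace_glob \<omega> v)" if v: "v \<in> Vh T \<Omega>" for v
  proof -
    have "energy \<alpha> \<beta> \<Omega> u v = broken_energy w (\<lambda>j. restr (closure (\<omega> j)) v)"
      using energy_eq_broken_energy[OF u(1) v] by (simp add: u(3))
    also have "\<dots> = \<psi> (trace_loc \<omega> (\<lambda>j. restr (closure (\<omega> j)) v))"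
      using v by (intro w(3)) (auto simp: VVh_vol_def Vh_restr_def)
    also have "\<dots> = \<psi> (skel_restr \<omega> (trace_glob \<omega> v))"
      by (simp only: trace_loc_restr skel_restr_trace_glob)
    also have "\<dots> = ?\<chi> (trace_glob \<omega> v)"
      using v trace_glob_image by (intro \<chi>[symmetric]) blast
    finally show ?thesis .
  qed
  then show "glob.S ?\<chi> = p"
    using glob.S_eq_iff[unfolded trace_glob_image, OF X] u by blast
qed

text \<open>One-sided information is enough: \<open>glob.S\<close> is already a bijection from the
  dual onto the trace space, so a map into the dual that it sends back to the identity must be its
  inverse.\<close>

lemma RTR_inverse:
  "bij_betw (RTR T \<Omega> \<omega> \<alpha> \<beta>) (Vh_skel T \<Omega> \<omega>) (dual_space scale_field (Vh_skel T \<Omega> \<omega>))"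
  "\<phi> \<in> dual_space scale_field (Vh_skel T \<Omega> \<omega>) \<Longrightarrow>
    inv_into (Vh_skel T \<Omega> \<omega>) (RTR T \<Omega> \<omega> \<alpha> \<beta>) \<phi> =
      (trace_glob \<omega> \<circ> inv_into (Vh T \<Omega>) (L_glob T \<Omega> \<alpha> \<beta>) \<circ> dual_map (Vh T \<Omega>) (trace_glob \<omega>)) \<phi>"
proof -
  let ?X = "Vh_skel T \<Omega> \<omega>" and ?R = "RTR T \<Omega> \<omega> \<alpha> \<beta>"
  let ?X' = "dual_space scale_field ?X"
  have bij: "bij_betw glob.S ?X' ?X"
    using glob.bij_betw_S by (simp only: trace_glob_image)
  have inj: "inj_on glob.S ?X'" using bij by (rule bij_betw_imp_inj_on)
  have eq: "?R p = inv_into ?X' glob.S p" if "p \<in> ?X" for p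
    using inv_into_f_f[OF inj RTR_right_inverse(1)[OF that]]
    unfolding RTR_right_inverse(2)[OF that] by (rule sym)
  have "bij_betw (inv_into ?X' glob.S) ?X ?X'" using bij by (rule bij_betw_inv_into)
  then show b: "bij_betw ?R ?X ?X'" using eq by (simp cong: bij_betw_cong)
  assume \<phi>: "\<phi> \<in> ?X'"
  then have S\<phi>: "glob.S \<phi> \<in> ?X" by (rule bij_betwE[OF bij, rule_format])
  have "inv_into ?X ?R \<phi> = glob.S \<phi>"
    using eq[OF S\<phi>] inv_into_f_f[OF inj \<phi>]
    by (intro inv_into_f_eq[OF bij_betw_imp_inj_on[OF b] S\<phi>]) simp
  then show "inv_into ?X ?R \<phi> =
      (trace_glob \<omega> \<circ> inv_into (Vh T \<Omega>) (L_glob T \<Omega> \<alpha> \<beta>) \<circ> dual_map (Vh T \<Omega>) (trace_glob \<omega>)) \<phi>"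
    by (simp only: L_glob_eq)
qed

end

theorem theorem3p2:
  fixes \<Omega> :: "(real^3) set" and T :: "(real^3) set set"
    and \<omega> :: "'j::finite \<Rightarrow> (real^3) set"
    and \<alpha> \<beta> :: "real^3 \<Rightarrow> real" and \<alpha>m \<alpha>p \<beta>m \<beta>p :: real
  assumes "polyhedral_domain \<Omega>"
    and "tetrahedral_mesh T \<Omega>"
    and "resolved_decomposition T \<Omega> \<omega>"
    and "\<alpha> \<in> borel_measurable (lebesgue_on \<Omega>)" and "\<beta> \<in> borel_measurable (lebesgue_on \<Omega>)"
    and "0 < \<alpha>m" and "0 < \<alpha>p" and "0 < \<beta>m" and "0 < \<beta>p"
    and "\<And>x. x \<in> \<Omega> \<Longrightarrow> \<alpha>m \<le> \<alpha> x \<and> \<alpha> x \<le> \<alpha>p"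
    and "\<And>x. x \<in> \<Omega> \<Longrightarrow> \<beta>m \<le> \<beta> x \<and> \<beta> x \<le> \<beta>p"
  shows "bij_betw (RTR T \<Omega> \<omega> \<alpha> \<beta>) (Vh_skel T \<Omega> \<omega>)
           (dual_space scale_field (Vh_skel T \<Omega> \<omega>)) \<and>
         (\<forall>\<phi> \<in> dual_space scale_field (Vh_skel T \<Omega> \<omega>).
            inv_into (Vh_skel T \<Omega> \<omega>) (RTR T \<Omega> \<omega> \<alpha> \<beta>) \<phi> =
            (trace_glob \<omega> \<circ> inv_into (Vh T \<Omega>) (L_glob T \<Omega> \<alpha> \<beta>)
               \<circ> dual_map (Vh T \<Omega>) (trace_glob \<omega>)) \<phi>)"
proof -
  have "open \<Omega>" "bounded \<Omega>" using assms(1) by (auto simp: polyhedral_domain_def)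
  then interpret fe_problem \<Omega> T \<omega> \<alpha> \<beta> \<alpha>m \<alpha>p \<beta>m \<beta>p
    using assms by unfold_locales auto
  show ?thesis using RTR_inverse by blast
qed

end
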